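(* Let $w=(w_k)_{k\ge0}$ be a weight sequence with $w_k\sim ck^{-\beta}$ as $k\to\infty$ for some $c>0$ and $\beta>2$. Then $\nu<\infty$. Suppose further $m/n\to\lambda>\nu$. Let $\alpha=\beta-1>1$ and $c'=c/\Phi(1)$. (i) $Y_{(1)}=(\lambda-\nu)n+o_p(n)$ and $Y_{(2)}=o_p(n)$. (ii) $Z(m,n)\sim c(\lambda-\nu)^{-\beta}\Phi(1)^{n-1}n^{1-\beta}$. (iii) $(Y_{(1)},Y_{(2)},\dots,Y_{(n)})\approx_d\big(m-\sum_{i=1}^{n-1}\xi_i,\ \xi_{(1)},\dots,\xi_{(n-1)}\big)$, where $\xi_1,\dots,\xi_{n-1}$ are i.i.d. with $P(\xi_i=k)=w_k/\Phi(1)$ and $\xi_{(1)}\ge\dots\ge\xi_{(n-1)}$ are these variables ordered decreasingly. (iv) $Y_{(1)}=m-\nu n+O_p(n^{1/\alpha})$ and $n^{-1/\alpha}(m-\nu n-Y_{(1)})\to X_\alpha$ in distribution, where $X_\alpha$ is an $\alpha$-stable random variable with $E e^{-tX_\alpha}=\exp(c'\Gamma(-\alpha)t^\alpha)$ for $\mathrm{Re}\,t\ge0$. (v) $Y_{(2)}=O_p(n^{1/\alpha})$ and $n^{-1/\alpha}Y_{(2)}\to W$ in distribution, where $P(W\le x)=\exp(-\frac{c'}{\alpha}x^{-\alpha})$, $x\ge0$. (vi) More generally, for each $j\ge2$, $Y_{(j)}=O_p(n^{1/\alpha})$ and $n^{-1/\alpha}Y_{(j)}\to W_j$ in distribution,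 where $W_j$ has density $c'x^{-\alpha-1}\frac{(c'\alpha^{-1}x^{-\alpha})^{j-2}}{(j-2)!}\exp(-c'\alpha^{-1}x^{-\alpha})$, $x\ge0$, and $c'\alpha^{-1}W_j^{-\alpha}$ has the Gamma$(j-1,1)$ distribution.
   Context: A weight sequence is a sequence $w=(w_k)_{k\ge0}$ of nonnegative reals. $\Phi(t)=\sum_kw_kt^k$ (radius of convergence $\rho=1$), $\Psi(t)=t\Phi'(t)/\Phi(t)$, $\nu=\Psi(\rho)$. Balls-in-boxes: $\mathcal B_{m,n}=\{(y_1,\dots,y_n)\in\{0,1,\dots\}^n:\sum y_i=m\}$, weight $w(y)=\prod_iw_{y_i}$, $Z(m,n)=\sum_{y\in\mathcal B_{m,n}}w(y)$; when $Z(m,n)>0$, $B_{m,n}=(Y_1,\dots,Y_n)$ is random with $P(B_{m,n}=y)=w(y)/Z(m,n)$ (only $m,n$ with $Z(m,n)>0$ are considered). $Y_{(1)}\ge\dots\ge Y_{(n)}$ denote $Y_1,\dots,Y_n$ in decreasing order. For random vectors $X_n,X_n'$, $X_n\approx_dX_n'$ means that there is a coupling with $X_n=X_n'$ with probability tending to $1$ (equivalently, total variation distance tends to $0$).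
   Formalization: Part (iv) is stated only for α<2 (that is, 2<β<3): for α>2 the ξ_i have finite positive variance, so Y_(1) fluctuates at order n^{1/2}, not n^{1/α}, and at α=2 the value Γ(−α) is undefined; all other parts are for every β>2. *)

theory Defs
  imports "HOL-Probability.Probability" "HOL-Library.Landau_Symbols"
begin

definition Phi :: "(nat \<Rightarrow> real) \<Rightarrow> real \<Rightarrow> real" where
  "Phi w t = (\<Sum>k. w k * t ^ k)"

definition Psi :: "(nat \<Rightarrow> real) \<Rightarrow> real \<Rightarrow> real" where
  "Psi w t = t * deriv (Phi w) t / Phi w t"

text \<open>nu = Psi(rho) with rho = 1, understood (as in the paper) as the limit of Psi(t) as t increases to 1.\<close>
definition nu :: "(nat \<Rightarrow> real) \<Rightarrow> real" where
  "nu w = Lim (at_left 1) (Psi w)"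

definition BBset :: "nat \<Rightarrow> nat \<Rightarrow> (nat \<Rightarrow> nat) set" where
  "BBset m n = {y. (\<forall>i\<ge>n. y i = 0) \<and> (\<Sum>i<n. y i) = m}"

definition bweight :: "(nat \<Rightarrow> real) \<Rightarrow> nat \<Rightarrow> (nat \<Rightarrow> nat) \<Rightarrow> real" where
  "bweight w n y = (\<Prod>i<n. w (y i))"

definition Zmn :: "(nat \<Rightarrow> real) \<Rightarrow> nat \<Rightarrow> nat \<Rightarrow> real" where
  "Zmn w m n = (\<Sum>y\<in>BBset m n. bweight w n y)"

text \<open>The random allocation B_{m,n} (meaningful when Z(m,n) > 0).\<close>
definition Bmn :: "(nat \<Rightarrow> real) \<Rightarrow> nat \<Rightarrow> nat \<Rightarrow> (nat \<Rightarrow> nat) pmf" where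
  "Bmn w m n = embed_pmf (\<lambda>y. if y \<in> BBset m n then bweight w n y / Zmn w m n else 0)"

definition ordvec :: "nat \<Rightarrow> (nat \<Rightarrow> nat) \<Rightarrow> nat list" where
  "ordvec n y = rev (sort (map y [0..<n]))"

definition ordstat :: "nat \<Rightarrow> (nat \<Rightarrow> nat) \<Rightarrow> nat \<Rightarrow> nat" where
  "ordstat n y j = ordvec n y ! (j - 1)"

definition xi_pmf :: "(nat \<Rightarrow> real) \<Rightarrow> nat pmf" where
  "xi_pmf w = embed_pmf (\<lambda>k. w k / Phi w 1)"

definition tvd :: "'a pmf \<Rightarrow> 'a pmf \<Rightarrow> real" where
  "tvd p q = (SUP A. \<bar>measure_pmf.prob p A - measure_pmf.prob q A\<bar>)"

definition small_op :: "(nat \<Rightarrow> 'a pmf) \<Rightarrow> (nat \<Rightarrow> 'a \<Rightarrow> real) \<Rightarrow> (nat \<Rightarrow> real) \<Rightarrow> bool" where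
  "small_op P X r \<longleftrightarrow>
     (\<forall>\<epsilon>>0. (\<lambda>i. measure_pmf.prob (P i) {y. \<bar>X i y\<bar> > \<epsilon> * r i}) \<longlonglongrightarrow> 0)"

definition big_Op :: "(nat \<Rightarrow> 'a pmf) \<Rightarrow> (nat \<Rightarrow> 'a \<Rightarrow> real) \<Rightarrow> (nat \<Rightarrow> real) \<Rightarrow> bool" where
  "big_Op P X r \<longleftrightarrow>
     (\<forall>\<epsilon>>0. \<exists>K. eventually (\<lambda>i. measure_pmf.prob (P i) {y. \<bar>X i y\<bar> > K * r i} < \<epsilon>) sequentially)"

definition law :: "'a pmf \<Rightarrow> ('a \<Rightarrow> real) \<Rightarrow> real measure" where
  "law p f = distr (measure_pmf p) borel f"

end

theory Submission
  imports Defs "HOL-Real_Asymp.Real_Asymp"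
begin

text \<open>
  With \<open>p\<^sub>k = w\<^sub>k / \<Phi>(1)\<close>, the allocation is an i.i.d. sample of size \<open>n\<close> with law \<open>p\<close>, conditioned on its sum
  \<open>S\<^sub>n\<close> being \<open>m\<close>. The sum has to exceed its mean by about \<open>(\<lambda> - \<nu>) n\<close>, and for a power law the cheapest way is a
  single large value, so that \<open>P(S\<^sub>n = m) \<sim> n p\<^bsub>(\<lambda> - \<nu>) n\<^esub>\<close>. The same computation, uniformly over events, shows
  that up to a vanishing total variation distance the conditioned sample arises from an unconditioned sample of
  size \<open>n - 1\<close> by inserting the missing value \<open>m - S\<^bsub>n-1\<^esub>\<close> at a random place. The remaining claims then concern
  unconditioned samples: the law of large numbers, the Poisson limit for the number of large values, and the
  stable limit of the sum. The latter follows from comparing the Laplace transform of \<open>p\<close> with the binomial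
  series of \<open>(1 - z)\<^sup>\<alpha>\<close>, whose coefficients have the same tail up to a constant factor.
\<close>

section \<open>Independent samples as lists\<close>

abbreviation (input) "Pr \<equiv> measure_pmf.prob"
abbreviation (input) "Mean \<equiv> measure_pmf.expectation"

lemma pmf_replicate_pmf:
  "pmf (replicate_pmf n p) xs = (if length xs = n then prod_list (map (pmf p) xs) else 0)"
proof (induction n arbitrary: xs)
  case (Suc n)
  have eq: "replicate_pmf (Suc n) p = map_pmf (\<lambda>(x, xs). x # xs) (pair_pmf p (replicate_pmf n p))"
    by (simp add: pair_pmf_def map_pmf_def bind_assoc_pmf bind_return_pmf)
  have inj: "inj (\<lambda>(x, xs :: 'a list). x # xs)"
    by (auto simp: inj_def)
  show ?case
  proof (cases xs)
    case Nil
    have "[] \<notin> set_pmf (replicate_pmf (Suc n) p)"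
      by (subst set_replicate_pmf) auto
    then show ?thesis using Nil by (simp del: replicate_pmf.simps add: set_pmf_iff)
  next
    case (Cons y ys)
    have "pmf (replicate_pmf (Suc n) p) ((\<lambda>(x, xs). x # xs) (y, ys)) = pmf p y * pmf (replicate_pmf n p) ys"
      unfolding eq by (subst pmf_map_inj'[OF inj]) (rule pmf_pair)
    then show ?thesis using Cons Suc.IH[of ys] by simp
  qed
qed simp

lemma replicate_pmf_Suc_swap:
  "replicate_pmf (Suc n) p = bind_pmf (replicate_pmf n p) (\<lambda>xs. map_pmf (\<lambda>x. x # xs) p)"
  by (simp add: map_pmf_def) (rule bind_commute_pmf)

lemma prob_replicate_pmf_Suc:
  "Pr (replicate_pmf (Suc n) p) A =
     Mean (replicate_pmf n p) (\<lambda>xs. Pr p {x. x # xs \<in> A})"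
proof -
  have "ennreal (Pr (replicate_pmf (Suc n) p) A) = emeasure (replicate_pmf (Suc n) p) A"
    by (simp only: measure_pmf.emeasure_eq_measure)
  also have "\<dots> = (\<integral>\<^sup>+xs. ennreal (Pr p {x. x # xs \<in> A}) \<partial>replicate_pmf n p)"
    unfolding replicate_pmf_Suc_swap emeasure_bind_pmf
    by (simp add: vimage_def measure_pmf.emeasure_eq_measure)
  also have "\<dots> = ennreal (Mean (replicate_pmf n p) (\<lambda>xs. Pr p {x. x # xs \<in> A}))"
    by (rule nn_integral_eq_integral) (auto intro!: measure_pmf.integrable_const_bound[where B=1])
  finally show ?thesis
    by (subst (asm) ennreal_inj) (auto intro!: integral_nonneg_AE)
qed

definition to_front :: "nat \<Rightarrow> 'a list \<Rightarrow> 'a list" where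
  "to_front j xs = xs ! j # take j xs @ drop (Suc j) xs"

lemma mset_to_front: "j < length xs \<Longrightarrow> mset (to_front j xs) = mset xs"
  by (subst (2) id_take_nth_drop[of j xs]) (auto simp: to_front_def)

lemma length_to_front: "j < length xs \<Longrightarrow> length (to_front j xs) = length xs"
  by (auto simp: to_front_def)

lemma inj_on_to_front:
  assumes "j < n" shows "inj_on (to_front j) {xs. length xs = n}"
proof (rule inj_onI)
  fix xs ys :: "'a list"
  assume *: "xs \<in> {xs. length xs = n}" "ys \<in> {xs. length xs = n}" "to_front j xs = to_front j ys"
  then have "take j xs = take j ys" "drop (Suc j) xs = drop (Suc j) ys" "xs ! j = ys ! j"
    using assms by (auto simp: to_front_def append_eq_append_conv)
  then show "xs = ys"
    using * assms id_take_nth_drop[of j xs] id_take_nth_drop[of j ys] by simp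
qed

lemma to_front_surj:
  assumes "j < n" "length zs = n"
  obtains xs where "length xs = n" "to_front j xs = zs"
proof
  let ?xs = "take j (tl zs) @ hd zs # drop j (tl zs)"
  show "length ?xs = n" using assms by auto
  have [simp]: "length (take j (tl zs)) = j" using assms by auto
  have "?xs ! j = hd zs" by (metis \<open>length (take j (tl zs)) = j\<close> nth_append_length)
  moreover have "take j ?xs = take j (tl zs)" using assms by simp
  moreover have "drop (Suc j) ?xs = drop j (tl zs)" using assms by simp
  ultimately show "to_front j ?xs = zs"
    unfolding to_front_def using assms by (cases zs) auto
qed

lemma map_pmf_to_front:
  assumes "j < n"
  shows "map_pmf (to_front j) (replicate_pmf n p) = replicate_pmf n p"
proof (rule pmf_eqI)
  fix zs
  show "pmf (map_pmf (to_front j) (replicate_pmf n p)) zs = pmf (replicate_pmf n p) zs"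
  proof (cases "zs \<in> set_pmf (map_pmf (to_front j) (replicate_pmf n p))")
    case True
    then obtain xs where xs: "xs \<in> set_pmf (replicate_pmf n p)" "zs = to_front j xs" by auto
    then have len: "length xs = n" by (auto simp: set_replicate_pmf)
    have "pmf (map_pmf (to_front j) (replicate_pmf n p)) (to_front j xs) = pmf (replicate_pmf n p) xs"
      by (rule pmf_map_inj[OF inj_on_subset[OF inj_on_to_front[OF assms]] xs(1)])
         (auto simp: set_replicate_pmf)
    also have "\<dots> = pmf (replicate_pmf n p) (to_front j xs)"
    proof -
      have "mset (map (pmf p) (to_front j xs)) = mset (map (pmf p) xs)"
        using mset_to_front[of j xs] assms len by simp
      then have "prod_list (map (pmf p) (to_front j xs)) = prod_list (map (pmf p) xs)"
        by (metis prod_mset_prod_list)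
      then show ?thesis using assms len length_to_front[of j xs] by (simp add: pmf_replicate_pmf)
    qed
    finally show ?thesis by (simp add: xs)
  next
    case False
    have "zs \<notin> set_pmf (replicate_pmf n p)"
    proof
      assume zs: "zs \<in> set_pmf (replicate_pmf n p)"
      then have "length zs = n" by (auto simp: set_replicate_pmf)
      then obtain xs where xs: "length xs = n" "to_front j xs = zs"
        using to_front_surj[OF assms] by blast
      have "mset xs = mset zs" using mset_to_front[of j xs] xs assms by simp
      then have "set xs = set zs" by (rule mset_eq_setD)
      then have "xs \<in> set_pmf (replicate_pmf n p)"
        using zs xs by (auto simp: set_replicate_pmf)
      then have "to_front j xs \<in> set_pmf (map_pmf (to_front j) (replicate_pmf n p))" by auto
      with False xs show False by simp
    qed
    with False show ?thesis by (simp only: set_pmf_iff not_not)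
  qed
qed

lemma prob_to_front:
  assumes "j < n"
  shows "Pr (replicate_pmf n p) {xs. to_front j xs \<in> A} = Pr (replicate_pmf n p) A"
proof -
  have "Pr (map_pmf (to_front j) (replicate_pmf n p)) A =
      Pr (replicate_pmf n p) {xs. to_front j xs \<in> A}"
    by (simp add: vimage_def)
  then show ?thesis by (simp add: map_pmf_to_front[OF assms])
qed

lemma nn_integral_prod_list_replicate_pmf:
  "(\<integral>\<^sup>+xs. prod_list (map f xs) \<partial>replicate_pmf n p) = (\<integral>\<^sup>+x. f x \<partial>p) ^ n"
  by (induction n) (simp_all add: nn_integral_cmult nn_integral_multc)

lemma AE_replicate_pmf_length: "AE xs in replicate_pmf n p. length xs = n"
  by (auto simp: AE_measure_pmf_iff set_replicate_pmf)

lemma integral_bind_pmf_bounded: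
  fixes f :: "'a \<Rightarrow> complex"
  assumes bd: "\<And>x. norm (f x) \<le> B"
  shows "Mean (bind_pmf M N) f =
    Mean M (\<lambda>x. Mean (N x) f)"
proof -
  have real: "Mean (bind_pmf M N) g =
      Mean M (\<lambda>x. Mean (N x) g)"
    if "\<And>x. \<bar>g x\<bar> \<le> B" for g :: "'a \<Rightarrow> real"
    unfolding measure_pmf_bind
    by (rule integral_bind[where K="count_space UNIV" and B'=1 and B=B])
       (use that in \<open>auto simp: measure_pmf.finite_measure_axioms measure_pmf.emeasure_space_1
         intro!: measure_pmf_in_subprob_space\<close>)
  have int: "integrable (measure_pmf q) f" for q
    by (rule measure_pmf.integrable_const_bound[where B=B]) (auto simp: bd)
  have int2: "integrable M (\<lambda>x. Mean (N x) f)"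
  proof (rule measure_pmf.integrable_const_bound[where B=B])
    have "norm (Mean (N x) f) \<le> B" for x
    proof -
      have "norm (Mean (N x) f) \<le> Mean (N x) (\<lambda>y. norm (f y))"
        by (rule integral_norm_bound)
      also have "\<dots> \<le> Mean (N x) (\<lambda>y. B)"
        by (rule integral_mono) (auto simp: bd int)
      finally show ?thesis by simp
    qed
    then show "AE x in M. norm (Mean (N x) f) \<le> B" by simp
  qed simp
  have "\<bar>Re (f x)\<bar> \<le> B" "\<bar>Im (f x)\<bar> \<le> B" for x
    using bd[of x] abs_Re_le_cmod[of "f x"] abs_Im_le_cmod[of "f x"] by linarith+
  then show ?thesis
    using real[of "\<lambda>x. Re (f x)"] real[of "\<lambda>x. Im (f x)"]
    by (simp add: complex_eq_iff int int2)
qed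

lemma norm_prod_list_le_1:
  fixes f :: "'a \<Rightarrow> complex"
  assumes "\<And>x. norm (f x) \<le> 1"
  shows "norm (prod_list (map f xs)) \<le> 1"
  using assms by (induction xs) (auto simp: norm_mult intro!: mult_le_one)

lemma integral_prod_list_replicate_pmf:
  fixes f :: "'a \<Rightarrow> complex"
  assumes "\<And>x. norm (f x) \<le> 1"
  shows "Mean (replicate_pmf n p) (\<lambda>xs. prod_list (map f xs)) = Mean p f ^ n"
proof (induction n)
  case (Suc n)
  have "Mean (replicate_pmf (Suc n) p) (\<lambda>xs. prod_list (map f xs))
     = Mean p (\<lambda>x. Mean (replicate_pmf n p) (\<lambda>xs. f x * prod_list (map f xs)))"
    using norm_prod_list_le_1[of f] assms
    by (simp add: integral_bind_pmf_bounded[where B=1] map_pmf_def[symmetric])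
  also have "\<dots> = Mean p f * Mean p f ^ n"
    by (simp add: Suc.IH)
  finally show ?case by simp
qed simp

section \<open>Samples with power-law tails\<close>

lemma pmf_dominated_convergence:
  fixes f :: "nat \<Rightarrow> 'a \<Rightarrow> 'b::{banach, second_countable_topology}"
  assumes "integrable (measure_pmf p) g"
    and ev: "eventually (\<lambda>n. \<forall>x. norm (f n x) \<le> g x) sequentially"
    and lim: "\<And>x. (\<lambda>n. f n x) \<longlonglongrightarrow> h x"
  shows "(\<lambda>n. Mean p (f n)) \<longlonglongrightarrow> Mean p h"
proof -
  obtain N where N: "\<And>n x. n \<ge> N \<Longrightarrow> norm (f n x) \<le> g x"
    using ev by (auto simp: eventually_sequentially)
  have "(\<lambda>n. Mean p (f (n + N))) \<longlonglongrightarrow> Mean p h"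
    by (rule integral_dominated_convergence[where w=g])
       (use assms(1) N lim in \<open>auto intro!: LIMSEQ_ignore_initial_segment\<close>)
  then show ?thesis by (rule LIMSEQ_offset)
qed

lemma integrable_pmf_nat_iff:
  fixes f :: "nat \<Rightarrow> real"
  shows "integrable (measure_pmf p) f \<longleftrightarrow> summable (\<lambda>k. norm (pmf p k * f k))"
  unfolding measure_pmf_eq_density
  by (subst integrable_density) (auto simp: integrable_count_space_nat_iff)

lemma integral_pmf_nat_sums:
  fixes f :: "nat \<Rightarrow> 'b::{banach, second_countable_topology}"
  assumes "integrable (measure_pmf p) f"
  shows "(\<lambda>k. pmf p k *\<^sub>R f k) sums Mean p f"
proof -
  have "integrable (count_space UNIV) (\<lambda>k. pmf p k *\<^sub>R f k)"
    using assms unfolding measure_pmf_eq_density by (subst (asm) integrable_density) auto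
  from sums_integral_count_space_nat[OF this] show ?thesis
    unfolding measure_pmf_eq_density by (subst integral_density) auto
qed

lemma tendsto_one_plus_over_n_power_exp:
  fixes a :: "nat \<Rightarrow> complex"
  assumes a: "a \<longlonglongrightarrow> l"
  shows "(\<lambda>n. (1 + a n / of_nat n) ^ n) \<longlonglongrightarrow> exp l"
proof -
  have "(Ln has_field_derivative 1) (at 1)"
    using has_field_derivative_Ln[of 1] by simp
  then obtain g where g: "\<And>z. Ln z - Ln 1 = g z * (z - 1)" "isCont g 1" "g 1 = 1"
    unfolding CARAT_DERIV by blast
  have z0: "(\<lambda>n. 1 + a n / of_nat n) \<longlonglongrightarrow> 1 + 0"
    by (intro tendsto_intros tendsto_divide_0[OF a] tendsto_of_nat)
  then have g1: "(\<lambda>n. g (1 + a n / of_nat n)) \<longlonglongrightarrow> 1"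
    using isCont_tendsto_compose[OF g(2), of "\<lambda>n. 1 + a n / of_nat n"] g(3) by simp
  have "(\<lambda>n. exp (g (1 + a n / of_nat n) * a n)) \<longlonglongrightarrow> exp (1 * l)"
    by (intro tendsto_intros g1 a)
  moreover have "eventually (\<lambda>n. exp (g (1 + a n / of_nat n) * a n) = (1 + a n / of_nat n) ^ n) sequentially"
  proof -
    have "eventually (\<lambda>n. 1 + a n / of_nat n \<noteq> 0) sequentially"
      using z0 by (intro tendsto_imp_eventually_ne[OF z0]) auto
    then show ?thesis using eventually_gt_at_top[of 0]
    proof eventually_elim
      case (elim n)
      let ?z = "1 + a n / of_nat n"
      have "?z ^ n = exp (Ln ?z) ^ n" using elim by simp
      also have "\<dots> = exp (of_nat n * Ln ?z)" by (simp add: exp_of_nat_mult)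
      also have "Ln ?z = g ?z * (a n / of_nat n)" using g(1)[of ?z] by simp
      also have "of_nat n * (g ?z * (a n / of_nat n)) = g ?z * a n" using elim by simp
      finally show ?case by simp
    qed
  qed
  ultimately show ?thesis by (auto intro: Lim_transform_eventually)
qed

lemma tail_sum_quotient_tendsto:
  fixes f d :: "nat \<Rightarrow> real"
  assumes lim: "(\<lambda>k. f k / d k) \<longlonglongrightarrow> L" and pos: "\<And>k. k \<ge> 1 \<Longrightarrow> d k > 0"
    and sf: "summable f" and sd: "summable d"
  shows "(\<lambda>N. (\<Sum>k. f (k + N)) / (\<Sum>k. d (k + N))) \<longlonglongrightarrow> L"
proof (rule LIMSEQ_I)
  fix e :: real assume e: "e > 0"
  from LIMSEQ_D[OF lim, of "e/2"] e obtain N0 where N0: "\<And>k. k \<ge> N0 \<Longrightarrow> norm (f k / d k - L) < e/2"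
    by auto
  show "\<exists>no. \<forall>n\<ge>no. norm ((\<Sum>k. f (k + n)) / (\<Sum>k. d (k + n)) - L) < e"
  proof (intro exI allI impI)
    fix n assume n: "n \<ge> max N0 1"
    have sf': "summable (\<lambda>k. f (k + n))" and sd': "summable (\<lambda>k. d (k + n))"
      using sf sd by (simp_all add: summable_iff_shift)
    have dpos: "d (k + n) > 0" for k using n pos by auto
    have Dpos: "(\<Sum>k. d (k + n)) > 0" using sd' dpos by (intro suminf_pos) auto
    have b: "f (k + n) \<le> (L + e/2) * d (k + n)" "(L - e/2) * d (k + n) \<le> f (k + n)" for k
    proof -
      have "f (k + n) / d (k + n) \<le> L + e/2" "L - e/2 \<le> f (k + n) / d (k + n)"
        using N0[of "k + n"] n unfolding real_norm_def abs_less_iff by linarith+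
      then show "f (k + n) \<le> (L + e/2) * d (k + n)" "(L - e/2) * d (k + n) \<le> f (k + n)"
        using dpos[of k] by (simp_all only: pos_divide_le_eq pos_le_divide_eq)
    qed
    have "(\<Sum>k. f (k + n)) \<le> (\<Sum>k. (L + e/2) * d (k + n))"
      by (rule suminf_le) (use b sf' sd' in \<open>auto intro!: summable_mult\<close>)
    moreover have "(\<Sum>k. (L - e/2) * d (k + n)) \<le> (\<Sum>k. f (k + n))"
      by (rule suminf_le) (use b sf' sd' in \<open>auto intro!: summable_mult\<close>)
    ultimately have "(\<Sum>k. f (k + n)) / (\<Sum>k. d (k + n)) \<le> L + e/2"
      "L - e/2 \<le> (\<Sum>k. f (k + n)) / (\<Sum>k. d (k + n))"
      unfolding suminf_mult[OF sd'] using Dpos by (simp_all only: pos_divide_le_eq pos_le_divide_eq)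
    then have "\<bar>(\<Sum>k. f (k + n)) / (\<Sum>k. d (k + n)) - L\<bar> \<le> e/2"
      unfolding abs_le_iff by linarith
    then show "norm ((\<Sum>k. f (k + n)) / (\<Sum>k. d (k + n)) - L) < e" using e by simp
  qed
qed

locale heavy_tail =
  fixes p :: "nat pmf" and c \<beta> :: real
  assumes c_pos: "c > 0" and beta: "\<beta> > 2"
    and p_asymp: "(\<lambda>k. pmf p k * real k powr \<beta>) \<longlonglongrightarrow> c"
begin

abbreviation \<alpha> where "\<alpha> \<equiv> \<beta> - 1"

abbreviation "R \<equiv> \<lambda>N. replicate_pmf N p"

definition "mu = Mean p real"

lemma pmf_le_powr: obtains C where "C > 0" "\<And>k. pmf p k * real k powr \<beta> \<le> C"
proof -
  have "Bseq (\<lambda>k. pmf p k * real k powr \<beta>)"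
    using p_asymp by (intro convergent_imp_Bseq) (auto simp: convergent_def)
  then show ?thesis using that by (elim BseqE) (auto simp: abs_le_iff)
qed

lemma integrable_powr:
  assumes "s < \<alpha>" shows "integrable p (\<lambda>k. real k powr s)"
proof -
  obtain C where C: "C > 0" "\<And>k. pmf p k * real k powr \<beta> \<le> C" using pmf_le_powr by blast
  have S: "summable (\<lambda>k. C * real k powr (s - \<beta>))"
    using assms by (intro summable_mult) (simp add: summable_real_powr_iff)
  have B: "norm (pmf p k * real k powr s) \<le> C * real k powr (s - \<beta>)" for k
  proof (cases "k = 0")
    case False
    then have "pmf p k * real k powr s = (pmf p k * real k powr \<beta>) * real k powr (s - \<beta>)"
      by (simp add: powr_diff)
    also have "\<dots> \<le> C * real k powr (s - \<beta>)" using C by (intro mult_right_mono) auto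
    finally show ?thesis by simp
  qed simp
  show ?thesis
    unfolding integrable_pmf_nat_iff
    by (rule summable_comparison_test'[OF S, of 0]) (use B in simp)
qed

lemma integrable_real: "integrable p real"
proof -
  have "(\<lambda>k. real k powr 1) = real" by (auto simp: fun_eq_iff)
  then show ?thesis using integrable_powr[of 1] beta by simp
qed

lemma mu_nonneg: "mu \<ge> 0"
  unfolding mu_def by simp

lemma tail_nat: "(\<lambda>N. Pr p {N..} * real N powr \<alpha>) \<longlonglongrightarrow> c / \<alpha>"
proof -
  define d where "d k = real k powr (-\<alpha>) - real (Suc k) powr (-\<alpha>)" for k
  have dsum: "(\<lambda>k. d (k + N)) sums (real N powr (-\<alpha>))" for N
  proof -
    have "(\<lambda>k. real k powr (-\<alpha>)) \<longlonglongrightarrow> 0" using beta by real_asymp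
    then have "(\<lambda>k. real (k + N) powr (-\<alpha>)) \<longlonglongrightarrow> 0" by (rule LIMSEQ_ignore_initial_segment)
    from telescope_sums'[OF this] show ?thesis by (simp add: d_def)
  qed
  have "(\<lambda>k. (\<alpha> * real k powr (-\<beta>)) / d k) \<longlonglongrightarrow> 1"
    unfolding d_def using beta by real_asymp
  from tendsto_mult[OF p_asymp tendsto_divide[OF this tendsto_const, of \<alpha>]]
  have *: "(\<lambda>k. pmf p k * real k powr \<beta> * (\<alpha> * real k powr (-\<beta>) / d k / \<alpha>)) \<longlonglongrightarrow> c / \<alpha>"
    using beta by simp
  have "(\<lambda>k. pmf p k / d k) \<longlonglongrightarrow> c / \<alpha>"
  proof (rule Lim_transform_eventually[OF *], rule eventually_mono[OF eventually_gt_at_top[of 0]])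
    fix k :: nat assume "k > 0"
    moreover have "a * x * (al * inverse x / y / al) = a / y" if "x \<noteq> 0" "al \<noteq> 0" for a x y al :: real
      using that by simp
    ultimately show "pmf p k * real k powr \<beta> * (\<alpha> * real k powr (-\<beta>) / d k / \<alpha>) = pmf p k / d k"
      using beta by (simp only: powr_minus) simp
  qed
  moreover have "d k > 0" if "k \<ge> 1" for k
    using that beta unfolding d_def by (auto intro!: powr_less_mono2_neg)
  moreover have sp: "summable (pmf p)"
    using integrable_pmf_nat_iff[of p "\<lambda>_. 1"] by simp
  moreover have "summable d" using dsum[of 0] by (auto simp: sums_iff)
  ultimately have "(\<lambda>N. (\<Sum>k. pmf p (k + N)) / (\<Sum>k. d (k + N))) \<longlonglongrightarrow> c / \<alpha>"
    by (intro tail_sum_quotient_tendsto)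
  moreover have "(\<Sum>k. pmf p (k + N)) = Pr p {N..}" for N
  proof -
    have "(\<lambda>k. pmf p k *\<^sub>R indicator {N..} k) sums Mean p (indicator {N..} :: nat \<Rightarrow> real)"
      by (rule integral_pmf_nat_sums) (auto intro!: measure_pmf.integrable_const_bound[where B=1])
    then have "(\<lambda>k. pmf p (k + N) *\<^sub>R indicator {N..} (k + N)) sums (Pr p {N..} - (\<Sum>k<N. pmf p k *\<^sub>R indicator {N..} k))"
      by (subst sums_iff_shift) simp
    moreover have "(\<Sum>k<N. pmf p k *\<^sub>R indicator {N..} k) = (0::real)"
      by (intro sum.neutral) auto
    ultimately show ?thesis by (simp add: sums_iff)
  qed
  moreover have "(\<Sum>k. d (k + N)) = real N powr (-\<alpha>)" for N
    using dsum[of N] by (simp add: sums_iff)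
  ultimately have "(\<lambda>N. Pr p {N..} / real N powr (-\<alpha>)) \<longlonglongrightarrow> c / \<alpha>" by simp
  moreover have "Pr p {N..} / real N powr (-\<alpha>) = Pr p {N..} * real N powr \<alpha>" for N
    by (subst powr_minus_divide) simp
  ultimately show ?thesis by simp
qed

lemma tail_real: "((\<lambda>y. Pr p {k. real k > y} * y powr \<alpha>) \<longlongrightarrow> c / \<alpha>) at_top"
proof -
  have fl: "filterlim (\<lambda>y::real. nat \<lfloor>y\<rfloor> + 1) at_top at_top" by real_asymp
  from filterlim_compose[OF tail_nat fl]
  have 1: "((\<lambda>y::real. Pr p {nat \<lfloor>y\<rfloor> + 1..} * real (nat \<lfloor>y\<rfloor> + 1) powr \<alpha>) \<longlongrightarrow> c / \<alpha>) at_top" .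
  have 2: "((\<lambda>y::real. (y / real (nat \<lfloor>y\<rfloor> + 1)) powr \<alpha>) \<longlongrightarrow> 1) at_top"
  proof -
    have "((\<lambda>y::real. y / real (nat \<lfloor>y\<rfloor> + 1)) \<longlongrightarrow> 1) at_top" by real_asymp
    from tendsto_powr[OF this tendsto_const, of \<alpha>] show ?thesis by simp
  qed
  have "((\<lambda>y::real. Pr p {nat \<lfloor>y\<rfloor> + 1..} * real (nat \<lfloor>y\<rfloor> + 1) powr \<alpha> * (y / real (nat \<lfloor>y\<rfloor> + 1)) powr \<alpha>) \<longlongrightarrow> c / \<alpha>) at_top"
    using tendsto_mult[OF 1 2] by simp
  moreover have "eventually (\<lambda>y::real. Pr p {nat \<lfloor>y\<rfloor> + 1..} * real (nat \<lfloor>y\<rfloor> + 1) powr \<alpha> * (y / real (nat \<lfloor>y\<rfloor> + 1)) powr \<alpha> = Pr p {k. real k > y} * y powr \<alpha>) at_top"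
    using eventually_gt_at_top[of 0]
  proof eventually_elim
    case (elim y)
    have "{nat \<lfloor>y\<rfloor> + 1..} = {k. real k > y}"
      using elim by (auto; linarith)
    moreover have "real (nat \<lfloor>y\<rfloor> + 1) > 0" by simp
    ultimately show ?case using elim by (simp only: powr_divide order_less_imp_le) simp
  qed
  ultimately show ?thesis by (rule Lim_transform_eventually)
qed

lemma laplace_replicate:
  fixes t :: complex assumes "Re t \<ge> 0"
  shows "Mean (R N) (\<lambda>xs. exp (- t * of_nat (sum_list xs)))
     = Mean p (\<lambda>k. exp (- t * of_nat k)) ^ N"
proof -
  have eq: "exp (- t * of_nat (sum_list xs)) = prod_list (map (\<lambda>k. exp (- t * of_nat k)) xs)" for xs :: "nat list"
  proof (induction xs)
    case (Cons a xs)
    have "exp (- t * of_nat (sum_list (a # xs))) = exp (- t * of_nat a + - t * of_nat (sum_list xs))"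
      by (simp add: algebra_simps)
    also have "\<dots> = exp (- t * of_nat a) * exp (- t * of_nat (sum_list xs))"
      by (rule exp_add)
    finally show ?case by (simp only: Cons.IH list.map prod_list.Cons)
  qed simp
  show ?thesis unfolding eq
    by (rule integral_prod_list_replicate_pmf) (use assms in simp)
qed

lemma laplace_replicate_real:
  fixes t :: real assumes "t \<ge> 0"
  shows "Mean (R N) (\<lambda>xs. exp (- t * real (sum_list xs)))
     = Mean p (\<lambda>k. exp (- t * real k)) ^ N"
proof -
  have eq: "exp (- complex_of_real t * of_nat k) = complex_of_real (exp (- t * real k))" for k
    by (simp add: exp_of_real[symmetric])
  have "complex_of_real (Mean (R N) (\<lambda>xs. exp (- t * real (sum_list xs))))
     = complex_of_real (Mean p (\<lambda>k. exp (- t * real k)) ^ N)"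
    using laplace_replicate[of "complex_of_real t" N] assms
    unfolding eq integral_complex_of_real by simp
  then show ?thesis by (simp only: of_real_eq_iff)
qed

lemma laplace_scaled_tendsto:
  fixes t :: real assumes t: "t \<ge> 0"
  shows "(\<lambda>N. Mean (R N) (\<lambda>xs. exp (- t * ((real (sum_list xs) - real N * mu) / real N)))) \<longlonglongrightarrow> 1"
proof -
  define L where "L s = Mean p (\<lambda>k. exp (- s * real k))" for s :: real
  have int: "integrable p (\<lambda>k. exp (- s * real k))" if "s \<ge> 0" for s :: real
    by (rule measure_pmf.integrable_const_bound[where B=1]) (use that in auto)
  have "(\<lambda>N. Mean p (\<lambda>k. real N * (exp (- (t / real N) * real k) - 1))) \<longlonglongrightarrow> Mean p (\<lambda>k. - t * real k)"
  proof (rule pmf_dominated_convergence[where g="\<lambda>k. t * real k"])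
    show "integrable p (\<lambda>k. t * real k)" by (intro integrable_mult_right integrable_real)
    have "norm (real N * (exp (- (t / real N) * real k) - 1)) \<le> t * real k" if "N > 0" for N k
    proof -
      have "exp (- (t / real N) * real k) \<ge> 1 + - (t / real N) * real k" by (rule exp_ge_add_one_self)
      then have "1 - exp (- (t / real N) * real k) \<le> (t / real N) * real k" by simp
      then have "real N * (1 - exp (- (t / real N) * real k)) \<le> real N * ((t / real N) * real k)"
        by (rule mult_left_mono) simp
      moreover have "exp (- (t / real N) * real k) \<le> 1" using t by simp
      then have "norm (real N * (exp (- (t / real N) * real k) - 1)) = real N * (1 - exp (- (t / real N) * real k))"
        unfolding real_norm_def abs_mult by simp
      ultimately show ?thesis using that by simp
    qed
    then show "eventually (\<lambda>N. \<forall>k. norm (real N * (exp (- (t / real N) * real k) - 1)) \<le> t * real k) sequentially"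
      by (intro eventually_mono[OF eventually_gt_at_top[of 0]]) auto
    show "(\<lambda>N. real N * (exp (- (t / real N) * real k) - 1)) \<longlonglongrightarrow> - t * real k" for k
      by real_asymp
  qed
  also have "Mean p (\<lambda>k. - t * real k) = - t * mu" by (simp add: mu_def)
  also have "(\<lambda>N. Mean p (\<lambda>k. real N * (exp (- (t / real N) * real k) - 1)))
      = (\<lambda>N. real N * (L (t / real N) - 1))"
  proof
    fix N
    show "Mean p (\<lambda>k. real N * (exp (- (t / real N) * real k) - 1)) = real N * (L (t / real N) - 1)"
      using int[of "t / real N"] t by (simp add: L_def)
  qed
  finally have lim: "(\<lambda>N. real N * (L (t / real N) - 1)) \<longlonglongrightarrow> - t * mu" .
  have "(\<lambda>N. (1 + complex_of_real (real N * (L (t / real N) - 1)) / of_nat N) ^ N) \<longlonglongrightarrow> exp (complex_of_real (- t * mu))"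
    by (intro tendsto_one_plus_over_n_power_exp tendsto_of_real lim)
  then have "(\<lambda>N. complex_of_real ((1 + (real N * (L (t / real N) - 1)) / real N) ^ N)) \<longlonglongrightarrow> complex_of_real (exp (- t * mu))"
    by (simp only: of_real_power of_real_add of_real_divide of_real_1 of_real_of_nat_eq exp_of_real)
  then have "(\<lambda>N. (1 + (real N * (L (t / real N) - 1)) / real N) ^ N) \<longlonglongrightarrow> exp (- t * mu)"
    by (simp only: tendsto_of_real_iff)
  moreover have "eventually (\<lambda>N. (1 + (real N * (L (t / real N) - 1)) / real N) ^ N = L (t / real N) ^ N) sequentially"
    using eventually_gt_at_top[of 0] by eventually_elim simp
  ultimately have "(\<lambda>N. L (t / real N) ^ N) \<longlonglongrightarrow> exp (- t * mu)"
    by (rule Lim_transform_eventually)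
  from tendsto_mult[OF tendsto_const[of "exp (t * mu)"] this]
  have "(\<lambda>N. exp (t * mu) * L (t / real N) ^ N) \<longlonglongrightarrow> 1" by (simp add: exp_minus)
  moreover have "eventually (\<lambda>N. exp (t * mu) * L (t / real N) ^ N =
     Mean (R N) (\<lambda>xs. exp (- t * ((real (sum_list xs) - real N * mu) / real N)))) sequentially"
    using eventually_gt_at_top[of 0]
  proof eventually_elim
    case (elim N)
    have "exp (- t * ((real (sum_list xs) - real N * mu) / real N)) = exp (t * mu) * exp (- (t / real N) * real (sum_list xs))" for xs
    proof -
      have "- t * ((real (sum_list xs) - real N * mu) / real N) = t * mu + - (t / real N) * real (sum_list xs)"
        using elim by (simp add: field_simps)
      then show ?thesis by (simp only: exp_add)
    qed
    then show ?case using laplace_replicate_real[of "t / real N" N] t by (simp add: L_def)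
  qed
  ultimately show ?thesis by (rule Lim_transform_eventually)
qed

lemma integrable_laplace:
  assumes "t \<ge> 0" "s \<ge> 0" shows "integrable (R N) (\<lambda>xs. exp (- t * (real (sum_list xs) * s - b)))"
  by (rule measure_pmf.integrable_const_bound[where B="exp (t * b)"])
     (use assms in \<open>auto simp: algebra_simps\<close>)

text \<open>The variance may be infinite. Instead, \<open>E (exp (- Y) - 1)\<^sup>2\<close> is expressed through the Laplace
  transform of the centred and scaled sum \<open>Y\<close> at 1 and 2.\<close>

lemma weak_law:
  assumes e: "e > 0"
  shows "(\<lambda>N. Pr (R N) {xs. \<bar>real (sum_list xs) - real N * mu\<bar> > e * real N}) \<longlonglongrightarrow> 0"
proof -
  define X where "X N xs = (real (sum_list xs) - real N * mu) / real N" for N xs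
  define d where "d = (1 - exp (- e))\<^sup>2"
  have d: "d > 0" using e by (simp add: d_def)
  have int: "integrable (R N) (\<lambda>xs. exp (- t * X N xs))" if "t \<ge> 0" for t N
    using integrable_laplace[OF that, of "1 / real N" N "real N * mu / real N"]
    by (simp add: X_def diff_divide_distrib)
  have eq: "(exp (- X N xs) - 1)\<^sup>2 = exp (- 2 * X N xs) - 2 * exp (- 1 * X N xs) + 1" for N xs
    by (simp add: power2_diff exp_double[symmetric])
  have int2: "integrable (R N) (\<lambda>xs. (exp (- X N xs) - 1)\<^sup>2)" for N
    unfolding eq by (intro Bochner_Integration.integrable_add Bochner_Integration.integrable_diff integrable_mult_right int) auto
  have "Mean (R N) (\<lambda>xs. (exp (- X N xs) - 1)\<^sup>2) =
     Mean (R N) (\<lambda>xs. exp (- 2 * X N xs)) - 2 * Mean (R N) (\<lambda>xs. exp (- 1 * X N xs)) + 1" for N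
    unfolding eq using int[of 1 N] int[of 2 N] by simp
  moreover have "(\<lambda>N. Mean (R N) (\<lambda>xs. exp (- 2 * X N xs)) - 2 * Mean (R N) (\<lambda>xs. exp (- 1 * X N xs)) + 1) \<longlonglongrightarrow> 1 - 2 * 1 + 1"
    unfolding X_def by (intro tendsto_intros laplace_scaled_tendsto) auto
  ultimately have A: "(\<lambda>N. Mean (R N) (\<lambda>xs. (exp (- X N xs) - 1)\<^sup>2) / d) \<longlonglongrightarrow> 0 / d"
    by (intro tendsto_divide) (use d in auto)
  have B: "eventually (\<lambda>N. Pr (R N) {xs. \<bar>real (sum_list xs) - real N * mu\<bar> > e * real N} \<le> Mean (R N) (\<lambda>xs. (exp (- X N xs) - 1)\<^sup>2) / d) sequentially"
    using eventually_gt_at_top[of 0]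
  proof eventually_elim
    case (elim N)
    have "{xs. \<bar>real (sum_list xs) - real N * mu\<bar> > e * real N} \<subseteq> {xs \<in> space (R N). (exp (- X N xs) - 1)\<^sup>2 \<ge> d}"
    proof
      fix xs :: "nat list" assume "xs \<in> {xs. \<bar>real (sum_list xs) - real N * mu\<bar> > e * real N}"
      then have "\<bar>real (sum_list xs) - real N * mu\<bar> / real N > e" using elim by (simp add: field_simps)
      then have X: "\<bar>X N xs\<bar> > e" using elim by (simp add: X_def abs_divide)
      have "\<bar>exp (- X N xs) - 1\<bar> \<ge> 1 - exp (- e)"
      proof (cases "X N xs > 0")
        case True
        then have "exp (- X N xs) \<le> exp (- e)" using X by simp
        then show ?thesis by linarith
      next
        case False
        then have "exp (- X N xs) \<ge> exp e" using X by simp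
        moreover have "exp e + exp (-e) \<ge> 2" using exp_ge_add_one_self[of e] exp_ge_add_one_self[of "-e"] by linarith
        ultimately show ?thesis by linarith
      qed
      then have "(1 - exp (-e))\<^sup>2 \<le> \<bar>exp (- X N xs) - 1\<bar>\<^sup>2"
        by (rule power_mono) (use e in simp)
      then show "xs \<in> {xs \<in> space (R N). (exp (- X N xs) - 1)\<^sup>2 \<ge> d}" by (simp add: d_def)
    qed
    then have "Pr (R N) {xs. \<bar>real (sum_list xs) - real N * mu\<bar> > e * real N} \<le>
       Pr (R N) {xs \<in> space (R N). (exp (- X N xs) - 1)\<^sup>2 \<ge> d}"
      by (intro measure_pmf.finite_measure_mono) auto
    also have "\<dots> \<le> Mean (R N) (\<lambda>xs. (exp (- X N xs) - 1)\<^sup>2) / d"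
      by (rule integral_Markov_inequality_measure[where A="{}"]) (use d int2 in auto)
    finally show ?case .
  qed
  show ?thesis
    using tendsto_sandwich[OF _ B tendsto_const, of 0] A by simp
qed

text \<open>Dominated convergence applies because \<open>exp (s k) \<le> k powr ((\<beta> - 2) / 2)\<close> for \<open>3 \<le> k \<le> \<delta> n\<close>, where
  \<open>s = K ln n / n\<close>: the function \<open>ln x / x\<close> is decreasing.\<close>

lemma exp_moment_truncated:
  assumes K: "K > 0"
  shows "(\<lambda>n. Mean p (\<lambda>k. if real k \<le> ((\<beta> - 2) / (4 * K)) * real n
       then (exp (K * ln (real n) / real n * real k) - 1) / (K * ln (real n) / real n) else 0)) \<longlonglongrightarrow> mu"
proof -
  define \<gamma> where "\<gamma> = (\<beta> - 2) / 2"
  define \<delta> where "\<delta> = \<gamma> / (2 * K)"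
  define s where "s n = K * ln (real n) / real n" for n :: nat
  have g: "\<gamma> > 0" using beta by (simp add: \<gamma>_def)
  have dl: "\<delta> > 0" using g K by (simp add: \<delta>_def)
  have "(\<lambda>n. Mean p (\<lambda>k. if real k \<le> \<delta> * real n then (exp (s n * real k) - 1) / s n else 0)) \<longlonglongrightarrow> Mean p real"
  proof (rule pmf_dominated_convergence[where g="\<lambda>k. exp 2 * real k + real k powr (1 + \<gamma>)"])
    show "integrable p (\<lambda>k. exp 2 * real k + real k powr (1 + \<gamma>))"
      using beta by (intro Bochner_Integration.integrable_add integrable_mult_right integrable_real integrable_powr)
        (simp add: \<gamma>_def field_simps)
    have s0: "eventually (\<lambda>n. s n > 0) sequentially"
      unfolding s_def using K by real_asymp
    have s1: "eventually (\<lambda>n. s n < 1) sequentially"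
      unfolding s_def using K by real_asymp
    have l: "eventually (\<lambda>n. ln \<delta> + ln (real n) \<ge> ln (real n) / 2) sequentially"
      by real_asymp
    show "eventually (\<lambda>n. \<forall>k. norm (if real k \<le> \<delta> * real n then (exp (s n * real k) - 1) / s n else 0) \<le> exp 2 * real k + real k powr (1 + \<gamma>)) sequentially"
      using s0 s1 l eventually_gt_at_top[of 0]
    proof eventually_elim
      case (elim n)
      show ?case
      proof
        fix k :: nat
        have nn: "exp 2 * real k + real k powr (1 + \<gamma>) \<ge> 0" by simp
        have e1: "(exp (s n * real k) - 1) / s n \<le> real k * exp (s n * real k)"
        proof -
          have "1 - s n * real k \<le> exp (- (s n * real k))" using exp_ge_add_one_self[of "- (s n * real k)"] by simp
          then have "(1 - s n * real k) * exp (s n * real k) \<le> exp (- (s n * real k)) * exp (s n * real k)"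
            by (intro mult_right_mono) auto
          then have "exp (s n * real k) - 1 \<le> s n * real k * exp (s n * real k)"
            by (simp add: exp_minus algebra_simps)
          then show ?thesis using elim by (simp add: field_simps)
        qed
        have e0: "(exp (s n * real k) - 1) / s n \<ge> 0" using elim by simp
        have e2: "real k * exp (s n * real k) \<le> exp 2 * real k + real k powr (1 + \<gamma>)" if k: "real k \<le> \<delta> * real n"
        proof (cases "k \<le> 2")
          case True
          then have "s n * real k \<le> 1 * 2" using elim by (intro mult_mono) auto
          then have "exp (s n * real k) \<le> exp 2" by simp
          then have "real k * exp (s n * real k) \<le> real k * exp 2" by (rule mult_left_mono) simp
          then show ?thesis by (simp add: mult.commute add_increasing2)
        next
          case False
          then have k3: "real k \<ge> 3" by simp
          have "ln (\<delta> * real n) / (\<delta> * real n) \<le> ln (real k) / real k"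
            by (rule ln_x_over_x_mono) (use k k3 exp_le in auto)
          then have "\<gamma> * real k * (ln (\<delta> * real n) / (\<delta> * real n)) \<le> \<gamma> * real k * (ln (real k) / real k)"
            using g by (intro mult_left_mono) auto
          then have "\<gamma> * real k * (ln (\<delta> * real n) / (\<delta> * real n)) \<le> \<gamma> * ln (real k)" using k3 by simp
          moreover have "s n * real k \<le> \<gamma> * real k * (ln (\<delta> * real n) / (\<delta> * real n))"
          proof -
            have "ln (real n) / 2 \<le> ln (\<delta> * real n)" using elim dl by (simp add: ln_mult)
            then have "\<gamma> * real k * (ln (real n) / 2 / (\<delta> * real n)) \<le> \<gamma> * real k * (ln (\<delta> * real n) / (\<delta> * real n))"
              using g dl by (intro mult_left_mono divide_right_mono) auto
            moreover have "\<gamma> * real k * (ln (real n) / 2 / (\<delta> * real n)) = s n * real k"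
              using K g elim by (simp add: \<delta>_def s_def field_simps)
            ultimately show ?thesis by simp
          qed
          ultimately have "exp (s n * real k) \<le> real k powr \<gamma>" using k3 by (simp add: powr_def)
          then have "real k * exp (s n * real k) \<le> real k * real k powr \<gamma>" by (rule mult_left_mono) simp
          also have "\<dots> = real k powr (1 + \<gamma>)" using k3 by (simp add: powr_add)
          finally show ?thesis by (simp add: add_increasing)
        qed
        show "norm (if real k \<le> \<delta> * real n then (exp (s n * real k) - 1) / s n else 0) \<le> exp 2 * real k + real k powr (1 + \<gamma>)"
          using nn e0 e1 e2 by (auto intro: order_trans)
      qed
    qed
    show "(\<lambda>n. if real k \<le> \<delta> * real n then (exp (s n * real k) - 1) / s n else 0) \<longlonglongrightarrow> real k" for k
    proof (rule Lim_transform_eventually)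
      show "(\<lambda>n. (exp (s n * real k) - 1) / s n) \<longlonglongrightarrow> real k"
        unfolding s_def using K by real_asymp
      have "eventually (\<lambda>n. real k \<le> \<delta> * real n) sequentially" using dl by real_asymp
      then show "eventually (\<lambda>n. (exp (s n * real k) - 1) / s n = (if real k \<le> \<delta> * real n then (exp (s n * real k) - 1) / s n else 0)) sequentially"
        by eventually_elim simp
    qed
  qed
  moreover have "\<delta> = (\<beta> - 2) / (4 * K)" by (simp add: \<delta>_def \<gamma>_def)
  ultimately show ?thesis by (simp only: s_def mu_def)
qed

lemma large_deviation_truncated:
  assumes D: "D > 0" and E: "E > 0"
  obtains \<delta> where "\<delta> > 0"
    "eventually (\<lambda>n. Pr (R n) {xs. real (sum_list xs) \<ge> (mu + D) * real n \<and> (\<forall>x\<in>set xs. real x \<le> \<delta> * real n)} \<le> real n powr (-E)) sequentially"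
proof
  define K where "K = 2 * E / D"
  define \<delta> where "\<delta> = (\<beta> - 2) / (4 * K)"
  define s where "s n = K * ln (real n) / real n" for n :: nat
  have K: "K > 0" using D E by (simp add: K_def)
  show "\<delta> > 0" using K beta by (simp add: \<delta>_def)
  have s0: "eventually (\<lambda>n. s n > 0) sequentially"
    unfolding s_def using K by real_asymp
  define G where "G n = Mean p (\<lambda>k. if real k \<le> \<delta> * real n then (exp (s n * real k) - 1) / s n else 0)" for n
  have "G \<longlonglongrightarrow> mu"
    using exp_moment_truncated[OF K] unfolding G_def s_def \<delta>_def .
  then have "eventually (\<lambda>n. G n < mu + D / 2) sequentially"
    by (rule order_tendstoD) (use D in auto)
  then show "eventually (\<lambda>n. Pr (R n) {xs. real (sum_list xs) \<ge> (mu + D) * real n \<and> (\<forall>x\<in>set xs. real x \<le> \<delta> * real n)} \<le> real n powr (-E)) sequentially"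
    using s0 eventually_gt_at_top[of 0]
  proof eventually_elim
    case (elim n)
    let ?A = "{xs. real (sum_list xs) \<ge> (mu + D) * real n \<and> (\<forall>x\<in>set xs. real x \<le> \<delta> * real n)}"
    define f where "f k = (if real k \<le> \<delta> * real n then exp (s n * real k) else 0)" for k :: nat
    have prod: "prod_list (map (\<lambda>k. ennreal (f k)) xs) = ennreal (exp (s n * real (sum_list xs)))"
      if "\<forall>x\<in>set xs. real x \<le> \<delta> * real n" for xs
      using that
    proof (induction xs)
      case (Cons a xs)
      then show ?case by (simp add: f_def ennreal_mult[symmetric] exp_add[symmetric] distrib_left)
    qed simp
    have fb: "\<bar>f k\<bar> \<le> exp (s n * (\<delta> * real n))" for k
      using elim by (auto simp: f_def)
    have fint: "integrable p f"
      by (rule measure_pmf.integrable_const_bound[where B="exp (s n * (\<delta> * real n))"]) (use fb in auto)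
    have Ef: "Mean p f \<le> exp (s n * (mu + D / 2))"
    proof -
      let ?h = "\<lambda>k. if real k \<le> \<delta> * real n then (exp (s n * real k) - 1) / s n else 0"
      have hint: "integrable p ?h"
        by (rule measure_pmf.integrable_const_bound[where B="exp (s n * (\<delta> * real n)) / s n"])
           (use elim in \<open>auto intro!: divide_right_mono simp: add_increasing2 diff_le_eq\<close>)
      have "Mean p f \<le> Mean p (\<lambda>k. 1 + s n * ?h k)"
        by (rule integral_mono) (use fint hint elim in \<open>auto simp: f_def\<close>)
      also have "\<dots> = 1 + s n * G n" using hint by (simp add: G_def)
      also have "\<dots> \<le> 1 + s n * (mu + D / 2)" using elim by simp
      also have "\<dots> \<le> exp (s n * (mu + D / 2))" by (rule exp_ge_add_one_self)
      finally show ?thesis .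
    qed
    have "emeasure (R n) ?A = (\<integral>\<^sup>+xs. indicator ?A xs \<partial>R n)" by simp
    also have "\<dots> \<le> (\<integral>\<^sup>+xs. ennreal (exp (- s n * ((mu + D) * real n))) * prod_list (map (\<lambda>k. ennreal (f k)) xs) \<partial>R n)"
    proof (rule nn_integral_mono)
      fix xs
      show "indicator ?A xs \<le> ennreal (exp (- s n * ((mu + D) * real n))) * prod_list (map (\<lambda>k. ennreal (f k)) xs)"
      proof (cases "xs \<in> ?A")
        case True
        then have "s n * ((mu + D) * real n) \<le> s n * real (sum_list xs)" using elim by simp
        then have "1 \<le> exp (- s n * ((mu + D) * real n)) * exp (s n * real (sum_list xs))"
          by (simp add: mult_exp_exp)
        then show ?thesis using True by (simp add: prod ennreal_mult[symmetric])
      qed simp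
    qed
    also have "\<dots> = ennreal (exp (- s n * ((mu + D) * real n))) * (\<integral>\<^sup>+k. ennreal (f k) \<partial>p) ^ n"
      by (simp add: nn_integral_cmult nn_integral_prod_list_replicate_pmf)
    also have "(\<integral>\<^sup>+k. ennreal (f k) \<partial>p) = ennreal (Mean p f)"
      by (rule nn_integral_eq_integral[OF fint]) (simp add: f_def)
    also have "ennreal (exp (- s n * ((mu + D) * real n))) * ennreal (Mean p f) ^ n \<le>
       ennreal (exp (- s n * ((mu + D) * real n))) * ennreal (exp (s n * (mu + D / 2))) ^ n"
      by (intro mult_left_mono power_mono ennreal_leI Ef) auto
    also have "\<dots> = ennreal (exp (- s n * ((mu + D) * real n)) * exp (s n * (mu + D / 2)) ^ n)"
      by (simp add: ennreal_mult ennreal_power)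
    also have "exp (- s n * ((mu + D) * real n)) * exp (s n * (mu + D / 2)) ^ n = exp (- s n * real n * (D / 2))"
      by (simp add: exp_of_nat_mult[symmetric] mult_exp_exp algebra_simps)
    also have "\<dots> = real n powr (-E)"
      using elim D by (simp add: s_def K_def powr_def)
    finally show ?case by (simp add: measure_pmf.emeasure_eq_measure)
  qed
qed

lemma pmf_near:
  assumes D: "D > 0" and e: "0 < \<epsilon>" "\<epsilon> \<le> 1"
  obtains \<eta> where "\<eta> > 0" "\<eta> < D / 8"
    "eventually (\<lambda>x::real. \<forall>v::nat. \<bar>real v - D * x\<bar> \<le> 4 * \<eta> * x \<longrightarrow>
        (1 - \<epsilon>) * (c * (D * x) powr (-\<beta>)) \<le> pmf p v \<and> pmf p v \<le> (1 + \<epsilon>) * (c * (D * x) powr (-\<beta>))) at_top"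
proof -
  have "isCont (\<lambda>u::real. (1 + u) powr (-\<beta>)) 0" by (intro continuous_intros) auto
  then have "\<forall>e>0. \<exists>d>0. \<forall>u. \<bar>u\<bar> < d \<longrightarrow> \<bar>(1 + u) powr (-\<beta>) - 1\<bar> < e"
    by (simp add: continuous_at_real_range)
  from this[rule_format, of "\<epsilon> / 3"] obtain \<theta> where th: "\<theta> > 0" "\<And>u. \<bar>u\<bar> < \<theta> \<Longrightarrow> \<bar>(1 + u) powr (-\<beta>) - 1\<bar> < \<epsilon> / 3"
    using e by auto
  define \<eta> where "\<eta> = min (\<theta> * D / 8) (D / 16)"
  have eta: "\<eta> > 0" "\<eta> < D / 8" "4 * \<eta> / D < \<theta>" "4 * \<eta> < D"
    using th D by (auto simp: \<eta>_def min_def field_simps)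
  obtain k0 where k0: "\<And>k. k \<ge> k0 \<Longrightarrow> \<bar>pmf p k * real k powr \<beta> - c\<bar> < c * \<epsilon> / 3"
    using LIMSEQ_D[OF p_asymp, of "c * \<epsilon> / 3"] e c_pos by auto
  have "eventually (\<lambda>x::real. \<forall>v::nat. \<bar>real v - D * x\<bar> \<le> 4 * \<eta> * x \<longrightarrow>
        (1 - \<epsilon>) * (c * (D * x) powr (-\<beta>)) \<le> pmf p v \<and> pmf p v \<le> (1 + \<epsilon>) * (c * (D * x) powr (-\<beta>))) at_top"
    using eventually_gt_at_top[of 0] eventually_gt_at_top[of "(real k0 + 1) / (D - 4 * \<eta>)"]
  proof eventually_elim
    case (elim x)
    show ?case
    proof (intro allI impI)
      fix v :: nat assume v: "\<bar>real v - D * x\<bar> \<le> 4 * \<eta> * x"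
      have "real k0 + 1 < (D - 4 * \<eta>) * x" using elim eta by (simp add: field_simps)
      also have "\<dots> \<le> real v" using v by (simp add: abs_le_iff algebra_simps)
      finally have vk: "v \<ge> k0" "v > 0" by auto
      define u where "u = (real v - D * x) / (D * x)"
      have Dx: "D * x > 0" using D elim by simp
      have vu: "real v = (D * x) * (1 + u)" using D elim by (simp add: u_def distrib_left)
      have "\<bar>u\<bar> \<le> 4 * \<eta> * x / (D * x)" unfolding u_def abs_divide abs_of_pos[OF Dx]
        by (rule divide_right_mono[OF v]) (use Dx in simp)
      also have "\<dots> = 4 * \<eta> / D" using elim by simp
      finally have "\<bar>u\<bar> < \<theta>" using eta by simp
      from th(2)[OF this] have u1: "\<bar>(1 + u) powr (-\<beta>) - 1\<bar> < \<epsilon> / 3" .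
      have upos: "1 + u > 0" using vu vk Dx by (metis of_nat_0_less_iff zero_less_mult_pos)
      define q where "q = pmf p v * real v powr \<beta>"
      define r where "r = (1 + u) powr (-\<beta>)"
      have "pmf p v = q * real v powr (-\<beta>)" using vk by (simp add: q_def powr_minus)
      also have "real v powr (-\<beta>) = (D * x) powr (-\<beta>) * r"
        unfolding r_def by (subst vu, subst powr_mult) (use Dx upos in auto)
      finally have eq: "pmf p v = q * r * (D * x) powr (-\<beta>)" by simp
      have q: "c * (1 - \<epsilon> / 3) \<le> q" "q \<le> c * (1 + \<epsilon> / 3)"
        using k0[OF vk(1)] unfolding q_def[symmetric] abs_less_iff right_diff_distrib distrib_left by simp_all
      have r: "1 - \<epsilon> / 3 \<le> r" "r \<le> 1 + \<epsilon> / 3"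
        using u1 unfolding r_def[symmetric] abs_less_iff by linarith+
      have q0: "q \<ge> 0" by (simp add: q_def)
      have "c * (1 - \<epsilon> / 3) * (1 - \<epsilon> / 3) \<le> q * r"
        using q0 q r e c_pos by (intro mult_mono) auto
      moreover have "q * r \<le> c * (1 + \<epsilon> / 3) * (1 + \<epsilon> / 3)"
        using q r e c_pos by (intro mult_mono) auto
      moreover have m1: "(1 - \<epsilon> / 3) * (1 - \<epsilon> / 3) \<ge> 1 - \<epsilon>" using e by (simp add: algebra_simps)
      moreover have m2: "(1 + \<epsilon> / 3) * (1 + \<epsilon> / 3) \<le> 1 + \<epsilon>"
      proof -
        have "\<epsilon> * \<epsilon> \<le> \<epsilon> * 1" using e by (intro mult_left_mono) auto
        moreover have "(1 + \<epsilon> / 3) * (1 + \<epsilon> / 3) = 1 + \<epsilon> * 2 / 3 + \<epsilon> * \<epsilon> / 9" by (simp add: algebra_simps)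
        ultimately show ?thesis using e by linarith
      qed
      ultimately have "c * (1 - \<epsilon>) \<le> q * r" "q * r \<le> c * (1 + \<epsilon>)"
        using mult_left_mono[OF m1 less_imp_le[OF c_pos]] mult_left_mono[OF m2 less_imp_le[OF c_pos]]
        unfolding mult.assoc by linarith+
      from this[THEN mult_right_mono, of "(D * x) powr (-\<beta>)"]
      show "(1 - \<epsilon>) * (c * (D * x) powr (-\<beta>)) \<le> pmf p v \<and> pmf p v \<le> (1 + \<epsilon>) * (c * (D * x) powr (-\<beta>))"
        unfolding eq by (simp add: ac_simps)
    qed
  qed
  with eta that show ?thesis by blast
qed

lemma prob_max_greater_le:
  "Pr (R N) {xs. \<exists>x\<in>set xs. real x > y} \<le> real N * Pr p {k. real k > y}"
proof (induction N)
  case (Suc N)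
  let ?Q = "{xs. \<exists>x\<in>set xs. real x > y}"
  let ?q = "Pr p {k. real k > y}"
  have "Pr (R (Suc N)) ?Q = Mean (R N) (\<lambda>xs. Pr p {x. x # xs \<in> ?Q})"
    by (rule prob_replicate_pmf_Suc)
  also have "\<dots> \<le> Mean (R N) (\<lambda>xs. ?q + indicator ?Q xs)"
  proof (rule integral_mono)
    fix xs
    show "Pr p {x. x # xs \<in> ?Q} \<le> ?q + indicator ?Q xs"
    proof (cases "xs \<in> ?Q")
      case False
      then have "{x. x # xs \<in> ?Q} = {k. real k > y}" by auto
      then show ?thesis by simp
    qed (auto intro: add_increasing)
  qed (auto intro!: measure_pmf.integrable_const_bound[where B=1] Bochner_Integration.integrable_add)
  also have "\<dots> = ?q + Pr (R N) ?Q"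
    by (subst Bochner_Integration.integral_add) (auto intro!: measure_pmf.integrable_const_bound[where B=1])
  finally show ?case using Suc by (simp add: algebra_simps)
qed simp

lemma max_small_prob:
  assumes "\<eta> > 0"
  shows "(\<lambda>N. real N * Pr p {k. real k > \<eta> * real N}) \<longlonglongrightarrow> 0"
proof -
  have "filterlim (\<lambda>N. \<eta> * real N) at_top sequentially" using assms by real_asymp
  from filterlim_compose[OF tail_real this]
  have 1: "(\<lambda>N. Pr p {k. real k > \<eta> * real N} * (\<eta> * real N) powr \<alpha>) \<longlonglongrightarrow> c / \<alpha>" .
  have 2: "(\<lambda>N. real N / (\<eta> * real N) powr \<alpha>) \<longlonglongrightarrow> 0" using assms beta by real_asymp
  show ?thesis
    by (rule Lim_transform_eventually[OF tendsto_mult[OF 1 2, simplified]],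
        rule eventually_mono[OF eventually_gt_at_top[of 0]]) (use assms in auto)
qed

end

section \<open>One big jump\<close>

definition sorted_desc :: "nat list \<Rightarrow> int list" where
  "sorted_desc xs = map int (rev (sort xs))"

text \<open>Integer entries, because \<open>m - sum_list xs\<close> may be negative.\<close>

definition condensed :: "nat \<Rightarrow> nat list \<Rightarrow> int list" where
  "condensed m xs = (int m - int (sum_list xs)) # sorted_desc xs"

lemma sorted_desc_condensed:
  assumes "mset ys = mset (x # xs)" "\<forall>y\<in>set xs. y \<le> x" "x + sum_list xs = m"
  shows "sorted_desc ys = condensed m xs"
proof -
  have "sort ys = sort xs @ [x]"
    by (rule properties_for_sort) (use assms in \<open>auto simp: sorted_append\<close>)
  then show ?thesis using assms(3) by (auto simp: sorted_desc_def condensed_def)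
qed

locale condensation = heavy_tail +
  fixes m n :: "nat \<Rightarrow> nat" and lam :: real
  assumes n_lim: "filterlim n at_top sequentially"
    and m_lim: "(\<lambda>i. real (m i) / real (n i)) \<longlonglongrightarrow> lam"
    and lam: "lam > mu"
begin

definition "D = lam - mu"

definition "b i = c * (D * real (n i)) powr (-\<beta>)"

lemma D_pos: "D > 0" using lam by (simp add: D_def)

lemma n_pos: "eventually (\<lambda>i. n i > N) sequentially"
  using n_lim[unfolded filterlim_at_top, rule_format, of "Suc N"] by (simp add: Suc_le_eq)

lemma n_real_lim: "filterlim (\<lambda>i. real (n i)) at_top sequentially"
  using filterlim_compose[OF filterlim_real_sequentially n_lim] .

lemma n1_lim: "filterlim (\<lambda>i. n i - 1) at_top sequentially"
  unfolding filterlim_at_top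
proof
  fix Z show "eventually (\<lambda>i. Z \<le> n i - 1) sequentially"
    using n_pos[of "Z + 1"] by eventually_elim simp
qed

lemma b_pos: "eventually (\<lambda>i. b i > 0) sequentially"
  using n_pos[of 0] by eventually_elim (use D_pos c_pos in \<open>simp add: b_def\<close>)

lemma weak_law_shifted:
  assumes "\<eta> > 0"
  shows "(\<lambda>i. Pr (R (n i - 1)) {xs. \<bar>real (m i) - real (sum_list xs) - D * real (n i)\<bar> > 4 * \<eta> * real (n i)}) \<longlonglongrightarrow> 0"
proof -
  have A: "(\<lambda>i. Pr (R (n i - 1)) {xs. \<bar>real (sum_list xs) - real (n i - 1) * mu\<bar> > \<eta> * real (n i - 1)}) \<longlonglongrightarrow> 0"
    by (rule filterlim_compose[OF weak_law[OF assms] n1_lim])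
  have ev1: "eventually (\<lambda>i. \<bar>real (m i) / real (n i) - lam\<bar> < \<eta>) sequentially"
    using m_lim assms by (auto simp: tendsto_iff dist_real_def)
  obtain N where N: "mu / \<eta> < real N" using reals_Archimedean2 by blast
  have B: "eventually (\<lambda>i. Pr (R (n i - 1)) {xs. \<bar>real (m i) - real (sum_list xs) - D * real (n i)\<bar> > 4 * \<eta> * real (n i)}
     \<le> Pr (R (n i - 1)) {xs. \<bar>real (sum_list xs) - real (n i - 1) * mu\<bar> > \<eta> * real (n i - 1)}) sequentially"
    using ev1 n_pos[of N] n_pos[of 0]
  proof eventually_elim
    case (elim i)
    have "\<bar>real (m i) - lam * real (n i)\<bar> < \<eta> * real (n i)"
    proof -
      have "real (m i) - lam * real (n i) = (real (m i) / real (n i) - lam) * real (n i)"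
        using elim by (simp add: left_diff_distrib)
      then have "\<bar>real (m i) - lam * real (n i)\<bar> = \<bar>real (m i) / real (n i) - lam\<bar> * real (n i)"
        by (simp only: abs_mult abs_of_nat)
      also have "\<dots> < \<eta> * real (n i)" using elim by (intro mult_strict_right_mono) auto
      finally show ?thesis .
    qed
    moreover have "mu \<le> \<eta> * real (n i)"
    proof -
      have "mu < \<eta> * real N" using N assms by (simp add: field_simps)
      also have "\<dots> \<le> \<eta> * real (n i)" using elim assms by simp
      finally show ?thesis by simp
    qed
    moreover have "\<eta> * real (n i - 1) \<le> \<eta> * real (n i)" using assms by simp
    moreover have "real (n i - 1) * mu = real (n i) * mu - mu" using elim by (simp add: of_nat_diff algebra_simps)
    moreover have "D * real (n i) = lam * real (n i) - real (n i) * mu" by (simp add: D_def algebra_simps)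
    ultimately show ?case
      using mu_nonneg by (intro measure_pmf.finite_measure_mono subsetI) auto
  qed
  show ?thesis using tendsto_sandwich[OF _ B tendsto_const A] by simp
qed

text \<open>Either all entries are at most \<open>\<delta> n\<close>, which is negligible by exponential tilting, or some entry
  exceeds \<open>\<delta> n\<close>. By exchangeability it may be moved to the front, where it is determined by the other entries.\<close>

lemma local_upper:
  assumes e: "0 < \<epsilon>" "\<epsilon> \<le> 1"
  shows "eventually (\<lambda>i. Pr (R (n i)) {ys. sum_list ys = m i} \<le> (1 + 3 * \<epsilon>) * (real (n i) * b i)) sequentially"
proof -
  obtain \<eta> where eta: "\<eta> > 0" and
    near: "eventually (\<lambda>x::real. \<forall>v::nat. \<bar>real v - D * x\<bar> \<le> 4 * \<eta> * x \<longrightarrow>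
        (1 - \<epsilon>) * (c * (D * x) powr (-\<beta>)) \<le> pmf p v \<and> pmf p v \<le> (1 + \<epsilon>) * (c * (D * x) powr (-\<beta>))) at_top"
    using pmf_near[OF D_pos e] by blast
  obtain \<delta> where dl: "\<delta> > 0" and trunc:
    "eventually (\<lambda>n. Pr (R n) {xs. real (sum_list xs) \<ge> (mu + D / 2) * real n \<and> (\<forall>x\<in>set xs. real x \<le> \<delta> * real n)} \<le> real n powr (-\<beta>)) sequentially"
    using large_deviation_truncated[of "D / 2" \<beta>] D_pos beta by auto
  obtain C where C: "C > 0" "\<And>k. pmf p k * real k powr \<beta> \<le> C" using pmf_le_powr by blast
  define C' where "C' = C * \<delta> powr (-\<beta>) * D powr \<beta> / c"
  define Pn where "Pn i = Pr (R (n i - 1)) {xs. \<bar>real (m i) - real (sum_list xs) - D * real (n i)\<bar> > 4 * \<eta> * real (n i)}" for i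
  have "(\<lambda>i. C' * Pn i) \<longlonglongrightarrow> C' * 0"
    unfolding Pn_def by (intro tendsto_intros weak_law_shifted eta)
  then have ev1: "eventually (\<lambda>i. C' * Pn i < \<epsilon>) sequentially"
    by (rule order_tendstoD) (use e in simp)
  have ev2: "eventually (\<lambda>i. \<forall>v::nat. \<bar>real v - D * real (n i)\<bar> \<le> 4 * \<eta> * real (n i) \<longrightarrow> pmf p v \<le> (1 + \<epsilon>) * b i) sequentially"
    using eventually_compose_filterlim[OF near n_real_lim] unfolding b_def by eventually_elim auto
  note ev3 = eventually_compose_filterlim[OF trunc n_lim]
  have ev4: "eventually (\<lambda>i. real (m i) / real (n i) > mu + D / 2) sequentially"
    using m_lim by (rule order_tendstoD) (use lam in \<open>simp add: D_def field_simps\<close>)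
  have "eventually (\<lambda>n::nat. real n powr (-\<beta>) \<le> \<epsilon> * (real n * (c * (D * real n) powr (-\<beta>)))) sequentially"
    using e c_pos D_pos by real_asymp
  note ev5 = eventually_compose_filterlim[OF this n_lim]
  show ?thesis
    using ev1 ev2 ev3 ev4 ev5 n_pos[of 0] b_pos
  proof eventually_elim
    case (elim i)
    define N where "N = n i"
    define M where "M = m i"
    have N: "N > 0" using elim by (simp add: N_def)
    define F where "F = {ys. \<exists>x xs. ys = x # xs \<and> real x > \<delta> * real N \<and> x + sum_list xs = M}"
    have PF: "Pr (R N) F \<le> (1 + 2 * \<epsilon>) * b i"
    proof -
      let ?bad = "{xs. \<bar>real M - real (sum_list xs) - D * real N\<bar> > 4 * \<eta> * real N}"
      have "Pr (R (Suc (N - 1))) F = Mean (R (N - 1)) (\<lambda>xs. Pr p {x. x # xs \<in> F})"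
        by (rule prob_replicate_pmf_Suc)
      also have "\<dots> \<le> Mean (R (N - 1)) (\<lambda>xs. (1 + \<epsilon>) * b i + C' * b i * indicator ?bad xs)"
      proof (rule integral_mono)
        fix xs
        show "Pr p {x. x # xs \<in> F} \<le> (1 + \<epsilon>) * b i + C' * b i * indicator ?bad xs"
        proof (cases "sum_list xs \<le> M \<and> real (M - sum_list xs) > \<delta> * real N")
          case False
          then have "{x. x # xs \<in> F} = {}" by (auto simp: F_def)
          moreover have "C' \<ge> 0" using C c_pos by (simp add: C'_def)
          ultimately show ?thesis using elim e by (simp add: indicator_def)
        next
          case True
          define v where "v = M - sum_list xs"
          have "{x. x # xs \<in> F} \<subseteq> {v}" by (auto simp: F_def v_def)
          then have "Pr p {x. x # xs \<in> F} \<le> Pr p {v}"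
            by (intro measure_pmf.finite_measure_mono) auto
          then have *: "Pr p {x. x # xs \<in> F} \<le> pmf p v" by (simp add: measure_pmf_single)
          have rv: "real v = real M - real (sum_list xs)" using True by (simp add: v_def of_nat_diff)
          show ?thesis
          proof (cases "xs \<in> ?bad")
            case False
            then have "pmf p v \<le> (1 + \<epsilon>) * b i" using elim(2) unfolding rv[symmetric] by (auto simp: N_def rv)
            then show ?thesis using * False by simp
          next
            case bad: True
            have vd: "real v > \<delta> * real N" using True unfolding v_def by blast
            have dN: "\<delta> * real N > 0" using dl N by simp
            have "pmf p v = pmf p v * real v powr \<beta> * real v powr (-\<beta>)" using vd dN by (simp add: powr_minus)
            also have "\<dots> \<le> C * (\<delta> * real N) powr (-\<beta>)"
              using C vd dN beta by (intro mult_mono powr_mono2') auto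
            also have "\<dots> = C' * b i"
              using dl N D_pos c_pos by (simp add: C'_def b_def N_def powr_mult powr_minus)
            finally show ?thesis using * bad elim e by (simp add: add_increasing)
          qed
        qed
      qed (auto intro!: measure_pmf.integrable_const_bound[where B=1] Bochner_Integration.integrable_add integrable_mult_right)
      also have "\<dots> = (1 + \<epsilon>) * b i + C' * b i * Pn i"
        by (subst Bochner_Integration.integral_add)
           (auto intro!: measure_pmf.integrable_const_bound[where B=1] integrable_mult_right simp: Pn_def N_def M_def)
      also have "\<dots> = ((1 + \<epsilon>) + C' * Pn i) * b i" by (simp add: algebra_simps)
      also have "\<dots> \<le> (1 + 2 * \<epsilon>) * b i" using elim by (intro mult_right_mono) auto
      finally show ?thesis using N by simp
    qed
    let ?T = "{xs. real (sum_list xs) \<ge> (mu + D / 2) * real N \<and> (\<forall>x\<in>set xs. real x \<le> \<delta> * real N)}"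
    let ?E = "\<lambda>j. {ys. to_front j ys \<in> F}"
    have ae: "AE ys in R N. ys \<in> {ys. sum_list ys = M} \<longrightarrow> ys \<in> ?T \<union> (\<Union>j\<in>{..<N}. ?E j)"
      using AE_replicate_pmf_length[of N p]
    proof eventually_elim
      case (elim ys)
      show ?case
      proof
        assume "ys \<in> {ys. sum_list ys = M}"
        then have s: "sum_list ys = M" by simp
        show "ys \<in> ?T \<union> (\<Union>j\<in>{..<N}. ?E j)"
        proof (cases "\<forall>x\<in>set ys. real x \<le> \<delta> * real N")
          case True
          have "(mu + D / 2) * real N \<le> real M"
            using \<open>real (m i) / real (n i) > mu + D / 2\<close> N by (simp add: N_def M_def field_simps)
          then show ?thesis using True s by auto
        next
          case False
          then obtain j where j: "j < N" "real (ys ! j) > \<delta> * real N"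
            using elim by (auto simp: in_set_conv_nth not_le)
          have "sum_list (to_front j ys) = M"
            using mset_to_front[of j ys] j elim s by (metis sum_mset_sum_list)
          then have "to_front j ys \<in> F" using j by (auto simp: F_def to_front_def)
          then show ?thesis using j by auto
        qed
      qed
    qed
    have "Pr (R N) {ys. sum_list ys = M} \<le> Pr (R N) (?T \<union> (\<Union>j\<in>{..<N}. ?E j))"
      using ae by (intro measure_pmf.finite_measure_mono_AE) auto
    also have "\<dots> \<le> Pr (R N) ?T + Pr (R N) (\<Union>j\<in>{..<N}. ?E j)"
      by (rule measure_Un_le) auto
    also have "Pr (R N) (\<Union>j\<in>{..<N}. ?E j) \<le> (\<Sum>j<N. Pr (R N) (?E j))"
      by (rule measure_UNION_le) auto
    also have "\<dots> = (\<Sum>j<N. Pr (R N) F)"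
      by (intro sum.cong refl prob_to_front) auto
    also have "\<dots> \<le> real N * ((1 + 2 * \<epsilon>) * b i)" using PF by (simp add: mult_left_mono)
    also have "Pr (R N) ?T \<le> \<epsilon> * (real N * b i)"
      using elim by (simp add: N_def b_def)
    finally show ?case by (simp add: N_def M_def algebra_simps)
  qed
qed

text \<open>For typical \<open>xs\<close> the entry \<open>m - sum_list xs\<close> is the strict maximum, so the \<open>n\<close> places at which it can
  be inserted give disjoint events.\<close>

lemma local_lower:
  assumes e: "0 < \<epsilon>" "\<epsilon> \<le> 1"
  shows "eventually (\<lambda>i. \<forall>A. (1 - \<epsilon>) * (real (n i) * b i) * (Pr (R (n i - 1)) {xs. condensed (m i) xs \<in> A} - \<epsilon>)
    \<le> Pr (R (n i)) {ys. sum_list ys = m i \<and> sorted_desc ys \<in> A}) sequentially"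
proof -
  obtain \<eta> where eta: "\<eta> > 0" "\<eta> < D / 8" and
    near: "eventually (\<lambda>x::real. \<forall>v::nat. \<bar>real v - D * x\<bar> \<le> 4 * \<eta> * x \<longrightarrow>
        (1 - \<epsilon>) * (c * (D * x) powr (-\<beta>)) \<le> pmf p v \<and> pmf p v \<le> (1 + \<epsilon>) * (c * (D * x) powr (-\<beta>))) at_top"
    using pmf_near[OF D_pos e] by blast
  let ?bad = "\<lambda>i. {xs. \<bar>real (m i) - real (sum_list xs) - D * real (n i)\<bar> > 4 * \<eta> * real (n i)}"
  let ?big = "\<lambda>i. {xs. \<exists>x\<in>set xs. real x > \<eta> * real (n i)}"
  have ev1: "eventually (\<lambda>i. Pr (R (n i - 1)) (?bad i) < \<epsilon> / 2) sequentially"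
    using weak_law_shifted[OF eta(1)] by (rule order_tendstoD) (use e in simp)
  have "eventually (\<lambda>N. real N * Pr p {k. real k > \<eta> * real N} < \<epsilon> / 2) sequentially"
    using max_small_prob[OF eta(1)] by (rule order_tendstoD) (use e in simp)
  note ev2 = eventually_compose_filterlim[OF this n_lim]
  have ev3: "eventually (\<lambda>i. \<forall>v::nat. \<bar>real v - D * real (n i)\<bar> \<le> 4 * \<eta> * real (n i) \<longrightarrow> (1 - \<epsilon>) * b i \<le> pmf p v) sequentially"
    using eventually_compose_filterlim[OF near n_real_lim] unfolding b_def by eventually_elim auto
  show ?thesis
    using ev1 ev2 ev3 n_pos[of 0] b_pos
  proof eventually_elim
    case (elim i)
    define N where "N = n i"
    define M where "M = m i"
    have N: "N > 0" using elim by (simp add: N_def)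
    define G where "G = {xs. \<not> (\<bar>real M - real (sum_list xs) - D * real N\<bar> > 4 * \<eta> * real N) \<and> (\<forall>x\<in>set xs. real x \<le> \<eta> * real N)}"
    have G_gap: "sum_list xs \<le> M" "real (M - sum_list xs) > \<eta> * real N" if "xs \<in> G" for xs
    proof -
      have "\<bar>real M - real (sum_list xs) - D * real N\<bar> \<le> 4 * \<eta> * real N" using that by (auto simp: G_def)
      then have "real M - real (sum_list xs) \<ge> (D - 4 * \<eta>) * real N" by (simp add: abs_le_iff algebra_simps)
      moreover have "(D - 4 * \<eta>) * real N > \<eta> * real N" using eta N by (intro mult_strict_right_mono) auto
      moreover have "\<eta> * real N > 0" using eta N by simp
      ultimately have *: "real M - real (sum_list xs) > \<eta> * real N" "real M - real (sum_list xs) > 0" by linarith+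
      then show "sum_list xs \<le> M" by simp
      then show "real (M - sum_list xs) > \<eta> * real N" using * by (simp add: of_nat_diff)
    qed
    have PG: "Pr (R (N - 1)) (- G) \<le> \<epsilon>"
    proof -
      have "Pr (R (N - 1)) (- G) \<le> Pr (R (N - 1)) (?bad i \<union> ?big i)"
        by (intro measure_pmf.finite_measure_mono) (auto simp: G_def N_def M_def not_le)
      also have "\<dots> \<le> Pr (R (N - 1)) (?bad i) + Pr (R (N - 1)) (?big i)"
        by (rule measure_Un_le) auto
      also have "Pr (R (N - 1)) (?big i) \<le> real (N - 1) * Pr p {k. real k > \<eta> * real (n i)}"
        by (rule prob_max_greater_le)
      also have "\<dots> \<le> real N * Pr p {k. real k > \<eta> * real (n i)}"
        by (intro mult_right_mono) auto
      finally show ?thesis using elim(1,2) by (simp add: N_def)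
    qed
    show ?case
    proof
      fix A
      define F where "F = {ys. \<exists>x xs. ys = x # xs \<and> xs \<in> G \<and> x + sum_list xs = M \<and> condensed M xs \<in> A}"
      let ?E = "\<lambda>j. {ys. length ys = N} \<inter> {ys. to_front j ys \<in> F}"
      have "(1 - \<epsilon>) * b i * (Pr (R (N - 1)) {xs. condensed M xs \<in> A} - \<epsilon>)
        \<le> (1 - \<epsilon>) * b i * Pr (R (N - 1)) (G \<inter> {xs. condensed M xs \<in> A})"
      proof (rule mult_left_mono)
        have "Pr (R (N - 1)) {xs. condensed M xs \<in> A} \<le>
            Pr (R (N - 1)) ((G \<inter> {xs. condensed M xs \<in> A}) \<union> - G)"
          by (intro measure_pmf.finite_measure_mono) auto
        also have "\<dots> \<le> Pr (R (N - 1)) (G \<inter> {xs. condensed M xs \<in> A}) + Pr (R (N - 1)) (- G)"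
          by (rule measure_Un_le) auto
        finally show "Pr (R (N - 1)) {xs. condensed M xs \<in> A} - \<epsilon> \<le> Pr (R (N - 1)) (G \<inter> {xs. condensed M xs \<in> A})"
          using PG by simp
      qed (use e elim in auto)
      also have "\<dots> = Mean (R (N - 1)) (\<lambda>xs. (1 - \<epsilon>) * b i * indicator (G \<inter> {xs. condensed M xs \<in> A}) xs)"
        by simp
      also have "\<dots> \<le> Mean (R (N - 1)) (\<lambda>xs. Pr p {x. x # xs \<in> F})"
      proof (rule integral_mono)
        fix xs
        show "(1 - \<epsilon>) * b i * indicator (G \<inter> {xs. condensed M xs \<in> A}) xs \<le> Pr p {x. x # xs \<in> F}"
        proof (cases "xs \<in> G \<inter> {xs. condensed M xs \<in> A}")
          case True
          let ?v = "M - sum_list xs"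
          have v: "sum_list xs \<le> M" using G_gap True by auto
          have "{x. x # xs \<in> F} = {?v}" using True v by (auto simp: F_def)
          then have "Pr p {x. x # xs \<in> F} = pmf p ?v" by (simp add: measure_pmf_single)
          moreover have "\<bar>real ?v - D * real (n i)\<bar> \<le> 4 * \<eta> * real (n i)"
            using True v by (auto simp: G_def N_def of_nat_diff)
          then have "(1 - \<epsilon>) * b i \<le> pmf p ?v" using elim(3) by blast
          ultimately show ?thesis using True by simp
        qed simp
      qed (auto intro!: measure_pmf.integrable_const_bound[where B=1] integrable_mult_right)
      also have "\<dots> = Pr (R (Suc (N - 1))) F"
        by (rule prob_replicate_pmf_Suc[symmetric])
      also have "Suc (N - 1) = N" using N by simp
      finally have PF: "(1 - \<epsilon>) * b i * (Pr (R (N - 1)) {xs. condensed M xs \<in> A} - \<epsilon>) \<le> Pr (R N) F" .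
      have in_F: "ys ! j > nat \<lfloor>\<eta> * real N\<rfloor> \<and> (\<forall>k<N. k \<noteq> j \<longrightarrow> ys ! k \<le> nat \<lfloor>\<eta> * real N\<rfloor>)
          \<and> sum_list ys = M \<and> sorted_desc ys \<in> A" if ys: "ys \<in> ?E j" and j: "j < N" for ys j
      proof -
        have len: "length ys = N" using ys by auto
        obtain x xs where xs: "to_front j ys = x # xs" "xs \<in> G" "x + sum_list xs = M" "condensed M xs \<in> A"
          using ys by (auto simp: F_def)
        have ms: "mset ys = mset (x # xs)" using mset_to_front[of j ys] len j xs by simp
        have x: "x = ys ! j" and xs': "xs = take j ys @ drop (Suc j) ys"
          using xs(1) by (auto simp: to_front_def)
        have gap: "real x > \<eta> * real N" using G_gap[OF xs(2)] xs(3) by auto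
        have small: "real y \<le> \<eta> * real N" if "y \<in> set xs" for y using xs(2) that by (auto simp: G_def)
        have "\<forall>y\<in>set xs. y \<le> x"
        proof
          fix y assume "y \<in> set xs"
          then have "real y \<le> real x" using gap small[of y] by linarith
          then show "y \<le> x" by simp
        qed
        then have "sorted_desc ys = condensed M xs" using ms xs by (intro sorted_desc_condensed)
        moreover have "sum_list ys = M" using ms xs(3) by (metis sum_list.Cons sum_mset_sum_list)
        moreover have "x > nat \<lfloor>\<eta> * real N\<rfloor>" using gap eta(1) by (simp add: nat_less_iff floor_less_iff)
        moreover have "ys ! k \<le> nat \<lfloor>\<eta> * real N\<rfloor>" if "k < N" "k \<noteq> j" for k
        proof -
          have "ys ! k \<in> set xs"
          proof (cases "k < j")
            case True
            then have "ys ! k = take j ys ! k" "k < length (take j ys)" using len j by auto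
            then have "ys ! k \<in> set (take j ys)" by (metis nth_mem)
            then show ?thesis by (simp add: xs')
          next
            case False
            then have "ys ! k = drop (Suc j) ys ! (k - Suc j)" "k - Suc j < length (drop (Suc j) ys)"
              using len that by auto
            then have "ys ! k \<in> set (drop (Suc j) ys)" by (metis nth_mem)
            then show ?thesis by (simp add: xs')
          qed
          then show ?thesis using small by (simp add: le_nat_floor)
        qed
        ultimately show ?thesis using x xs(4) by simp
      qed
      have disj: "disjoint_family_on ?E {..<N}"
        unfolding disjoint_family_on_def
      proof (intro ballI impI)
        fix j k assume jk: "j \<in> {..<N}" "k \<in> {..<N}" "j \<noteq> k"
        have False if "ys \<in> ?E j" "ys \<in> ?E k" for ys
          using in_F[OF that(1)] in_F[OF that(2)] jk by (meson lessThan_iff not_le)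
        then show "?E j \<inter> ?E k = {}" by blast
      qed
      have "real N * Pr (R N) F = (\<Sum>j<N. Pr (R N) F)" by simp
      also have "\<dots> = (\<Sum>j<N. Pr (R N) (?E j))"
      proof (rule sum.cong[OF refl])
        fix j assume "j \<in> {..<N}"
        then have "Pr (R N) F = Pr (R N) {ys. to_front j ys \<in> F}"
          by (simp add: prob_to_front)
        also have "\<dots> = Pr (R N) (?E j)"
          using AE_replicate_pmf_length[of N p] by (intro measure_pmf.finite_measure_eq_AE) auto
        finally show "Pr (R N) F = Pr (R N) (?E j)" .
      qed
      also have "\<dots> = Pr (R N) (\<Union>j\<in>{..<N}. ?E j)"
        by (rule measure_pmf.finite_measure_finite_Union[symmetric]) (use disj in auto)
      also have "\<dots> \<le> Pr (R N) {ys. sum_list ys = M \<and> sorted_desc ys \<in> A}"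
      proof (rule measure_pmf.finite_measure_mono)
        show "(\<Union>j\<in>{..<N}. ?E j) \<subseteq> {ys. sum_list ys = M \<and> sorted_desc ys \<in> A}"
          using in_F by blast
      qed simp
      finally have "real N * Pr (R N) F \<le> Pr (R N) {ys. sum_list ys = M \<and> sorted_desc ys \<in> A}" .
      moreover have "real N * ((1 - \<epsilon>) * b i * (Pr (R (N - 1)) {xs. condensed M xs \<in> A} - \<epsilon>)) \<le> real N * Pr (R N) F"
        using PF by (rule mult_left_mono) simp
      ultimately show "(1 - \<epsilon>) * (real (n i) * b i) * (Pr (R (n i - 1)) {xs. condensed (m i) xs \<in> A} - \<epsilon>)
        \<le> Pr (R (n i)) {ys. sum_list ys = m i \<and> sorted_desc ys \<in> A}"
        by (simp add: N_def M_def mult_ac)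
    qed
  qed
qed

lemma prob_sum_asymp:
  "(\<lambda>i. Pr (R (n i)) {ys. sum_list ys = m i} / (real (n i) * b i)) \<longlonglongrightarrow> 1"
proof (rule tendstoI)
  fix r :: real assume r: "r > 0"
  define e where "e = min (1/2) (r / 8)"
  have e: "0 < e" "e \<le> 1" "4 * e < r" using r by (auto simp: e_def)
  show "eventually (\<lambda>i. dist (Pr (R (n i)) {ys. sum_list ys = m i} / (real (n i) * b i)) 1 < r) sequentially"
    using local_upper[OF e(1,2)] local_lower[OF e(1,2)] n_pos[of 0] b_pos
  proof eventually_elim
    case (elim i)
    let ?x = "real (n i) * b i" let ?P = "Pr (R (n i)) {ys. sum_list ys = m i}"
    have x: "?x > 0" using elim by simp
    have "(1 - e) * ?x * (1 - e) \<le> ?P" using elim(2)[rule_format, of UNIV] by simp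
    then have "(1 - e) * (1 - e) \<le> ?P / ?x" using x by (simp add: pos_le_divide_eq mult_ac)
    moreover have "?P / ?x \<le> 1 + 3 * e" using elim(1) x by (simp add: pos_divide_le_eq mult_ac)
    moreover have "(1 - e) * (1 - e) \<ge> 1 - 2 * e" by (simp add: algebra_simps)
    ultimately show ?case using e unfolding dist_real_def abs_less_iff by linarith
  qed
qed

lemma conditional_close:
  assumes r: "r > 0"
  shows "eventually (\<lambda>i. \<forall>A. \<bar>Pr (R (n i)) {ys. sum_list ys = m i \<and> sorted_desc ys \<in> A} / Pr (R (n i)) {ys. sum_list ys = m i}
      - Pr (R (n i - 1)) {xs. condensed (m i) xs \<in> A}\<bar> \<le> r) sequentially"
proof -
  define e where "e = min (1/4) (r / 5)"
  have e: "0 < e" "e \<le> 1" "5 * e \<le> r" "e \<le> 1/4" using r by (auto simp: e_def)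
  show ?thesis
    using local_upper[OF e(1,2)] local_lower[OF e(1,2)] n_pos[of 0] b_pos
  proof eventually_elim
    case (elim i)
    let ?x = "real (n i) * b i" let ?P = "Pr (R (n i)) {ys. sum_list ys = m i}"
    let ?PA = "\<lambda>A. Pr (R (n i)) {ys. sum_list ys = m i \<and> sorted_desc ys \<in> A}"
    let ?Q = "\<lambda>A. Pr (R (n i - 1)) {xs. condensed (m i) xs \<in> A}"
    have x: "?x > 0" using elim by simp
    have "(1 - e) * ?x * (1 - e) \<le> ?P" using elim(2)[rule_format, of UNIV] by simp
    moreover have "(1 - e) * ?x * (1 - e) > 0" using e x by simp
    ultimately have P: "?P > 0" by linarith
    have lower: "?PA A / ?P \<ge> ?Q A - r" for A
    proof (cases "?Q A \<le> e")
      case True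
      have "?PA A / ?P \<ge> 0" by simp
      then show ?thesis using True e by linarith
    next
      case False
      have Q1: "?Q A \<le> 1" by simp
      have "(1 - 4 * e) * (?Q A - e) * ?P \<le> (1 - 4 * e) * (?Q A - e) * ((1 + 3 * e) * ?x)"
        using False e elim(1) by (intro mult_left_mono) auto
      also have "\<dots> = ((1 - 4 * e) * (1 + 3 * e)) * (?x * (?Q A - e))" by (simp add: mult_ac)
      also have "\<dots> \<le> (1 - e) * (?x * (?Q A - e))"
      proof (rule mult_right_mono)
        show "(1 - 4 * e) * (1 + 3 * e) \<le> 1 - e" using e by (simp add: algebra_simps)
        show "0 \<le> ?x * (?Q A - e)" using False by (intro mult_nonneg_nonneg[OF less_imp_le[OF x]]) simp
      qed
      also have "\<dots> \<le> ?PA A" using elim(2)[rule_format, of A] by (simp add: mult_ac)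
      finally have "(1 - 4 * e) * (?Q A - e) \<le> ?PA A / ?P" using P by (simp add: pos_le_divide_eq)
      moreover have "?Q A - e \<le> 1" using Q1 e by linarith
      then have "4 * e * (?Q A - e) \<le> 4 * e * 1" using e by (intro mult_left_mono) auto
      then have "(1 - 4 * e) * (?Q A - e) \<ge> ?Q A - 5 * e" by (simp add: left_diff_distrib)
      ultimately show ?thesis using e by linarith
    qed
    show ?case
    proof
      fix A
      have "?PA A + ?PA (- A) = ?P"
        by (subst measure_pmf.finite_measure_Union[symmetric]) (auto intro!: arg_cong[where f="Pr _"])
      then have 1: "?PA A / ?P + ?PA (- A) / ?P = 1" using P by (simp add: add_divide_distrib[symmetric])
      have "?Q A + ?Q (- A) = 1"
        using measure_pmf.prob_compl[of "{xs. condensed (m i) xs \<in> A}" "R (n i - 1)"]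
        by (simp add: Compl_eq_Diff_UNIV[symmetric] Collect_neg_eq[symmetric])
      then show "\<bar>?PA A / ?P - ?Q A\<bar> \<le> r"
        using lower[of A] lower[of "- A"] 1 by linarith
    qed
  qed
qed

end

section \<open>The allocation as a conditioned sample\<close>

lemma bij_betw_BBset:
  "bij_betw (\<lambda>y. map y [0..<n]) (BBset m n) {xs. length xs = n \<and> sum_list xs = m}"
proof (rule bij_betw_byWitness[where f' = "\<lambda>xs i. if i < n then xs ! i else 0"])
  have sum: "sum_list (map y [0..<n]) = (\<Sum>i<n. y i)" for y :: "nat \<Rightarrow> nat"
    by (simp add: interv_sum_list_conv_sum_set_nat atLeast0LessThan)
  show "\<forall>y\<in>BBset m n. (\<lambda>i. if i < n then map y [0..<n] ! i else 0) = y"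
    by (auto simp: BBset_def fun_eq_iff)
  show *: "\<forall>xs\<in>{xs. length xs = n \<and> sum_list xs = m}. map (\<lambda>i. if i < n then xs ! i else 0) [0..<n] = xs"
    by (auto intro!: nth_equalityI)
  show "(\<lambda>y. map y [0..<n]) ` BBset m n \<subseteq> {xs. length xs = n \<and> sum_list xs = m}"
    by (auto simp: BBset_def sum)
  show "(\<lambda>xs i. if i < n then xs ! i else 0) ` {xs. length xs = n \<and> sum_list xs = m} \<subseteq> BBset m n"
  proof safe
    fix xs :: "nat list" assume "n = length xs" "m = sum_list xs"
    then show "(\<lambda>i. if i < length xs then xs ! i else 0) \<in> BBset (sum_list xs) (length xs)"
      using * sum[of "\<lambda>i. if i < n then xs ! i else 0"] by (auto simp: BBset_def)
  qed
qed

lemma finite_lists_sum: "finite {xs :: nat list. length xs = n \<and> sum_list xs = m}"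
  by (rule finite_subset[OF _ finite_lists_length_eq[of "{..m}" n]]) (auto intro: member_le_sum_list)

lemma finite_BBset: "finite (BBset m n)"
  using bij_betw_finite[OF bij_betw_BBset] finite_lists_sum by blast

lemma pmf_Bmn:
  assumes w: "\<And>k. w k \<ge> 0" and Z: "Zmn w m n > 0"
  shows "pmf (Bmn w m n) y = (if y \<in> BBset m n then bweight w n y / Zmn w m n else 0)"
  unfolding Bmn_def
proof (rule pmf_embed_pmf)
  have b: "bweight w n y \<ge> 0" for y unfolding bweight_def by (intro prod_nonneg) (simp add: w)
  then show "0 \<le> (if y \<in> BBset m n then bweight w n y / Zmn w m n else 0)" for y
    using Z by simp
  have "(\<integral>\<^sup>+ y. ennreal (if y \<in> BBset m n then bweight w n y / Zmn w m n else 0) \<partial>count_space UNIV)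
     = (\<Sum>y\<in>BBset m n. ennreal (if y \<in> BBset m n then bweight w n y / Zmn w m n else 0))"
    by (rule nn_integral_count_space') (auto simp: finite_BBset)
  also have "\<dots> = (\<Sum>y\<in>BBset m n. ennreal (bweight w n y / Zmn w m n))" by (rule sum.cong) auto
  also have "\<dots> = ennreal (\<Sum>y\<in>BBset m n. bweight w n y / Zmn w m n)"
    using b Z by (intro sum_ennreal) simp
  also have "(\<Sum>y\<in>BBset m n. bweight w n y / Zmn w m n) = 1"
    using Z by (simp add: sum_divide_distrib[symmetric] Zmn_def)
  finally show "(\<integral>\<^sup>+ y. ennreal (if y \<in> BBset m n then bweight w n y / Zmn w m n else 0) \<partial>count_space UNIV) = 1"
    by simp
qed

lemma bweight_eq_pmf:
  assumes "\<And>k. pmf p k = w k / \<Phi>" "\<Phi> > 0"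
  shows "bweight w n y = \<Phi> ^ n * pmf (replicate_pmf n p) (map y [0..<n])"
proof -
  have "bweight w n y = (\<Prod>i<n. \<Phi> * pmf p (y i))"
    unfolding bweight_def using assms by simp
  also have "\<dots> = \<Phi> ^ n * (\<Prod>i<n. pmf p (y i))" by (simp add: prod.distrib)
  also have "(\<Prod>i<n. pmf p (y i)) = prod_list (map (\<lambda>i. pmf p (y i)) [0..<n])"
    by (subst prod.distinct_set_conv_list[symmetric]) (auto simp: atLeast0LessThan)
  finally show ?thesis by (simp add: pmf_replicate_pmf o_def)
qed

lemma prob_lists_sum_eq:
  assumes "\<And>k. pmf p k = w k / \<Phi>" "\<Phi> > 0"
  shows "(\<Sum>y\<in>{y \<in> BBset m n. map y [0..<n] \<in> E}. bweight w n y)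
    = \<Phi> ^ n * Pr (replicate_pmf n p) {ys. sum_list ys = m \<and> ys \<in> E}"
proof -
  let ?L = "{ys. length ys = n \<and> sum_list ys = m} \<inter> E"
  have "bij_betw (\<lambda>y. map y [0..<n]) {y \<in> BBset m n. map y [0..<n] \<in> E} ?L"
    unfolding bij_betw_def
  proof
    show "inj_on (\<lambda>y. map y [0..<n]) {y \<in> BBset m n. map y [0..<n] \<in> E}"
      by (rule inj_on_subset[OF bij_betw_imp_inj_on[OF bij_betw_BBset[of n m]]]) auto
    have "f ` {y \<in> A. f y \<in> E} = f ` A \<inter> E" for f :: "(nat \<Rightarrow> nat) \<Rightarrow> nat list" and A by blast
    then show "(\<lambda>y. map y [0..<n]) ` {y \<in> BBset m n. map y [0..<n] \<in> E} = ?L"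
      by (simp only: bij_betw_imp_surj_on[OF bij_betw_BBset[of n m]])
  qed
  from sum.reindex_bij_betw[OF this, of "pmf (replicate_pmf n p)"]
  have "(\<Sum>y\<in>{y \<in> BBset m n. map y [0..<n] \<in> E}. pmf (replicate_pmf n p) (map y [0..<n])) = sum (pmf (replicate_pmf n p)) ?L" .
  also have "\<dots> = Pr (replicate_pmf n p) ?L"
    by (rule measure_measure_pmf_finite[symmetric]) (auto intro: finite_subset[OF _ finite_lists_sum])
  also have "\<dots> = Pr (replicate_pmf n p) {ys. sum_list ys = m \<and> ys \<in> E}"
    using AE_replicate_pmf_length[of n p] by (intro measure_pmf.finite_measure_eq_AE) auto
  finally show ?thesis
    by (simp add: bweight_eq_pmf[OF assms] sum_distrib_left[symmetric])
qed

lemma Zmn_eq_prob: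
  assumes "\<And>k. pmf p k = w k / \<Phi>" "\<Phi> > 0"
  shows "Zmn w m n = \<Phi> ^ n * Pr (replicate_pmf n p) {ys. sum_list ys = m}"
  using prob_lists_sum_eq[OF assms, where E=UNIV, of n m] by (simp add: Zmn_def)

lemma prob_Bmn:
  assumes w: "\<And>k. w k \<ge> 0" and Z: "Zmn w m n > 0" and p: "\<And>k. pmf p k = w k / \<Phi>" "\<Phi> > 0"
  shows "Pr (Bmn w m n) {y. map y [0..<n] \<in> E} =
    Pr (replicate_pmf n p) {ys. sum_list ys = m \<and> ys \<in> E} / Pr (replicate_pmf n p) {ys. sum_list ys = m}"
proof -
  have supp: "set_pmf (Bmn w m n) \<subseteq> BBset m n"
    by (auto simp: set_pmf_eq pmf_Bmn[OF w Z] split: if_splits)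
  have "Pr (Bmn w m n) {y. map y [0..<n] \<in> E} = Pr (Bmn w m n) {y \<in> BBset m n. map y [0..<n] \<in> E}"
    using supp by (intro measure_pmf.finite_measure_eq_AE) (auto simp: AE_measure_pmf_iff)
  also have "\<dots> = (\<Sum>y\<in>{y \<in> BBset m n. map y [0..<n] \<in> E}. bweight w n y / Zmn w m n)"
    by (subst measure_measure_pmf_finite) (auto simp: finite_BBset pmf_Bmn[OF w Z])
  also have "\<dots> = (\<Phi> ^ n * Pr (replicate_pmf n p) {ys. sum_list ys = m \<and> ys \<in> E}) / Zmn w m n"
    unfolding sum_divide_distrib[symmetric] prob_lists_sum_eq[OF p] ..
  finally show ?thesis using p(2) by (simp add: Zmn_eq_prob[OF p])
qed

lemma summable_weights:
  fixes w :: "nat \<Rightarrow> real"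
  assumes beta: "\<beta> > 2" and lim: "(\<lambda>k. w k * real k powr \<beta>) \<longlonglongrightarrow> c" and w: "\<And>k. w k \<ge> 0"
  shows "summable (\<lambda>k. real k * w k)" "summable w"
proof -
  have "Bseq (\<lambda>k. w k * real k powr \<beta>)"
    using lim by (intro convergent_imp_Bseq) (auto simp: convergent_def)
  then obtain C where C: "C > 0" "\<And>k. norm (w k * real k powr \<beta>) \<le> C" by (elim BseqE) auto
  have S: "summable (\<lambda>k. C * real k powr (1 - \<beta>))"
    using beta by (intro summable_mult) (simp add: summable_real_powr_iff)
  have B: "norm (real k * w k) \<le> C * real k powr (1 - \<beta>)" for k
  proof (cases "k = 0")
    case False
    then have "real k * w k = (w k * real k powr \<beta>) * real k powr (1 - \<beta>)"
      by (simp add: powr_diff)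
    also have "\<dots> \<le> C * real k powr (1 - \<beta>)" using C(2)[of k] by (intro mult_right_mono) auto
    finally show ?thesis using w by simp
  qed simp
  show 1: "summable (\<lambda>k. real k * w k)"
    by (rule summable_comparison_test'[OF S, of 0]) (use B in simp)
  have "norm (w k) \<le> real k * w k" if "k \<ge> 1" for k
    using that w[of k] mult_right_mono[of 1 "real k" "w k"] by simp
  then show "summable w" by (rule summable_comparison_test'[OF 1])
qed

lemma power_series_tendsto_at_left_1:
  fixes a :: "nat \<Rightarrow> real"
  assumes "summable a" "\<And>k. a k \<ge> 0"
  shows "((\<lambda>t. \<Sum>k. a k * t ^ k) \<longlongrightarrow> (\<Sum>k. a k)) (at_left 1)"
proof -
  have "uniform_limit {0..1} (\<lambda>n t. \<Sum>k<n. a k * t ^ k) (\<lambda>t. \<Sum>k. a k * t ^ k) sequentially"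
    by (rule Weierstrass_m_test[of _ _ a])
       (use assms in \<open>auto simp: abs_mult intro!: mult_left_le power_le_one\<close>)
  then have "continuous_on {0..1} (\<lambda>t. \<Sum>k. a k * t ^ k)"
    by (rule uniform_limit_theorem[rotated]) (auto intro!: always_eventually continuous_intros)
  then have "((\<lambda>t. \<Sum>k. a k * t ^ k) \<longlongrightarrow> (\<Sum>k. a k * 1 ^ k)) (at 1 within {0..1})"
    unfolding continuous_on by (rule bspec) simp
  moreover have "at 1 within {0..1::real} = at_left 1"
    by (rule at_within_Icc_at_left) simp
  ultimately show ?thesis by simp
qed

lemma Psi_tendsto:
  fixes w :: "nat \<Rightarrow> real"
  assumes w: "\<And>k. w k \<ge> 0" and S: "summable (\<lambda>k. real k * w k)" "summable w" and pos: "Phi w 1 > 0"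
  shows "(Psi w \<longlongrightarrow> (\<Sum>k. real k * w k) / Phi w 1) (at_left 1)"
proof -
  have d: "t * deriv (Phi w) t = (\<Sum>k. (real k * w k) * t ^ k)" if t: "t \<in> {0<..<1}" for t
  proof -
    have sm: "summable (\<lambda>k. w k * z ^ k)" if "norm z < 1" for z :: real
      using powser_inside[of w 1 z] S(2) that by simp
    have "DERIV (Phi w) t :> (\<Sum>k. diffs w k * t ^ k)"
      unfolding Phi_def by (rule termdiffs_strong'[of 1]) (use sm t in auto)
    then have "deriv (Phi w) t = (\<Sum>k. diffs w k * t ^ k)" by (rule DERIV_imp_deriv)
    moreover have "t * (\<Sum>k. diffs w k * t ^ k) = (\<Sum>k. (real k * w k) * t ^ k)"
    proof -
      have "summable (\<lambda>k. diffs w k * t ^ k)"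
        using termdiff_converges[of t 1 w] sm t by auto
      then have "t * (\<Sum>k. diffs w k * t ^ k) = (\<Sum>k. (real (Suc k) * w (Suc k)) * t ^ Suc k)"
        by (subst suminf_mult[symmetric]) (auto simp: diffs_def mult_ac)
      also have "\<dots> = (\<Sum>k. (real k * w k) * t ^ k)"
      proof -
        have "summable (\<lambda>k. (real k * w k) * t ^ k)"
          using powser_inside[of "\<lambda>k. real k * w k" 1 t] S(1) t by simp
        from suminf_split_head[OF this] show ?thesis by simp
      qed
      finally show ?thesis .
    qed
    ultimately show ?thesis by simp
  qed
  have "((\<lambda>t. (\<Sum>k. (real k * w k) * t ^ k) / Phi w t) \<longlongrightarrow> (\<Sum>k. real k * w k) / (\<Sum>k. w k)) (at_left 1)"
    unfolding Phi_def
    by (intro tendsto_divide power_series_tendsto_at_left_1) (use w S pos in \<open>auto simp: Phi_def\<close>)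
  moreover have "eventually (\<lambda>t. (\<Sum>k. (real k * w k) * t ^ k) / Phi w t = Psi w t) (at_left 1)"
    using eventually_at_left_real[of 0 1]
    by (rule eventually_mono) (use d in \<open>auto simp: Psi_def\<close>)
  ultimately show ?thesis by (simp add: Phi_def Lim_transform_eventually)
qed

section \<open>Order statistics\<close>

lemma length_filter_greater_sorted_desc:
  fixes ds :: "nat list" and y :: real
  assumes "sorted_wrt (\<ge>) ds" "j < length ds"
  shows "real (ds ! j) \<le> y \<longleftrightarrow> length (filter (\<lambda>x. real x > y) ds) \<le> j"
  using assms
proof (induction ds arbitrary: j)
  case (Cons d ds)
  show ?case
  proof (cases "real d \<le> y")
    case True
    have le: "real x \<le> y" if "x \<in> set (d # ds)" for x
      using Cons.prems(1) True that by force
    then have "filter (\<lambda>x. real x > y) (d # ds) = []" by (simp only: filter_empty_conv not_less) auto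
    moreover have "real ((d # ds) ! j) \<le> y" using le nth_mem[OF Cons.prems(2)] by blast
    ultimately show ?thesis by (metis le0 list.size(3))
  next
    case False
    then show ?thesis using Cons by (cases j) auto
  qed
qed simp

lemma nth_rev_sort_le_iff:
  fixes xs :: "nat list" and y :: real
  assumes "j < length xs"
  shows "real (rev (sort xs) ! j) \<le> y \<longleftrightarrow> length (filter (\<lambda>x. real x > y) xs) \<le> j"
proof -
  have "mset (filter (\<lambda>x. real x > y) (rev (sort xs))) = mset (filter (\<lambda>x. real x > y) xs)"
    by simp
  then have "length (filter (\<lambda>x. real x > y) (rev (sort xs))) = length (filter (\<lambda>x. real x > y) xs)"
    by (metis size_mset)
  moreover have "sorted_wrt (\<ge>) (rev (sort xs))"
    by (simp add: sorted_wrt_rev)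
  ultimately show ?thesis
    using length_filter_greater_sorted_desc[of "rev (sort xs)" j y] assms by simp
qed

lemma map_pmf_replicate_pmf: "map_pmf (map f) (replicate_pmf n p) = replicate_pmf n (map_pmf f p)"
proof (induction n)
  case (Suc n)
  show ?case by (simp add: map_bind_pmf bind_map_pmf Suc.IH[symmetric])
qed simp

lemma map_pmf_bernoulli:
  "map_pmf P p = bernoulli_pmf (Pr p {x. P x})"
proof (rule pmf_eqI)
  fix b
  have "pmf (map_pmf P p) True = Pr p {x. P x}" by (simp add: pmf_map vimage_def)
  moreover have "pmf (map_pmf P p) False = 1 - Pr p {x. P x}"
    using measure_pmf.prob_compl[of "{x. P x}" p]
    by (simp add: pmf_map vimage_def Compl_eq_Diff_UNIV[symmetric] Collect_neg_eq[symmetric])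
  ultimately show "pmf (map_pmf P p) b = pmf (bernoulli_pmf (Pr p {x. P x})) b"
    by (cases b) simp_all
qed

lemma map_pmf_count_binomial:
  "map_pmf (\<lambda>xs. length (filter P xs)) (replicate_pmf N p) = binomial_pmf N (Pr p {x. P x})"
proof -
  have "(\<lambda>xs. length (filter P xs)) = (length \<circ> filter id) \<circ> map P"
    by (auto simp: fun_eq_iff filter_map o_def)
  then have "map_pmf (\<lambda>xs. length (filter P xs)) (replicate_pmf N p) = map_pmf (length \<circ> filter id) (replicate_pmf N (map_pmf P p))"
    by (simp only: map_pmf_compose o_apply map_pmf_replicate_pmf)
  also have "\<dots> = binomial_pmf N (Pr p {x. P x})"
    unfolding map_pmf_bernoulli by (rule binomial_pmf_altdef[symmetric]) simp
  finally show ?thesis .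
qed

lemma binomial_poisson_limit:
  fixes q :: "nat \<Rightarrow> real"
  assumes lim: "(\<lambda>N. real N * q N) \<longlonglongrightarrow> \<theta>"
  shows "(\<lambda>N. real (N choose l) * q N ^ l * (1 - q N) ^ (N - l)) \<longlonglongrightarrow> \<theta> ^ l * exp (- \<theta>) / fact l"
proof -
  have q0: "q \<longlonglongrightarrow> 0"
  proof -
    have "(\<lambda>N. (real N * q N) * (1 / real N)) \<longlonglongrightarrow> \<theta> * 0"
      by (intro tendsto_mult lim) real_asymp
    then have "(\<lambda>N. (real N * q N) * (1 / real N)) \<longlonglongrightarrow> 0" by (simp only: mult_zero_right)
    then show ?thesis
      by (rule Lim_transform_eventually) (rule eventually_mono[OF eventually_gt_at_top[of 0]], simp)
  qed
  have ch: "(\<lambda>N. real (N choose l) / real N ^ l) \<longlonglongrightarrow> 1 / fact l"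
  proof -
    have "(\<lambda>N. (\<Prod>i<l. (real N - real i) / real N) / fact l) \<longlonglongrightarrow> (\<Prod>i<l. 1) / fact l"
      by (intro tendsto_intros tendsto_prod) (real_asymp, simp)
    moreover have "(\<Prod>i<l. (real N - real i) / real N) / fact l = real (N choose l) / real N ^ l" for N
      by (simp add: binomial_gbinomial gbinomial_prod_rev prod_dividef atLeast0LessThan)
    ultimately show ?thesis by simp
  qed
  have ex: "(\<lambda>N. (1 - q N) ^ N) \<longlonglongrightarrow> exp (- \<theta>)"
  proof -
    have "(\<lambda>N. (1 + complex_of_real (- (real N * q N)) / of_nat N) ^ N) \<longlonglongrightarrow> exp (complex_of_real (- \<theta>))"
      by (intro tendsto_one_plus_over_n_power_exp tendsto_of_real tendsto_minus lim)
    then have "(\<lambda>N. complex_of_real ((1 + - (real N * q N) / real N) ^ N)) \<longlonglongrightarrow> complex_of_real (exp (- \<theta>))"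
      by (simp only: of_real_power of_real_add of_real_divide of_real_1 of_real_of_nat_eq exp_of_real)
    then have "(\<lambda>N. (1 + - (real N * q N) / real N) ^ N) \<longlonglongrightarrow> exp (- \<theta>)" by (simp only: tendsto_of_real_iff)
    then show ?thesis
      by (rule Lim_transform_eventually) (rule eventually_mono[OF eventually_gt_at_top[of 0]], simp)
  qed
  have "(\<lambda>N. (real (N choose l) / real N ^ l) * (real N * q N) ^ l * ((1 - q N) ^ N / (1 - q N) ^ l)) \<longlonglongrightarrow> (1 / fact l) * \<theta> ^ l * (exp (- \<theta>) / (1 - 0) ^ l)"
    by (intro tendsto_intros ch lim ex q0) auto
  moreover have "eventually (\<lambda>N. (real (N choose l) / real N ^ l) * (real N * q N) ^ l * ((1 - q N) ^ N / (1 - q N) ^ l) = real (N choose l) * q N ^ l * (1 - q N) ^ (N - l)) sequentially"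
    using order_tendstoD(2)[OF q0, of 1, OF zero_less_one] eventually_ge_at_top[of l] eventually_gt_at_top[of 0]
  proof eventually_elim
    case (elim N)
    have "(1 - q N) ^ (N - l) = (1 - q N) ^ N / (1 - q N) ^ l"
      using elim by (intro power_diff) auto
    then show ?case using elim by (simp add: power_mult_distrib)
  qed
  ultimately have "(\<lambda>N. real (N choose l) * q N ^ l * (1 - q N) ^ (N - l)) \<longlonglongrightarrow> (1 / fact l) * \<theta> ^ l * (exp (- \<theta>) / (1 - 0) ^ l)"
    by (rule Lim_transform_eventually)
  then show ?thesis by simp
qed

context heavy_tail begin

definition "theta x = c / \<alpha> * x powr (- \<alpha>)"

lemma theta_pos: "x > 0 \<Longrightarrow> theta x > 0"
  using c_pos beta by (simp add: theta_def)

lemma order_stat_limit: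
  assumes x: "x > 0"
  shows "(\<lambda>N. Pr (R N) {xs. real (rev (sort xs) ! j) \<le> x * real (Suc N) powr (1 / \<alpha>)})
     \<longlonglongrightarrow> 1 - erlang_CDF j 1 (theta x)"
proof -
  define y where "y N = x * real (Suc N) powr (1 / \<alpha>)" for N
  define q where "q N = Pr p {k. real k > y N}" for N
  have ylim: "filterlim y at_top sequentially" unfolding y_def using x beta by real_asymp
  have 1: "(\<lambda>N. q N * y N powr \<alpha>) \<longlonglongrightarrow> c / \<alpha>"
    unfolding q_def by (rule filterlim_compose[OF tail_real ylim])
  have ya: "y N powr \<alpha> = x powr \<alpha> * real (Suc N)" for N
    using x beta by (simp add: y_def powr_mult powr_powr)
  have "(\<lambda>N. (q N * y N powr \<alpha>) * (real N / real (Suc N)) * x powr (- \<alpha>)) \<longlonglongrightarrow> c / \<alpha> * 1 * x powr (- \<alpha>)"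
    by (intro tendsto_mult 1 tendsto_const) real_asymp
  moreover have "(q N * y N powr \<alpha>) * (real N / real (Suc N)) * x powr (- \<alpha>) = real N * q N" for N
  proof -
    have xx: "x powr \<alpha> * x powr (- \<alpha>) = 1" using x by (subst powr_add[symmetric]) simp
    have gen: "a * (X * s) * (t / s) * Y = t * a" if "s > 0" "X * Y = 1" for a X s t Y :: real
    proof -
      have "a * (X * s) * (t / s) * Y = t * a * (X * Y)" using that(1) by simp
      then show ?thesis by (simp only: that(2) mult_1_right)
    qed
    show ?thesis unfolding ya by (rule gen[OF _ xx]) simp
  qed
  ultimately have lim: "(\<lambda>N. real N * q N) \<longlonglongrightarrow> theta x" by (simp add: theta_def)
  have "(\<lambda>N. \<Sum>l\<le>j. real (N choose l) * q N ^ l * (1 - q N) ^ (N - l)) \<longlonglongrightarrow> (\<Sum>l\<le>j. theta x ^ l * exp (- theta x) / fact l)"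
    by (intro tendsto_sum binomial_poisson_limit lim)
  moreover have "(\<Sum>l\<le>j. theta x ^ l * exp (- theta x) / fact l) = 1 - erlang_CDF j 1 (theta x)"
    using theta_pos[OF x] by (simp add: erlang_CDF_def)
  moreover have "eventually (\<lambda>N. (\<Sum>l\<le>j. real (N choose l) * q N ^ l * (1 - q N) ^ (N - l)) = Pr (R N) {xs. real (rev (sort xs) ! j) \<le> y N}) sequentially"
    using eventually_gt_at_top[of j]
  proof eventually_elim
    case (elim N)
    have "Pr (R N) {xs. real (rev (sort xs) ! j) \<le> y N} = Pr (R N) {xs. length (filter (\<lambda>x. real x > y N) xs) \<le> j}"
      using AE_replicate_pmf_length[of N p]
      by (intro measure_pmf.finite_measure_eq_AE) (use elim in \<open>auto simp: nth_rev_sort_le_iff\<close>)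
    also have "\<dots> = Pr (map_pmf (\<lambda>xs. length (filter (\<lambda>x. real x > y N) xs)) (R N)) {..j}"
      by (simp add: vimage_def)
    also have "\<dots> = Pr (binomial_pmf N (q N)) {..j}"
      unfolding map_pmf_count_binomial q_def ..
    also have "\<dots> = (\<Sum>l\<le>j. pmf (binomial_pmf N (q N)) l)"
      by (rule measure_measure_pmf_finite) simp
    also have "\<dots> = (\<Sum>l\<le>j. real (N choose l) * q N ^ l * (1 - q N) ^ (N - l))"
      by (intro sum.cong refl pmf_binomial) (auto simp: q_def)
    finally show ?case by simp
  qed
  ultimately show ?thesis unfolding y_def by (simp add: Lim_transform_eventually)
qed

end

lemma DERIV_poisson_sum:
  "((\<lambda>t::real. \<Sum>l\<le>k. t ^ l * exp (- t) / fact l) has_real_derivative - (t ^ k * exp (- t) / fact k)) (at t)"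
proof (induction k)
  case 0
  show ?case by (auto intro!: derivative_eq_intros)
next
  case (Suc k)
  have A: "((\<lambda>t::real. t ^ Suc k * exp (- t) / fact (Suc k)) has_real_derivative
      (real (Suc k) * t ^ k * exp (- t) - t ^ Suc k * exp (- t)) / fact (Suc k)) (at t)"
    by (rule derivative_eq_intros refl | simp)+
  have B: "(real (Suc k) * t ^ k * exp (- t) - t ^ Suc k * exp (- t)) / fact (Suc k) =
      t ^ k * exp (- t) / fact k - t ^ Suc k * exp (- t) / fact (Suc k)"
  proof -
    have "real (Suc k) * t ^ k * exp (- t) / fact (Suc k) = t ^ k * exp (- t) / fact k"
      unfolding fact_Suc of_nat_mult by (simp only: mult.assoc) (simp del: of_nat_Suc)
    then show ?thesis by (simp only: diff_divide_distrib)
  qed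
  show ?case unfolding sum.atMost_Suc
    by (rule DERIV_cong[OF DERIV_add[OF Suc.IH A[unfolded B]]]) simp
qed

lemma erlang_CDF_1_eq: "x \<ge> 0 \<Longrightarrow> 1 - erlang_CDF k 1 x = (\<Sum>l\<le>k. x ^ l * exp (- x) / fact l)"
  by (simp add: erlang_CDF_def)

lemma poisson_sum_at_top: "((\<lambda>t::real. \<Sum>l\<le>k. t ^ l * exp (- t) / fact l) \<longlongrightarrow> 0) at_top"
proof -
  have "((\<lambda>t::real. t ^ l * exp (- t) / fact l) \<longlongrightarrow> 0) at_top" for l :: nat
    using tendsto_divide[OF tendsto_power_div_exp_0[of l] tendsto_const, of "fact l"]
    by (simp add: exp_minus divide_inverse)
  then have "((\<lambda>t::real. \<Sum>l\<le>k. t ^ l * exp (- t) / fact l) \<longlongrightarrow> (\<Sum>l\<le>k. 0)) at_top" by (intro tendsto_sum)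
  then show ?thesis by simp
qed

lemma poisson_sum_at_0: "(\<Sum>l\<le>k. 0 ^ l * exp (- 0) / fact l) = (1::real)"
  by (subst sum.atMost_shift) simp

lemma weak_conv_m_from_pos:
  assumes \<mu>: "\<And>i. real_distribution (\<mu> i)" and M: "real_distribution M"
    and 0: "cdf M 0 = 0" and lim: "\<And>x. x > 0 \<Longrightarrow> (\<lambda>i. cdf (\<mu> i) x) \<longlonglongrightarrow> cdf M x"
  shows "weak_conv_m \<mu> M"
  unfolding weak_conv_m_def weak_conv_def
proof (intro allI impI)
  interpret M: real_distribution M by fact
  interpret \<mu>: real_distribution "\<mu> i" for i by fact
  fix x
  show "(\<lambda>i. cdf (\<mu> i) x) \<longlonglongrightarrow> cdf M x"
  proof (cases "x > 0")
    case False
    then have z: "cdf M x = 0" using M.cdf_nondecreasing[of x 0] M.cdf_nonneg[of x] 0 by simp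
    have "(\<lambda>i. cdf (\<mu> i) x) \<longlonglongrightarrow> 0"
    proof (rule LIMSEQ_I)
      fix r :: real assume "r > 0"
      have "(cdf M \<longlongrightarrow> cdf M 0) (at_right 0)"
        using M.cdf_is_right_cont[of 0] by (simp add: continuous_within)
      then have "eventually (\<lambda>z. cdf M z < r) (at_right 0)"
        using \<open>r > 0\<close> 0 by (intro order_tendstoD) auto
      then have "eventually (\<lambda>z. cdf M z < r \<and> z > 0) (at_right 0)"
        by (intro eventually_conj eventually_at_right_less)
      then obtain z where z: "z > 0" "cdf M z < r"
        using eventually_happens[of _ "at_right (0::real)"] by auto
      from order_tendstoD(2)[OF lim[OF z(1)] z(2)]
      obtain N where "\<And>i. i \<ge> N \<Longrightarrow> cdf (\<mu> i) z < r" by (auto simp: eventually_sequentially)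
      moreover have "cdf (\<mu> i) x \<le> cdf (\<mu> i) z" for i
        using False z by (intro \<mu>.cdf_nondecreasing) simp
      ultimately show "\<exists>no. \<forall>i\<ge>no. norm (cdf (\<mu> i) x - 0) < r"
        using \<mu>.cdf_nonneg by (intro exI[of _ N]) (auto intro: le_less_trans)
    qed
    then show ?thesis by (simp add: z)
  qed (rule lim)
qed

context heavy_tail begin

definition frechet_density :: "nat \<Rightarrow> real \<Rightarrow> real" where
  "frechet_density k x = (if x > 0 then c * x powr (- \<alpha> - 1) * (c / \<alpha> * x powr (- \<alpha>)) ^ k / fact k
     * exp (- (c / \<alpha>) * x powr (- \<alpha>)) else 0)"

definition "frechet k = density lborel (\<lambda>x. ennreal (frechet_density k x))"

lemma frechet_density_measurable [measurable]: "frechet_density k \<in> borel_measurable borel"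
  unfolding frechet_density_def by measurable

lemma frechet_density_nonneg: "frechet_density k x \<ge> 0"
  using c_pos beta by (simp add: frechet_density_def)

lemma sets_frechet [simp]: "sets (frechet k) = sets borel"
  and space_frechet [simp]: "space (frechet k) = UNIV"
  by (simp_all add: frechet_def)

lemma theta_DERIV: "x > 0 \<Longrightarrow> (theta has_real_derivative - c * x powr (- \<alpha> - 1)) (at x)"
proof -
  assume x: "x > 0"
  have "((\<lambda>x. c / \<alpha> * x powr (- \<alpha>)) has_real_derivative c / \<alpha> * (- \<alpha> * x powr (- \<alpha> - 1))) (at x)"
    by (intro DERIV_cmult has_real_derivative_powr x)
  moreover have "c / a * (- a * X) = - c * X" if "a \<noteq> 0" for a X :: real using that by simp
  from this[of \<alpha>] have "c / \<alpha> * (- \<alpha> * x powr (- \<alpha> - 1)) = - c * x powr (- \<alpha> - 1)" using beta by simp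
  ultimately show ?thesis unfolding theta_def by (simp only:)
qed

lemma emeasure_frechet_atLeast:
  assumes z: "z > 0"
  shows "emeasure (frechet k) {z..} = ennreal (erlang_CDF k 1 (theta z))"
proof -
  define G where "G t = (\<Sum>l\<le>k. t ^ l * exp (- t) / fact l)" for t :: real
  have G: "(G has_real_derivative - (t ^ k * exp (- t) / fact k)) (at t)" for t
    unfolding G_def by (rule DERIV_poisson_sum)
  have "emeasure (frechet k) {z..} = (\<integral>\<^sup>+x. ennreal (frechet_density k x) * indicator {z..} x \<partial>lborel)"
    unfolding frechet_def by (rule emeasure_density) auto
  also have "\<dots> = ennreal (1 - G (theta z))"
  proof (rule nn_integral_FTC_atLeast)
    fix x assume x: "z \<le> x"
    then have x0: "x > 0" using z by simp
    from DERIV_chain2[OF G theta_DERIV[OF x0]]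
    have "((\<lambda>x. G (theta x)) has_real_derivative - (theta x ^ k * exp (- theta x) / fact k) * (- c * x powr (- \<alpha> - 1))) (at x)" .
    moreover have "- (theta x ^ k * exp (- theta x) / fact k) * (- c * x powr (- \<alpha> - 1)) = frechet_density k x"
      using x0 by (simp add: frechet_density_def theta_def mult_ac)
    ultimately show "((\<lambda>x. G (theta x)) has_real_derivative frechet_density k x) (at x)" by simp
    show "0 \<le> frechet_density k x" by (rule frechet_density_nonneg)
  next
    have th: "(theta \<longlongrightarrow> 0) at_top" unfolding theta_def using beta by real_asymp
    have "isCont G 0" by (rule DERIV_isCont[OF G])
    from isCont_tendsto_compose[OF this th]
    have "((\<lambda>x. G (theta x)) \<longlongrightarrow> G 0) at_top" .
    moreover have "G 0 = 1" unfolding G_def by (rule poisson_sum_at_0)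
    ultimately show "((\<lambda>x. G (theta x)) \<longlongrightarrow> 1) at_top" by simp
  qed simp
  also have "1 - G (theta z) = erlang_CDF k 1 (theta z)"
    using erlang_CDF_1_eq[of "theta z" k] theta_pos[OF z] by (simp add: G_def)
  finally show ?thesis .
qed

lemma theta_at_right_0: "filterlim theta at_top (at_right 0)"
  unfolding theta_def using beta c_pos by real_asymp

lemma AE_frechet_pos: "AE x in frechet k. x > 0"
  unfolding frechet_def by (subst AE_density) (auto simp: frechet_density_def)

lemma real_distribution_frechet: "real_distribution (frechet k)"
proof -
  have seq: "filterlim (\<lambda>n. 1 / real (Suc n)) (at_right 0) sequentially"
    by real_asymp
  have "filterlim (\<lambda>n. theta (1 / real (Suc n))) at_top sequentially"
    by (rule filterlim_compose[OF theta_at_right_0 seq])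
  from filterlim_compose[OF poisson_sum_at_top[of k] this]
  have "(\<lambda>n. 1 - erlang_CDF k 1 (theta (1 / real (Suc n)))) \<longlonglongrightarrow> 0"
    using theta_pos by (simp add: erlang_CDF_1_eq less_imp_le del: of_nat_Suc)
  from tendsto_diff[OF tendsto_const[of 1] this]
  have "(\<lambda>n. erlang_CDF k 1 (theta (1 / real (Suc n)))) \<longlonglongrightarrow> 1" by simp
  then have 1: "(\<lambda>n. emeasure (frechet k) {1 / real (Suc n)..}) \<longlonglongrightarrow> ennreal 1"
    by (simp add: emeasure_frechet_atLeast tendsto_ennrealI del: of_nat_Suc ennreal_1)
  have "(\<lambda>n. emeasure (frechet k) {1 / real (Suc n)..}) \<longlonglongrightarrow> emeasure (frechet k) (\<Union>n. {1 / real (Suc n)..})"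
    by (rule Lim_emeasure_incseq) (auto simp: incseq_def frac_le intro: order_trans[rotated])
  from LIMSEQ_unique[OF 1 this] have 2: "emeasure (frechet k) (\<Union>n. {1 / real (Suc n)..}) = 1" by simp
  have "emeasure (frechet k) UNIV = emeasure (frechet k) (\<Union>n. {1 / real (Suc n)..})"
  proof (rule emeasure_eq_AE)
    show "AE x in frechet k. (x \<in> UNIV) = (x \<in> (\<Union>n. {1 / real (Suc n)..}))"
      using AE_frechet_pos
    proof eventually_elim
      case (elim x)
      then obtain n where "inverse (real (Suc n)) < x" using reals_Archimedean by blast
      then show ?case by (auto simp: inverse_eq_divide intro: less_imp_le)
    qed
  qed auto
  then have "prob_space (frechet k)" using 2 by (intro prob_spaceI) simp
  then show ?thesis by (simp add: real_distribution_def real_distribution_axioms_def)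
qed

lemma measure_frechet_atLeast: "z > 0 \<Longrightarrow> measure (frechet k) {z..} = erlang_CDF k 1 (theta z)"
  using emeasure_frechet_atLeast[of z k] by (simp add: measure_def)

lemma cdf_frechet:
  assumes "x > 0" shows "cdf (frechet k) x = 1 - erlang_CDF k 1 (theta x)"
proof -
  interpret real_distribution "frechet k" by (rule real_distribution_frechet)
  have "AE y in frechet k. y \<noteq> x"
    unfolding frechet_def using AE_lborel_singleton[of x] by (subst AE_density) auto
  then have "measure (frechet k) {..x} = measure (frechet k) (UNIV - {x..})"
    by (intro finite_measure_eq_AE) auto
  also have "\<dots> = 1 - measure (frechet k) {x..}"
    using prob_compl[of "{x..}"] by simp
  finally show ?thesis using assms by (simp add: cdf_def measure_frechet_atLeast)
qed

lemma cdf_frechet_0: "cdf (frechet k) 0 = 0"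
proof -
  interpret real_distribution "frechet k" by (rule real_distribution_frechet)
  have "measure (frechet k) {..0} = measure (frechet k) {}"
    using AE_frechet_pos[of k] by (intro finite_measure_eq_AE) auto
  then show ?thesis by (simp add: cdf_def)
qed

lemma theta_measurable [measurable]: "theta \<in> borel_measurable borel"
  unfolding theta_def by measurable

lemma distr_frechet: "distr (frechet k) borel theta = density lborel (\<lambda>x. ennreal (erlang_density k 1 x))"
proof (rule cdf_unique)
  interpret F: real_distribution "frechet k" by (rule real_distribution_frechet)
  have meas: "theta \<in> measurable (frechet k) borel" by (simp add: measurable_def theta_measurable)
       (use theta_measurable in \<open>simp add: measurable_def\<close>)
  show "real_distribution (distr (frechet k) borel theta)"
    by (intro F.real_distribution_distr meas)
  interpret E: prob_space "density lborel (\<lambda>x. ennreal (erlang_density k 1 x))"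
    by (rule prob_space_erlang_density) simp
  show "real_distribution (density lborel (\<lambda>x. ennreal (erlang_density k 1 x)))"
    by unfold_locales simp_all
  show "cdf (distr (frechet k) borel theta) = cdf (density lborel (\<lambda>x. ennreal (erlang_density k 1 x)))"
  proof
    fix y :: real
    have E: "cdf (density lborel (\<lambda>x. ennreal (erlang_density k 1 x))) y = erlang_CDF k 1 y"
      using emeasure_erlang_density[of 1 k y] by (simp add: cdf_def measure_def)
    have L: "cdf (distr (frechet k) borel theta) y = measure (frechet k) (theta -` {..y})"
      using measure_distr[OF meas, of "{..y}"] by (simp add: cdf_def)
    have tm: "theta -` {..y} \<in> sets (frechet k)" using measurable_sets[OF meas, of "{..y}"] by simp
    show "cdf (distr (frechet k) borel theta) y = cdf (density lborel (\<lambda>x. ennreal (erlang_density k 1 x))) y"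
    proof (cases "y > 0")
      case False
      have "measure (frechet k) (theta -` {..y}) = measure (frechet k) {}"
      proof (rule F.finite_measure_eq_AE)
        show "AE x in frechet k. (x \<in> theta -` {..y}) = (x \<in> {})"
          using AE_frechet_pos[of k]
        proof eventually_elim
          case (elim x)
          then show ?case using theta_pos[OF elim] False by simp
        qed
      qed (use tm in auto)
      moreover have "erlang_CDF k 1 y = 0"
        using False poisson_sum_at_0[of k] by (cases "y = 0") (auto simp: erlang_CDF_def)
      ultimately show ?thesis by (simp add: E L)
    next
      case True
      define z where "z = (\<alpha> * y / c) powr (- 1 / \<alpha>)"
      have a: "\<alpha> > 0" using beta by simp
      have z: "z > 0" using True a c_pos by (simp add: z_def)
      have tz: "theta z = y"
      proof -
        have "c / a * ((a * y / c) powr (- 1 / a)) powr (- a) = y" if "a > 0" for a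
          using that True c_pos by (simp add: powr_powr)
        from this[OF a] show ?thesis unfolding theta_def z_def .
      qed
      have anti: "theta x2 < theta x1" if "0 < x1" "x1 < x2" for x1 x2
        unfolding theta_def using that a c_pos by (intro mult_strict_left_mono powr_less_mono2_neg) auto
      have iff: "theta x \<le> y \<longleftrightarrow> z \<le> x" if "x > 0" for x
        using anti[of x z] anti[of z x] that z tz by (cases x z rule: linorder_cases) auto
      have "measure (frechet k) (theta -` {..y}) = measure (frechet k) {z..}"
      proof (rule F.finite_measure_eq_AE)
        show "AE x in frechet k. (x \<in> theta -` {..y}) = (x \<in> {z..})"
          using AE_frechet_pos[of k] by eventually_elim (simp add: iff)
      qed (use tm in auto)
      then show ?thesis using z by (simp add: E L measure_frechet_atLeast tz)
    qed
  qed
qed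

end

section \<open>The stable limit\<close>

definition neg_binomial_coeff :: "real \<Rightarrow> nat \<Rightarrow> real" where
  "neg_binomial_coeff \<gamma> k = (-1) ^ k * (\<gamma> gchoose k)"

lemma neg_binomial_coeff_asymp:
  "(\<lambda>k. neg_binomial_coeff \<gamma> k * real k powr (\<gamma> + 1)) \<longlonglongrightarrow> inverse (Gamma (- \<gamma>))"
proof (rule Lim_transform_eventually[OF gbinomial_asymptotic[of \<gamma>]])
  show "eventually (\<lambda>k. (\<gamma> gchoose k) / ((- 1) ^ k / exp ((\<gamma> + 1) * of_real (ln (real k)))) =
      neg_binomial_coeff \<gamma> k * real k powr (\<gamma> + 1)) sequentially"
    using eventually_gt_at_top[of 0]
  proof eventually_elim
    case (elim k)
    have "x / (s / e) = s * x * e" if "s = 1 \<or> s = -1" for x s e :: real using that by auto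
    from this[of "(-1) ^ k"] show ?case
      using elim by (cases "even k") (auto simp: neg_binomial_coeff_def powr_def)
  qed
qed

lemma summable_neg_binomial_coeff:
  assumes "\<gamma> > 0" shows "summable (\<lambda>k. \<bar>neg_binomial_coeff \<gamma> k\<bar>)"
proof -
  have "Bseq (\<lambda>k. neg_binomial_coeff \<gamma> k * real k powr (\<gamma> + 1))"
    using neg_binomial_coeff_asymp[of \<gamma>] by (intro convergent_imp_Bseq) (auto simp: convergent_def)
  then obtain C where C: "\<And>k. norm (neg_binomial_coeff \<gamma> k * real k powr (\<gamma> + 1)) \<le> C" by (elim BseqE) auto
  have S: "summable (\<lambda>k. C * real k powr (- \<gamma> - 1))"
    using assms by (intro summable_mult) (simp add: summable_real_powr_iff)
  show ?thesis
  proof (rule summable_comparison_test'[OF S, of 1])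
    fix k :: nat assume "1 \<le> k"
    then have one: "real k powr (\<gamma> + 1) * real k powr (- \<gamma> - 1) = 1" by (subst powr_add[symmetric]) simp
    have "\<bar>neg_binomial_coeff \<gamma> k\<bar> = \<bar>neg_binomial_coeff \<gamma> k\<bar> * (real k powr (\<gamma> + 1) * real k powr (- \<gamma> - 1))"
      unfolding one by simp
    also have "\<dots> = norm (neg_binomial_coeff \<gamma> k * real k powr (\<gamma> + 1)) * real k powr (- \<gamma> - 1)"
      by (simp add: abs_mult)
    also have "\<dots> \<le> C * real k powr (- \<gamma> - 1)" by (intro mult_right_mono C) simp
    finally show "norm \<bar>neg_binomial_coeff \<gamma> k\<bar> \<le> C * real k powr (- \<gamma> - 1)" by simp
  qed
qed

text \<open>On the unit circle the series is obtained as a radial limit, the coefficients being absolutely summable.\<close>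

lemma neg_binomial_series:
  fixes z :: complex
  assumes g: "\<gamma> > 0" and z: "norm z \<le> 1"
  shows "(\<lambda>k. of_real (neg_binomial_coeff \<gamma> k) * z ^ k) sums ((1 - z) powr of_real \<gamma>)"
proof -
  let ?a = "neg_binomial_coeff \<gamma>"
  have inside: "(\<lambda>k. of_real (?a k) * y ^ k) sums ((1 - y) powr of_real \<gamma>)" if "norm y < 1" for y :: complex
  proof -
    have "(\<lambda>k. (complex_of_real \<gamma> gchoose k) * (- y) ^ k) sums (1 + - y) powr of_real \<gamma>"
      by (rule gen_binomial_complex) (use that in simp)
    moreover have "complex_of_real \<gamma> gchoose k = of_real (\<gamma> gchoose k)" for k
      by (simp add: gbinomial_prod_rev)
    moreover have "of_real (\<gamma> gchoose k) * (- y) ^ k = of_real (?a k) * y ^ k" for k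
      by (simp add: neg_binomial_coeff_def power_minus[of y])
    ultimately show ?thesis by simp
  qed
  have sm: "summable (\<lambda>k. of_real (?a k) * y ^ k)" if "norm y \<le> 1" for y :: complex
  proof (rule summable_comparison_test'[OF summable_neg_binomial_coeff[OF g], of 0])
    show "norm (of_real (?a k) * y ^ k) \<le> \<bar>?a k\<bar>" for k
      using that by (simp add: norm_mult norm_power mult_left_le power_le_one)
  qed
  define r where "r n = 1 - 1 / real (n + 2)" for n :: nat
  have r: "r n \<ge> 0" "r n < 1" for n by (auto simp: r_def field_simps)
  have rlim: "r \<longlonglongrightarrow> 1" unfolding r_def by real_asymp
  have "uniform_limit {0..1} (\<lambda>n x. \<Sum>k<n. of_real (?a k) * (of_real x * z) ^ k) (\<lambda>x. \<Sum>k. of_real (?a k) * (of_real x * z) ^ k) sequentially"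
  proof (rule Weierstrass_m_test[of _ _ "\<lambda>k. \<bar>?a k\<bar>"])
    fix k and x :: real assume x: "x \<in> {0..1}"
    then have "norm (of_real x * z) \<le> 1 * 1" unfolding norm_mult by (intro mult_mono) (use z in auto)
    then have "norm (of_real x * z) ^ k \<le> 1" by (intro power_le_one) auto
    then show "norm (of_real (?a k) * (of_real x * z) ^ k) \<le> \<bar>?a k\<bar>"
      unfolding norm_mult norm_power norm_of_real by (intro mult_left_le) (simp_all add: norm_mult)
  qed (rule summable_neg_binomial_coeff[OF g])
  then have "continuous_on {0..1} (\<lambda>x. \<Sum>k. of_real (?a k) * (of_real x * z) ^ k)"
    by (rule uniform_limit_theorem[rotated]) (auto intro!: always_eventually continuous_intros)
  then have "(\<lambda>n. \<Sum>k. of_real (?a k) * (of_real (r n) * z) ^ k) \<longlonglongrightarrow> (\<Sum>k. of_real (?a k) * (of_real 1 * z) ^ k)"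
    by (rule continuous_on_tendsto_compose[OF _ rlim]) (use r in \<open>auto intro!: always_eventually less_imp_le\<close>)
  moreover have "(\<Sum>k. of_real (?a k) * (of_real (r n) * z) ^ k) = (1 - of_real (r n) * z) powr of_real \<gamma>" for n
  proof -
    have "norm (of_real (r n) * z) \<le> r n * 1" unfolding norm_mult using r[of n] z by (intro mult_mono) auto
    then show ?thesis using inside[of "of_real (r n) * z"] r[of n] by (simp add: sums_iff)
  qed
  ultimately have A: "(\<lambda>n. (1 - of_real (r n) * z) powr of_real \<gamma>) \<longlonglongrightarrow> (\<Sum>k. of_real (?a k) * z ^ k)" by simp
  have "1 - z \<notin> \<real>\<^sub>\<le>\<^sub>0 \<or> 1 - z = 0 \<and> Re (of_real \<gamma>) > 0"
  proof (cases "z = 1")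
    case False
    have "Re z \<le> 1" using complex_Re_le_cmod[of z] z by simp
    moreover have "Re z \<noteq> 1 \<or> Im z \<noteq> 0" using False by (auto simp: complex_eq_iff)
    ultimately show ?thesis by (auto simp: complex_nonpos_Reals_iff)
  qed (use g in auto)
  then have "(\<lambda>n. (1 - of_real (r n) * z) powr of_real \<gamma>) \<longlonglongrightarrow> (1 - of_real 1 * z) powr of_real \<gamma>"
    by (intro tendsto_powr_complex' tendsto_intros rlim) (auto simp del: Re_complex_of_real)
  then have "(\<lambda>n. (1 - of_real (r n) * z) powr of_real \<gamma>) \<longlonglongrightarrow> (1 - z) powr of_real \<gamma>" by simp
  from LIMSEQ_unique[OF A this] summable_sums[OF sm[OF z]] show ?thesis by simp
qed

lemma norm_exp_minus_linear:
  fixes z :: complex assumes "Re z \<ge> 0"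
  shows "norm (exp (- z) - 1 + z) \<le> 3 * norm z" "norm (exp (- z) - 1 + z) \<le> 3 * (norm z)\<^sup>2"
proof -
  have "norm (exp (- z) - 1 + z) \<le> 3 * norm z \<and> norm (exp (- z) - 1 + z) \<le> 3 * (norm z)\<^sup>2"
  proof (cases "norm z \<le> 1")
    case True
    have "norm (exp (- z) - (\<Sum>k\<le>1. (- z) ^ k / fact k)) \<le> exp \<bar>Re (- z)\<bar> * norm (- z) ^ Suc 1 / fact 1"
      by (rule Taylor_exp)
    moreover have "(\<Sum>k\<le>1. (- z) ^ k / fact k) = 1 - z" by (simp add: atMost_Suc)
    ultimately have "norm (exp (- z) - 1 + z) \<le> exp \<bar>Re z\<bar> * (norm z)\<^sup>2"
      by (simp add: power2_eq_square algebra_simps)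
    also have "exp \<bar>Re z\<bar> \<le> exp 1" using abs_Re_le_cmod[of z] True by simp
    also have "exp 1 \<le> (3::real)" by (rule exp_le)
    finally have "norm (exp (- z) - 1 + z) \<le> 3 * (norm z)\<^sup>2" by (simp add: mult_right_mono)
    moreover have "(norm z)\<^sup>2 \<le> norm z" using True by (simp add: power2_eq_square mult_left_le)
    ultimately show ?thesis by linarith
  next
    case False
    have "norm (exp (- z) - 1 + z) \<le> norm (exp (- z)) + norm (1::complex) + norm z"
      by (intro order_trans[OF norm_triangle_ineq] add_mono order_trans[OF norm_triangle_ineq4]) auto
    also have "norm (exp (- z)) \<le> 1" using assms by simp
    finally have "norm (exp (- z) - 1 + z) \<le> 3 * norm z" using False by simp
    moreover have "norm z \<le> (norm z)\<^sup>2" using False mult_left_mono[of 1 "norm z" "norm z"] by (simp add: power2_eq_square)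
    ultimately show ?thesis by linarith
  qed
  then show "norm (exp (- z) - 1 + z) \<le> 3 * norm z" "norm (exp (- z) - 1 + z) \<le> 3 * (norm z)\<^sup>2" by auto
qed

lemma exp_minus_linear_lower:
  fixes x :: real assumes "x \<ge> 0"
  shows "exp (- x) - 1 + x \<ge> min x (x\<^sup>2) / 4"
proof -
  have em: "exp (- y) \<le> 1 / (1 + y)" if "y \<ge> 0" for y :: real
    using exp_ge_add_one_self[of y] that by (simp add: exp_minus inverse_eq_divide frac_le)
  have small: "exp (- x) - 1 + x \<ge> x\<^sup>2 / 4" if "0 \<le> x" "x \<le> 1" for x :: real
  proof -
    have "exp (- 0) - 1 + 0 - 0\<^sup>2 / 4 \<le> exp (- x) - 1 + x - x\<^sup>2 / 4"
    proof (rule DERIV_nonneg_imp_nondecreasing[OF that(1)])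
      fix y assume y: "0 \<le> y" "y \<le> x"
      have "((\<lambda>y. exp (- y) - 1 + y - y\<^sup>2 / 4) has_real_derivative 1 - exp (- y) - y / 2) (at y)"
        by (auto intro!: derivative_eq_intros)
      moreover have "1 / (1 + y) \<le> 1 - y / 2"
      proof -
        have "y * y \<le> y * 1" using y that by (intro mult_left_mono) auto
        then show ?thesis using y by (simp add: field_simps)
      qed
      then have "0 \<le> 1 - exp (- y) - y / 2" using em[of y] y by linarith
      ultimately show "\<exists>D. ((\<lambda>y. exp (- y) - 1 + y - y\<^sup>2 / 4) has_real_derivative D) (at y) \<and> 0 \<le> D" by blast
    qed
    then show ?thesis by simp
  qed
  show ?thesis
  proof (cases "x \<le> 1")
    case True
    then show ?thesis using small[of x] assms by (auto simp: min_def)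
  next
    case False
    have "exp (- 1) - 1 + 1 - 1 / 4 \<le> exp (- x) - 1 + x - x / 4"
    proof (rule DERIV_nonneg_imp_nondecreasing[where f="\<lambda>y. exp (- y) - 1 + y - y / 4" and a=1 and b=x])
      fix y :: real assume y: "1 \<le> y" "y \<le> x"
      have "((\<lambda>y. exp (- y) - 1 + y - y / 4) has_real_derivative 1 - exp (- y) - 1 / 4) (at y)"
        by (auto intro!: derivative_eq_intros)
      moreover have "1 / (1 + y) \<le> 1 / 2" using y by (simp add: field_simps)
      then have "0 \<le> 1 - exp (- y) - 1 / 4" using em[of y] y by linarith
      ultimately show "\<exists>D. ((\<lambda>y. exp (- y) - 1 + y - y / 4) has_real_derivative D) (at y) \<and> 0 \<le> D" by blast
    qed (use False in simp)
    then have "exp (- x) - 1 + x \<ge> x / 4" using small[of 1] by simp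
    then show ?thesis by (auto simp: min_def)
  qed
qed

lemma norm_exp_minus_linear_le:
  fixes t :: complex assumes "Re t \<ge> 0" "x \<ge> 0"
  shows "norm (exp (- (t * of_real x)) - 1 + t * of_real x) \<le> 12 * (norm t + (norm t)\<^sup>2) * (exp (- x) - 1 + x)"
proof -
  let ?z = "t * of_real x"
  have z: "Re ?z \<ge> 0" "norm ?z = norm t * x" using assms by (auto simp: norm_mult)
  have "norm (exp (- ?z) - 1 + ?z) \<le> 3 * (norm t + (norm t)\<^sup>2) * min x (x\<^sup>2)"
  proof (cases "x \<le> x\<^sup>2")
    case True
    have "norm (exp (- ?z) - 1 + ?z) \<le> 3 * norm t * x" using norm_exp_minus_linear(1)[OF z(1)] z(2) by simp
    also have "\<dots> \<le> 3 * (norm t + (norm t)\<^sup>2) * x" using assms by (intro mult_right_mono) auto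
    finally show ?thesis using True by (simp add: min_def)
  next
    case False
    have "norm (exp (- ?z) - 1 + ?z) \<le> 3 * (norm t)\<^sup>2 * x\<^sup>2" using norm_exp_minus_linear(2)[OF z(1)] z(2) by (simp add: power_mult_distrib)
    also have "\<dots> \<le> 3 * (norm t + (norm t)\<^sup>2) * x\<^sup>2" by (intro mult_right_mono) auto
    finally show ?thesis using False by (simp add: min_def)
  qed
  also have "\<dots> \<le> 3 * (norm t + (norm t)\<^sup>2) * (4 * (exp (- x) - 1 + x))"
    using exp_minus_linear_lower[OF assms(2)] by (intro mult_left_mono) auto
  also have "\<dots> = 12 * (norm t + (norm t)\<^sup>2) * (exp (- x) - 1 + x)" by (simp add: algebra_simps)
  finally show ?thesis .
qed

context heavy_tail begin

definition "kappa = c * Gamma (- \<alpha>)"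

abbreviation "acoef \<equiv> neg_binomial_coeff \<alpha>"

lemma Gamma_minus_alpha_pos:
  assumes "\<beta> < 3" shows "Gamma (- \<alpha>) > 0"
proof -
  have ni: "- \<alpha> \<notin> \<int>\<^sub>\<le>\<^sub>0" "- \<alpha> + 1 \<notin> \<int>\<^sub>\<le>\<^sub>0"
  proof -
    have "real_of_int k \<noteq> - \<alpha>" "real_of_int k \<noteq> - \<alpha> + 1" for k
    proof -
      show "real_of_int k \<noteq> - \<alpha>"
      proof
        assume "real_of_int k = - \<alpha>"
        then have "real_of_int k < real_of_int (- 1)" "real_of_int (- 2) < real_of_int k" using assms beta by auto
        then show False unfolding of_int_less_iff by linarith
      qed
      show "real_of_int k \<noteq> - \<alpha> + 1"
      proof
        assume "real_of_int k = - \<alpha> + 1"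
        then have "real_of_int k < real_of_int 0" "real_of_int (- 1) < real_of_int k" using assms beta by auto
        then show False unfolding of_int_less_iff by linarith
      qed
    qed
    then show "- \<alpha> \<notin> \<int>\<^sub>\<le>\<^sub>0" "- \<alpha> + 1 \<notin> \<int>\<^sub>\<le>\<^sub>0" by (metis nonpos_Ints_cases)+
  qed
  have "Gamma (- \<alpha> + 1 + 1) = (- \<alpha> + 1) * (- \<alpha> * Gamma (- \<alpha>))"
    by (simp only: Gamma_plus1[OF ni(1)] Gamma_plus1[OF ni(2)])
  moreover have "Gamma (- \<alpha> + 1 + 1) > 0" using assms by (intro Gamma_real_pos) simp
  ultimately have "(- \<alpha> + 1) * - \<alpha> * Gamma (- \<alpha>) > 0" by (simp only: mult.assoc)
  moreover have "(- \<alpha> + 1) * - \<alpha> > 0" using beta by (intro mult_neg_neg) auto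
  ultimately show ?thesis by (rule zero_less_mult_pos)
qed

lemma acoef_moments: "acoef sums 0" "(\<lambda>k. real k * acoef k) sums 0"
proof -
  have z: "neg_binomial_coeff \<gamma> sums 0" if "\<gamma> > 0" for \<gamma>
  proof -
    have "(\<lambda>k. complex_of_real (neg_binomial_coeff \<gamma> k)) sums complex_of_real 0"
      using neg_binomial_series[OF that, of 1] by simp
    then show ?thesis by (simp only: sums_of_real_iff)
  qed
  show "acoef sums 0" using z beta by simp
  have "(\<lambda>k. - \<alpha> * neg_binomial_coeff (\<alpha> - 1) k) sums (- \<alpha> * 0)"
    by (intro sums_mult z) (use beta in simp)
  moreover have "- \<alpha> * neg_binomial_coeff (\<alpha> - 1) k = real (Suc k) * acoef (Suc k)" for k
  proof -
    have "real (Suc k) * acoef (Suc k) = - ((-1) ^ k) * (real (Suc k) * (\<alpha> gchoose Suc k))"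
      by (simp add: neg_binomial_coeff_def del: of_nat_Suc)
    also have "real (Suc k) * (\<alpha> gchoose Suc k) = \<alpha> * ((\<alpha> - 1) gchoose k)" by (rule gbinomial_absorption)
    finally have F: "real (Suc k) * acoef (Suc k) = - ((-1) ^ k) * (\<alpha> * ((\<alpha> - 1) gchoose k))" .
    have gen: "- a * (s * X) = - s * (a * X)" for a s X :: real by simp
    show ?thesis unfolding F unfolding neg_binomial_coeff_def by (rule gen)
  qed
  ultimately have "(\<lambda>k. real (Suc k) * acoef (Suc k)) sums 0" by simp
  from sums_Suc[OF this] show "(\<lambda>k. real k * acoef k) sums 0" by simp
qed

lemma acoef_expansion:
  fixes t :: complex assumes t: "Re t \<ge> 0"
  shows "(\<lambda>k. of_real (acoef k) * (exp (- (t * of_nat k)) - 1 + t * of_nat k)) sums ((1 - exp (- t)) powr of_real \<alpha>)"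
proof -
  have "(\<lambda>k. of_real (acoef k) * exp (- t) ^ k) sums ((1 - exp (- t)) powr of_real \<alpha>)"
    by (rule neg_binomial_series) (use t beta in auto)
  moreover have "exp (- t) ^ k = exp (- (t * of_nat k))" for k
    by (simp add: exp_of_nat_mult[symmetric] mult.commute)
  ultimately have 1: "(\<lambda>k. of_real (acoef k) * exp (- (t * of_nat k))) sums ((1 - exp (- t)) powr of_real \<alpha>)" by simp
  have 2: "(\<lambda>k. complex_of_real (acoef k)) sums of_real 0"
    using acoef_moments(1) by (simp only: sums_of_real_iff)
  have "(\<lambda>k. complex_of_real (real k * acoef k)) sums of_real 0"
    using acoef_moments(2) by (simp only: sums_of_real_iff)
  from sums_mult[OF this, of t]
  have 3: "(\<lambda>k. t * of_real (real k * acoef k)) sums 0" by simp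
  from sums_add[OF sums_diff[OF 1 2] 3] show ?thesis
    by (simp add: algebra_simps)
qed

lemma acoef_expansion_real:
  assumes h: "h \<ge> 0"
  shows "(\<lambda>k. acoef k * (exp (- (h * real k)) - 1 + h * real k)) sums ((1 - exp (- h)) powr \<alpha>)"
proof -
  have "(\<lambda>k. complex_of_real (acoef k * (exp (- (h * real k)) - 1 + h * real k))) sums of_real ((1 - exp (- h)) powr \<alpha>)"
    using acoef_expansion[of "of_real h"] h
    by (simp add: exp_of_real[symmetric] powr_of_real[symmetric])
  then show ?thesis by (simp only: sums_of_real_iff)
qed

lemma laplace_expansion:
  fixes t :: complex assumes t: "Re t \<ge> 0"
  shows "(\<lambda>k. of_real (pmf p k) * (exp (- (t * of_nat k)) - 1 + t * of_nat k)) sums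
    (Mean p (\<lambda>k. exp (- t * of_nat k)) - 1 + t * of_real mu)"
proof -
  have i1: "integrable p (\<lambda>k. exp (- (t * of_nat k)))"
    by (rule measure_pmf.integrable_const_bound[where B=1]) (use t in auto)
  have i2: "integrable p (\<lambda>k. complex_of_real (real k))"
    by (rule integrable_of_real[OF integrable_real])
  then have i2': "integrable p (\<lambda>k. t * of_nat k)" by simp
  have "(\<lambda>k. pmf p k *\<^sub>R (exp (- (t * of_nat k)) - 1 + t * of_nat k)) sums Mean p (\<lambda>k. exp (- (t * of_nat k)) - 1 + t * of_nat k)"
    by (rule integral_pmf_nat_sums) (intro Bochner_Integration.integrable_add Bochner_Integration.integrable_diff i1 i2', simp)
  moreover have "Mean p (\<lambda>k. exp (- (t * of_nat k)) - 1 + t * of_nat k) = Mean p (\<lambda>k. exp (- t * of_nat k)) - 1 + t * of_real mu"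
  proof -
    have "Mean p (\<lambda>k. complex_of_real (real k)) = of_real mu"
      unfolding mu_def by (rule integral_complex_of_real)
    then have "Mean p (\<lambda>k. t * of_nat k) = t * of_real mu" by simp
    then show ?thesis using i1 i2' by simp
  qed
  ultimately show ?thesis by (simp add: scaleR_conv_of_real)
qed

lemma coefficient_error:
  assumes b3: "\<beta> < 3" and e: "\<epsilon> > 0"
  shows "eventually (\<lambda>k. \<bar>pmf p k - kappa * acoef k\<bar> \<le> \<epsilon> * acoef k) sequentially"
proof -
  define g where "g = inverse (Gamma (- \<alpha>))"
  have g: "g > 0" using Gamma_minus_alpha_pos[OF b3] by (simp add: g_def)
  have kg: "kappa * g = c" using Gamma_minus_alpha_pos[OF b3] by (simp add: kappa_def g_def)
  have a: "(\<lambda>k. acoef k * real k powr \<beta>) \<longlonglongrightarrow> g"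
    using neg_binomial_coeff_asymp[of \<alpha>] by (simp add: g_def)
  have "(\<lambda>k. \<bar>pmf p k * real k powr \<beta> - kappa * (acoef k * real k powr \<beta>)\<bar> - \<epsilon> * (acoef k * real k powr \<beta>)) \<longlonglongrightarrow> \<bar>c - kappa * g\<bar> - \<epsilon> * g"
    by (intro tendsto_intros p_asymp a)
  then have "eventually (\<lambda>k. \<bar>pmf p k * real k powr \<beta> - kappa * (acoef k * real k powr \<beta>)\<bar> - \<epsilon> * (acoef k * real k powr \<beta>) < 0) sequentially"
    by (rule order_tendstoD) (use kg e g in simp)
  then show ?thesis using eventually_gt_at_top[of 0]
  proof eventually_elim
    case (elim k)
    have pos: "real k powr \<beta> > 0" using elim by simp
    have "pmf p k * real k powr \<beta> - kappa * (acoef k * real k powr \<beta>) = (pmf p k - kappa * acoef k) * real k powr \<beta>"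
      by (simp add: algebra_simps)
    then have "\<bar>pmf p k * real k powr \<beta> - kappa * (acoef k * real k powr \<beta>)\<bar> = \<bar>pmf p k - kappa * acoef k\<bar> * real k powr \<beta>"
      using pos by (simp add: abs_mult)
    then have "\<bar>pmf p k - kappa * acoef k\<bar> * real k powr \<beta> \<le> (\<epsilon> * acoef k) * real k powr \<beta>"
      using elim by (simp add: mult_ac)
    then show ?case using pos by (rule mult_right_le_imp_le)
  qed
qed

text \<open>The weights are compared with \<open>kappa * acoef\<close>, whose generating function is \<open>kappa * (1 - z) powr \<alpha>\<close>.
  Since \<open>acoef\<close> is eventually positive, the same expansion at \<open>t = 1\<close> majorises the error.\<close>

lemma error_term_bound:
  fixes t :: complex
  assumes b3: "\<beta> < 3" and t: "Re t \<ge> 0" and e: "\<epsilon> > 0"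
  obtains B where "\<And>h. h \<ge> 0 \<Longrightarrow> norm (Mean p (\<lambda>k. exp (- (t * of_real h) * of_nat k)) - 1 + (t * of_real h) * of_real mu
       - of_real kappa * (1 - exp (- (t * of_real h))) powr of_real \<alpha>)
     \<le> 12 * (norm t + (norm t)\<^sup>2) * (\<epsilon> * h powr \<alpha> + B * h\<^sup>2)"
proof -
  define q where "q k = pmf p k - kappa * acoef k" for k
  obtain K where K: "\<And>k. k \<ge> K \<Longrightarrow> \<bar>q k\<bar> \<le> \<epsilon> * acoef k"
    using coefficient_error[OF b3 e] by (auto simp: eventually_sequentially q_def)
  define r where "r k = (if k < K then \<bar>q k\<bar> + \<epsilon> * \<bar>acoef k\<bar> else 0)" for k
  have qr: "\<bar>q k\<bar> \<le> \<epsilon> * acoef k + r k" for k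
  proof (cases "k < K")
    case True
    have "\<epsilon> * (- \<bar>acoef k\<bar>) \<le> \<epsilon> * acoef k" using e by (intro mult_left_mono) auto
    then show ?thesis using True by (simp add: r_def)
  qed (use K in \<open>auto simp: r_def\<close>)
  define B where "B = (\<Sum>k<K. r k * (3 * (real k)\<^sup>2))"
  define C where "C = 12 * (norm t + (norm t)\<^sup>2)"
  have C: "C \<ge> 0" by (simp add: C_def)
  show ?thesis
  proof
    fix h :: real assume h: "h \<ge> 0"
    define d where "d x = exp (- x) - 1 + x" for x :: real
    define g where "g k = exp (- ((t * of_real h) * of_nat k)) - 1 + (t * of_real h) * of_nat k" for k :: nat
    have d0: "d x \<ge> 0" for x using exp_ge_add_one_self[of "- x"] by (simp add: d_def)
    have th: "Re (t * of_real h) \<ge> 0" using t h by simp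
    have gd: "norm (g k) \<le> C * d (h * real k)" for k
    proof -
      have "(t * of_real h) * of_nat k = t * of_real (h * real k)" by simp
      then show ?thesis unfolding g_def d_def C_def
        using norm_exp_minus_linear_le[OF t, of "h * real k"] h by (simp only:) auto
    qed
    have d3: "d x \<le> 3 * x\<^sup>2" if "x \<ge> 0" for x
    proof -
      have eq: "complex_of_real (d x) = exp (- of_real x) - 1 + of_real x"
        unfolding d_def by (simp add: exp_of_real[symmetric])
      have "norm (complex_of_real (d x)) \<le> 3 * (norm (complex_of_real x))\<^sup>2"
        unfolding eq by (rule norm_exp_minus_linear(2)) (use that in simp)
      then show ?thesis using d0[of x] by (simp only: norm_of_real) simp
    qed
    let ?E = "Mean p (\<lambda>k. exp (- (t * of_real h) * of_nat k)) - 1 + (t * of_real h) * of_real mu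
       - of_real kappa * (1 - exp (- (t * of_real h))) powr of_real \<alpha>"
    have "(\<lambda>k. of_real (pmf p k) * g k - of_real kappa * (of_real (acoef k) * g k)) sums ?E"
      unfolding g_def by (intro sums_diff sums_mult laplace_expansion acoef_expansion th)
    then have sq: "(\<lambda>k. of_real (q k) * g k) sums ?E" by (simp add: q_def algebra_simps)
    have s1: "(\<lambda>k. \<epsilon> * (acoef k * d (h * real k))) sums (\<epsilon> * (1 - exp (- h)) powr \<alpha>)"
      unfolding d_def by (intro sums_mult acoef_expansion_real h)
    have s2: "(\<lambda>k. r k * d (h * real k)) sums (\<Sum>k<K. r k * d (h * real k))"
      by (rule sums_finite) (auto simp: r_def)
    have s3: "(\<lambda>k. C * (\<epsilon> * (acoef k * d (h * real k)) + r k * d (h * real k))) sums (C * (\<epsilon> * (1 - exp (- h)) powr \<alpha> + (\<Sum>k<K. r k * d (h * real k))))"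
      by (intro sums_mult sums_add s1 s2)
    have le: "norm (of_real (q k) * g k) \<le> C * (\<epsilon> * (acoef k * d (h * real k)) + r k * d (h * real k))" for k
    proof -
      have "norm (of_real (q k) * g k) = \<bar>q k\<bar> * norm (g k)" by (simp add: norm_mult)
      also have "\<dots> \<le> (\<epsilon> * acoef k + r k) * (C * d (h * real k))"
      proof (rule mult_mono[OF qr gd])
        show "0 \<le> \<epsilon> * acoef k + r k" using qr[of k] by (rule order_trans[OF abs_ge_zero])
      qed simp
      finally show ?thesis by (simp add: algebra_simps)
    qed
    have "norm ?E \<le> C * (\<epsilon> * (1 - exp (- h)) powr \<alpha> + (\<Sum>k<K. r k * d (h * real k)))"
      using norm_suminf_le[OF le, OF sums_summable[OF s3]] sq s3 by (simp add: sums_iff)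
    also have "\<dots> \<le> C * (\<epsilon> * h powr \<alpha> + B * h\<^sup>2)"
    proof (intro mult_left_mono add_mono C)
      have "1 - exp (- h) \<le> h" using exp_ge_add_one_self[of "- h"] by simp
      then show "(1 - exp (- h)) powr \<alpha> \<le> h powr \<alpha>" using h beta by (intro powr_mono2) auto
      have "(\<Sum>k<K. r k * d (h * real k)) \<le> (\<Sum>k<K. r k * (3 * (real k)\<^sup>2) * h\<^sup>2)"
      proof (rule sum_mono)
        fix k
        have "r k * d (h * real k) \<le> r k * (3 * (h * real k)\<^sup>2)"
          using h e by (intro mult_left_mono d3) (auto simp: r_def)
        then show "r k * d (h * real k) \<le> r k * (3 * (real k)\<^sup>2) * h\<^sup>2" by (simp add: power_mult_distrib mult_ac)
      qed
      then show "(\<Sum>k<K. r k * d (h * real k)) \<le> B * h\<^sup>2" by (simp add: B_def sum_distrib_right)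
    qed (use e in auto)
    finally show "norm ?E \<le> 12 * (norm t + (norm t)\<^sup>2) * (\<epsilon> * h powr \<alpha> + B * h\<^sup>2)" by (simp add: C_def)
  qed
qed

end

text \<open>Tightness gives a subsequential limit. Truncation at \<open>- K\<close> identifies its Laplace transform, hence its
  characteristic function, and Levy's theorem extends the convergence to the whole sequence.\<close>

lemma laplace_limit_law:
  fixes \<mu> :: "nat \<Rightarrow> real measure" and L :: "complex \<Rightarrow> complex"
  assumes rd: "\<And>N. real_distribution (\<mu> N)"
    and int: "\<And>N s. s \<ge> 0 \<Longrightarrow> integrable (\<mu> N) (\<lambda>x. exp (- s * x))"
    and lim: "\<And>t. Re t \<ge> 0 \<Longrightarrow> (\<lambda>N. \<integral>x. exp (- t * complex_of_real x) \<partial>\<mu> N) \<longlonglongrightarrow> L t"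
    and tight: "tight \<mu>"
  shows "\<exists>M. real_distribution M \<and>
    (\<forall>t. Re t \<ge> 0 \<longrightarrow> integrable M (\<lambda>x. exp (- t * complex_of_real x)) \<and> (\<integral>x. exp (- t * complex_of_real x) \<partial>M) = L t) \<and>
    weak_conv_m \<mu> M"
proof -
  obtain r M where r: "strict_mono (r :: nat \<Rightarrow> nat)" and M: "real_distribution M" and wc: "weak_conv_m (\<mu> \<circ> id \<circ> r) M"
    using tight_imp_convergent_subsubsequence[OF tight strict_mono_id] by blast
  interpret M: real_distribution M by fact
  interpret \<mu>: real_distribution "\<mu> N" for N by (rule rd)
  have wc: "weak_conv_m (\<lambda>j. \<mu> (r j)) M" using wc by (simp add: o_def)
  have bdd: "\<exists>C. \<forall>N. (\<integral>x. exp (- s * x) \<partial>\<mu> N) \<le> C" if "s \<ge> 0" for s :: real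
  proof -
    have "(\<integral>x. exp (- complex_of_real s * complex_of_real x) \<partial>\<mu> N) = complex_of_real (\<integral>x. exp (- s * x) \<partial>\<mu> N)" for N
    proof -
      have "exp (- complex_of_real s * complex_of_real x) = complex_of_real (exp (- s * x))" for x
        by (simp add: exp_of_real[symmetric])
      then show ?thesis by (simp only: integral_complex_of_real)
    qed
    then have "(\<lambda>N. complex_of_real (\<integral>x. exp (- s * x) \<partial>\<mu> N)) \<longlonglongrightarrow> L (of_real s)"
      using lim[of "of_real s"] that by simp
    then have "Bseq (\<lambda>N. complex_of_real (\<integral>x. exp (- s * x) \<partial>\<mu> N))"
      by (intro convergent_imp_Bseq) (auto simp: convergent_def)
    then obtain C where "\<And>N. norm (complex_of_real (\<integral>x. exp (- s * x) \<partial>\<mu> N)) \<le> C" by (elim BseqE) auto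
    then have "(\<integral>x. exp (- s * x) \<partial>\<mu> N) \<le> C" for N by (simp only: norm_of_real abs_le_iff)
    then show ?thesis by blast
  qed
  have conv: "(\<lambda>j. integral\<^sup>L (\<mu> (r j)) f) \<longlonglongrightarrow> integral\<^sup>L M f"
    if "\<And>x. isCont f x" "\<And>x. norm (f x) \<le> B" for f :: "real \<Rightarrow> complex" and B
    by (rule weak_conv_imp_integral_bdd_continuous_conv[OF rd M wc]) (use that in auto)
  have convr: "(\<lambda>j. integral\<^sup>L (\<mu> (r j)) f) \<longlonglongrightarrow> integral\<^sup>L M f"
    if "\<And>x. isCont f x" "\<And>x. norm (f x) \<le> B" for f :: "real \<Rightarrow> real" and B
    by (rule weak_conv_imp_integral_bdd_continuous_conv[OF rd M wc]) (use that in auto)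
  have intM: "integrable M (\<lambda>x. exp (- s * x)) \<and> (\<integral>x. exp (- s * x) \<partial>M) \<le> C"
    if s: "s \<ge> 0" and C: "\<And>N. (\<integral>x. exp (- s * x) \<partial>\<mu> N) \<le> C" for s C :: real
  proof -
    define f where "f K x = exp (- s * max x (- real K))" for K x
    have fc: "isCont (f K) x" for K x unfolding f_def by (intro continuous_intros)
    have fb: "norm (f K x) \<le> exp (s * real K)" for K x
    proof -
      have "- s * max x (- real K) \<le> - s * (- real K)" using s by (intro mult_left_mono_neg) auto
      then show ?thesis by (simp add: f_def)
    qed
    have fm: "f K \<in> borel_measurable borel" for K
      unfolding f_def by measurable
    have fint: "integrable N (f K)" if "real_distribution N" for N K
    proof -
      interpret N: real_distribution N by fact
      show ?thesis by (rule N.integrable_const_bound[where B="exp (s * real K)"]) (use fb fm in auto)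
    qed
    have "(\<integral>x. f K x \<partial>M) \<le> C" for K
    proof (rule LIMSEQ_le_const2[OF convr[OF fc fb]])
      have "(\<integral>x. f K x \<partial>\<mu> N) \<le> (\<integral>x. exp (- s * x) \<partial>\<mu> N)" for N
      proof (rule integral_mono[OF fint[OF rd] int[OF s]])
        fix x show "f K x \<le> exp (- s * x)" unfolding f_def using s by (simp add: mult_left_mono)
      qed
      then show "\<exists>N. \<forall>j\<ge>N. (\<integral>x. f K x \<partial>\<mu> (r j)) \<le> C" using C by (meson order_trans)
    qed
    then have nnf: "(\<integral>\<^sup>+x. ennreal (f K x) \<partial>M) \<le> ennreal C" for K
      by (subst nn_integral_eq_integral[OF fint[OF M]], simp add: f_def, intro ennreal_leI)
    have nn: "(\<integral>\<^sup>+x. ennreal (exp (- s * x)) \<partial>M) \<le> ennreal C"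
    proof -
      have "(\<integral>\<^sup>+x. ennreal (exp (- s * x)) \<partial>M) \<le> (\<integral>\<^sup>+x. (SUP K. ennreal (f K x)) \<partial>M)"
      proof (rule nn_integral_mono)
        fix x
        obtain K where "- x \<le> real K" using real_arch_simple by blast
        then have "exp (- s * x) = f K x" by (simp add: f_def max_def)
        then show "ennreal (exp (- s * x)) \<le> (SUP K. ennreal (f K x))" by (intro SUP_upper2[of K]) auto
      qed
      also have "\<dots> = (SUP K. \<integral>\<^sup>+x. ennreal (f K x) \<partial>M)"
      proof (rule nn_integral_monotone_convergence_SUP)
        show "incseq (\<lambda>K x. ennreal (f K x))"
          unfolding incseq_def le_fun_def
        proof (intro allI impI ennreal_leI)
          fix m n :: nat and x assume "m \<le> n"
          then have "- s * max x (- real m) \<le> - s * max x (- real n)"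
            using s by (intro mult_left_mono_neg) auto
          then show "f m x \<le> f n x" by (simp add: f_def)
        qed
        show "(\<lambda>x. ennreal (f K x)) \<in> borel_measurable M" for K using fm by measurable
      qed
      also have "\<dots> \<le> ennreal C" by (intro SUP_least nnf)
      finally show ?thesis .
    qed
    have i: "integrable M (\<lambda>x. exp (- s * x))"
    proof (rule integrableI_bounded)
      show "(\<integral>\<^sup>+x. ennreal (norm (exp (- s * x))) \<partial>M) < \<infinity>"
        using le_less_trans[OF nn ennreal_less_top] by simp
    qed measurable
    have "C \<ge> 0" using C[of 0] by (rule order_trans[rotated]) simp
    moreover have "ennreal (\<integral>x. exp (- s * x) \<partial>M) \<le> ennreal C"
      using nn by (subst (asm) nn_integral_eq_integral[OF i]) auto
    ultimately show ?thesis using i by simp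
  qed
  have main: "integrable M (\<lambda>x. exp (- t * complex_of_real x)) \<and> (\<integral>x. exp (- t * complex_of_real x) \<partial>M) = L t"
    if t: "Re t \<ge> 0" for t
  proof -
    obtain C where C: "\<And>N. (\<integral>x. exp (- (Re t + 1) * x) \<partial>\<mu> N) \<le> C" using bdd[of "Re t + 1"] t by auto
    have em: "(\<lambda>x. exp (- t * complex_of_real x)) \<in> borel_measurable borel" by measurable
    have iM: "integrable M (\<lambda>x. exp (- t * complex_of_real x))"
    proof (rule Bochner_Integration.integrable_bound)
      show "integrable M (\<lambda>x. exp (- Re t * x))" using intM[OF t] bdd[OF t] by blast
    qed (use em in auto)
    have i\<mu>: "integrable (\<mu> N) (\<lambda>x. exp (- t * complex_of_real x))" for N
    proof (rule Bochner_Integration.integrable_bound)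
      show "integrable (\<mu> N) (\<lambda>x. exp (- Re t * x))" by (rule int[OF t])
    qed (use em in auto)
    define g where "g K x = exp (- t * complex_of_real (max x (- real K)))" for K :: nat and x
    have gc: "isCont (g K) x" for K x unfolding g_def by (intro continuous_intros)
    have gb: "norm (g K x) \<le> exp (Re t * real K)" for K x
    proof -
      have "- Re t * max x (- real K) \<le> - Re t * (- real K)" using t by (intro mult_left_mono_neg) auto
      then show ?thesis by (simp add: g_def)
    qed
    have gm: "g K \<in> borel_measurable borel" for K unfolding g_def by measurable
    have diff: "norm (exp (- t * complex_of_real x) - g K x) \<le> 2 * exp (- real K) * exp (- (Re t + 1) * x)" for K x
    proof (cases "x \<ge> - real K")
      case True
      then show ?thesis by (simp add: g_def max_def)
    next
      case False
      have "norm (exp (- t * complex_of_real x) - g K x) \<le> norm (exp (- t * complex_of_real x)) + norm (g K x)"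
        by (rule norm_triangle_ineq4)
      also have "norm (exp (- t * complex_of_real x)) = exp (- Re t * x)" by simp
      also have "norm (g K x) \<le> exp (- Re t * x)"
        using False t mult_left_mono[of "real K" "- x" "Re t"] by (simp add: g_def max_def)
      also have "exp (- Re t * x) + exp (- Re t * x) = 2 * (exp x * exp (- (Re t + 1) * x))"
        by (simp add: mult_exp_exp algebra_simps)
      also have "\<dots> \<le> 2 * (exp (- real K) * exp (- (Re t + 1) * x))"
        using False by (intro mult_left_mono mult_right_mono) auto
      finally show ?thesis by simp
    qed
    have close: "norm ((\<integral>x. exp (- t * complex_of_real x) \<partial>N) - (\<integral>x. g K x \<partial>N)) \<le> 2 * exp (- real K) * C"
      if N: "real_distribution N" and iN: "integrable N (\<lambda>x. exp (- t * complex_of_real x))"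
        and i1: "integrable N (\<lambda>x. exp (- (Re t + 1) * x))" and le: "(\<integral>x. exp (- (Re t + 1) * x) \<partial>N) \<le> C" for N K
    proof -
      interpret N: real_distribution N by fact
      have gi: "integrable N (g K)"
        by (rule N.integrable_const_bound[where B="exp (Re t * real K)"]) (use gb gm in auto)
      have "norm ((\<integral>x. exp (- t * complex_of_real x) \<partial>N) - (\<integral>x. g K x \<partial>N)) = norm (\<integral>x. exp (- t * complex_of_real x) - g K x \<partial>N)"
        using iN gi by simp
      also have "\<dots> \<le> (\<integral>x. norm (exp (- t * complex_of_real x) - g K x) \<partial>N)" by (rule integral_norm_bound)
      also have "\<dots> \<le> (\<integral>x. 2 * exp (- real K) * exp (- (Re t + 1) * x) \<partial>N)"
        by (rule integral_mono) (use iN gi i1 diff in \<open>auto intro!: integrable_mult_right\<close>)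
      also have "\<dots> = 2 * exp (- real K) * (\<integral>x. exp (- (Re t + 1) * x) \<partial>N)" by simp
      also have "\<dots> \<le> 2 * exp (- real K) * C" using le by (intro mult_left_mono) auto
      finally show ?thesis .
    qed
    have t1: "Re t + 1 \<ge> 0" using t by simp
    have "norm ((\<integral>x. exp (- t * complex_of_real x) \<partial>M) - L t) \<le> 4 * exp (- real K) * C" for K
    proof -
      have "(\<lambda>j. norm ((\<integral>x. exp (- t * complex_of_real x) \<partial>\<mu> (r j)) - (\<integral>x. g K x \<partial>\<mu> (r j)))) \<longlonglongrightarrow> norm (L t - (\<integral>x. g K x \<partial>M))"
        by (intro tendsto_norm tendsto_diff conv[OF gc gb] LIMSEQ_subseq_LIMSEQ[OF lim[OF t] r, unfolded o_def])
      then have "norm (L t - (\<integral>x. g K x \<partial>M)) \<le> 2 * exp (- real K) * C"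
        by (rule LIMSEQ_le_const2) (use close[OF rd i\<mu> int[OF t1] C] in blast)
      moreover have "norm ((\<integral>x. exp (- t * complex_of_real x) \<partial>M) - (\<integral>x. g K x \<partial>M)) \<le> 2 * exp (- real K) * C"
        by (rule close[OF M iM]) (use intM[OF t1 C] in auto)
      ultimately show ?thesis
        using norm_triangle_ineq4[of "(\<integral>x. exp (- t * complex_of_real x) \<partial>M) - (\<integral>x. g K x \<partial>M)" "L t - (\<integral>x. g K x \<partial>M)"] by simp
    qed
    moreover have "(\<lambda>K. 4 * exp (- real K) * C) \<longlonglongrightarrow> 0" by real_asymp
    ultimately have "norm ((\<integral>x. exp (- t * complex_of_real x) \<partial>M) - L t) \<le> 0"
      by (intro LIMSEQ_le_const) auto
    then show ?thesis using iM by simp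
  qed
  have "weak_conv_m \<mu> M"
  proof (rule levy_continuity[OF rd M])
    fix s :: real
    have ch: "char N s = (\<integral>x. exp (- (- \<i> * of_real s) * complex_of_real x) \<partial>N)" for N
      unfolding char_def by (simp add: mult_ac)
    show "(\<lambda>N. char (\<mu> N) s) \<longlonglongrightarrow> char M s"
      using lim[of "- \<i> * of_real s"] main[of "- \<i> * of_real s"] by (simp only: ch) simp
  qed
  then show ?thesis using M main by blast
qed

context heavy_tail begin

definition "scal N = real (Suc N) powr (- 1 / \<alpha>)"

definition "X N xs = scal N * (real (sum_list xs) - real (Suc N) * mu)"

lemma scal_pos: "scal N > 0" by (simp add: scal_def)

lemma scal_powr: "real (Suc N) * scal N powr \<alpha> = 1"
proof -
  have "(y powr (- 1 / a)) powr a = y powr (- 1)" if "a > 0" for y a :: real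
    using that by (simp add: powr_powr)
  from this[of \<alpha> "real (Suc N)"] beta have "scal N powr \<alpha> = real (Suc N) powr (- 1)" by (simp add: scal_def)
  then show ?thesis by (simp add: powr_minus)
qed

lemma scal_lim: "scal \<longlonglongrightarrow> 0" unfolding scal_def using beta by real_asymp

lemma scal_sq_lim: "\<beta> < 3 \<Longrightarrow> (\<lambda>N. real (Suc N) * (scal N)\<^sup>2) \<longlonglongrightarrow> 0"
proof -
  assume b3: "\<beta> < 3"
  have ex: "1 - 2 / \<alpha> < 0" using b3 beta by (simp add: field_simps)
  have "(\<lambda>N. real (Suc N) powr (1 - 2 / \<alpha>)) \<longlonglongrightarrow> 0"
    by (rule tendsto_neg_powr[OF ex]) real_asymp
  moreover have "real (Suc N) powr (1 - 2 / \<alpha>) = real (Suc N) * (scal N)\<^sup>2" for N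
  proof -
    have "y powr (1 - 2 / a) = y * (y powr (- 1 / a))\<^sup>2" if "y > 0" for y a :: real
    proof -
      have "y powr (1 - 2 / a) = y powr (1 + (- 1 / a + - 1 / a))" by simp
      also have "\<dots> = y * (y powr (- 1 / a))\<^sup>2" using that by (simp only: powr_add powr_one power2_eq_square less_imp_le)
      finally show ?thesis .
    qed
    then show ?thesis by (simp add: scal_def)
  qed
  ultimately show ?thesis by simp
qed

lemma exp_linear_remainder:
  fixes w :: "nat \<Rightarrow> complex"
  assumes "w \<longlonglongrightarrow> 0" "(\<lambda>N. real (Suc N) * (norm (w N))\<^sup>2) \<longlonglongrightarrow> 0"
  shows "(\<lambda>N. of_nat (Suc N) * ((1 - w N) * exp (w N) - 1)) \<longlonglongrightarrow> 0"
proof -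
  define \<rho> where "\<rho> N = exp (w N) - 1 - w N" for N
  have "norm (\<rho> N) \<le> exp (norm (w N)) * (norm (w N))\<^sup>2" for N
  proof -
    have "norm (exp (w N) - (\<Sum>k\<le>1. w N ^ k / fact k)) \<le> exp \<bar>Re (w N)\<bar> * norm (w N) ^ Suc 1 / fact 1"
      by (rule Taylor_exp)
    also have "\<dots> \<le> exp (norm (w N)) * (norm (w N))\<^sup>2"
      using abs_Re_le_cmod[of "w N"] by (simp add: power2_eq_square mult_right_mono)
    finally show ?thesis by (simp add: \<rho>_def atMost_Suc algebra_simps)
  qed
  then have bd: "norm (of_nat (Suc N) * \<rho> N) \<le> (real (Suc N) * (norm (w N))\<^sup>2) * exp (norm (w N))" for N
    unfolding norm_mult norm_of_nat by (simp add: mult_left_mono mult_ac del: of_nat_Suc)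
  have "(\<lambda>N. (real (Suc N) * (norm (w N))\<^sup>2) * exp (norm (w N))) \<longlonglongrightarrow> 0 * exp (norm (0::complex))"
    by (intro tendsto_intros assms)
  then have lim0: "(\<lambda>N. (real (Suc N) * (norm (w N))\<^sup>2) * exp (norm (w N))) \<longlonglongrightarrow> 0"
    by (simp only: mult_zero_left)
  have R: "(\<lambda>N. of_nat (Suc N) * \<rho> N) \<longlonglongrightarrow> 0"
    by (rule Lim_null_comparison[OF always_eventually lim0]) (use bd in blast)
  have W: "(\<lambda>N. of_nat (Suc N) * (w N)\<^sup>2) \<longlonglongrightarrow> 0"
    by (rule tendsto_norm_zero_cancel) (use assms(2) in \<open>simp add: norm_mult norm_power del: of_nat_Suc\<close>)
  have "(\<lambda>N. (1 - w N) * (of_nat (Suc N) * \<rho> N) - of_nat (Suc N) * (w N)\<^sup>2) \<longlonglongrightarrow> (1 - 0) * 0 - 0"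
    by (intro tendsto_intros assms R W)
  moreover have "(1 - w N) * (of_nat (Suc N) * \<rho> N) - of_nat (Suc N) * (w N)\<^sup>2 = of_nat (Suc N) * ((1 - w N) * exp (w N) - 1)" for N
    by (simp add: \<rho>_def power2_eq_square algebra_simps del: of_nat_Suc)
  ultimately show ?thesis by simp
qed

lemma laplace_X:
  fixes t :: complex
  assumes t: "Re t \<ge> 0"
  shows "Mean (R N) (\<lambda>xs. exp (- t * complex_of_real (X N xs))) =
     exp (t * of_real (scal N) * of_real mu) ^ Suc N * Mean p (\<lambda>k. exp (- (t * of_real (scal N)) * of_nat k)) ^ N"
proof -
  have "exp (- t * complex_of_real (X N xs)) = exp (t * of_real (scal N) * of_real mu) ^ Suc N * exp (- (t * of_real (scal N)) * of_nat (sum_list xs))" for xs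
  proof -
    have "- t * complex_of_real (X N xs) = of_nat (Suc N) * (t * of_real (scal N) * of_real mu) + - (t * of_real (scal N)) * of_nat (sum_list xs)"
      by (simp add: X_def algebra_simps)
    then show ?thesis by (simp only: exp_add exp_of_nat_mult)
  qed
  then show ?thesis
    using laplace_replicate[of "t * of_real (scal N)" N] t scal_pos[of N] by (simp add: less_imp_le)
qed

lemma laplace_X_tendsto_nonzero:
  fixes t :: complex
  assumes b3: "\<beta> < 3" and t: "Re t \<ge> 0" and t0: "t \<noteq> 0"
  shows "(\<lambda>N. Mean (R N) (\<lambda>xs. exp (- t * complex_of_real (X N xs)))) \<longlonglongrightarrow> exp (of_real kappa * t powr of_real \<alpha>)"
proof -
  define s where "s N = t * of_real (scal N)" for N
  define \<phi> where "\<phi> N = Mean p (\<lambda>k. exp (- s N * of_nat k))" for N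
  define T where "T N = (1 - exp (- s N)) powr of_real \<alpha>" for N
  define n where "n N = complex_of_nat (Suc N)" for N
  define C where "C = 12 * (norm t + (norm t)\<^sup>2)"
  have C: "C \<ge> 0" by (simp add: C_def)
  have nn: "n N \<noteq> 0" for N unfolding n_def using of_nat_0_neq by metis
  have snorm: "norm (s N) = norm t * scal N" for N using scal_pos[of N] by (simp add: s_def norm_mult)
  have Tlim: "(\<lambda>N. n N * T N) \<longlonglongrightarrow> t powr of_real \<alpha>"
  proof -
    define y where "y N = (1 - exp (- s N)) / of_real (scal N)" for N
    have bd: "norm (y N - t) \<le> 3 * (norm t)\<^sup>2 * scal N" for N
    proof -
      have "y N - t = - ((exp (- s N) - 1 + s N) / of_real (scal N))"
        using scal_pos[of N] by (simp add: y_def s_def field_simps)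
      then have "norm (y N - t) = norm (exp (- s N) - 1 + s N) / scal N"
        using scal_pos[of N] by (simp add: norm_divide)
      also have "\<dots> \<le> (3 * (norm (s N))\<^sup>2) / scal N"
        using scal_pos[of N] t by (intro divide_right_mono norm_exp_minus_linear(2)) (auto simp: s_def)
      also have "\<dots> = 3 * (norm t)\<^sup>2 * scal N"
        using scal_pos[of N] by (simp add: snorm power2_eq_square)
      finally show ?thesis .
    qed
    have "(\<lambda>N. 3 * (norm t)\<^sup>2 * scal N) \<longlonglongrightarrow> 3 * (norm t)\<^sup>2 * 0" by (intro tendsto_intros scal_lim)
    then have lim0: "(\<lambda>N. 3 * (norm t)\<^sup>2 * scal N) \<longlonglongrightarrow> 0" by (simp only: mult_zero_right)
    have "(\<lambda>N. y N - t) \<longlonglongrightarrow> 0"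
      by (rule Lim_null_comparison[OF always_eventually lim0]) (use bd in blast)
    then have "y \<longlonglongrightarrow> t" by (rule Lim_null[THEN iffD2])
    moreover have "t \<notin> \<real>\<^sub>\<le>\<^sub>0"
      using t t0 by (auto simp: complex_nonpos_Reals_iff complex_eq_iff)
    ultimately have "(\<lambda>N. y N powr of_real \<alpha>) \<longlonglongrightarrow> t powr of_real \<alpha>"
      by (intro tendsto_powr_complex tendsto_const)
    moreover have "n N * T N = y N powr of_real \<alpha>" for N
    proof -
      have "1 - exp (- s N) = of_real (scal N) * y N" using scal_pos[of N] by (simp add: y_def)
      then have "T N = of_real (scal N) powr of_real \<alpha> * y N powr of_real \<alpha>"
        unfolding T_def using scal_pos[of N] by (simp only:) (rule powr_times_real_left, auto)
      also have "complex_of_real (scal N) powr of_real \<alpha> = of_real (scal N powr \<alpha>)"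
        using scal_pos[of N] by (intro powr_of_real) simp
      finally have "n N * T N = of_real (real (Suc N) * scal N powr \<alpha>) * y N powr of_real \<alpha>"
        by (simp add: n_def del: of_nat_Suc)
      then show ?thesis by (simp only: scal_powr) simp
    qed
    ultimately show ?thesis by simp
  qed
  have Elim: "(\<lambda>N. n N * (\<phi> N - 1 + s N * of_real mu - of_real kappa * T N)) \<longlonglongrightarrow> 0"
  proof (rule LIMSEQ_I)
    fix r :: real assume r: "r > 0"
    define \<epsilon> where "\<epsilon> = r / (2 * (C + 1))"
    have e: "\<epsilon> > 0" using r C by (simp add: \<epsilon>_def)
    have Ce: "C * \<epsilon> \<le> r / 2"
    proof -
      have "C * r \<le> (C + 1) * r" using r by simp
      then show ?thesis using C by (simp add: \<epsilon>_def field_simps)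
    qed
    obtain B where B: "\<And>h. h \<ge> 0 \<Longrightarrow> norm (Mean p (\<lambda>k. exp (- (t * of_real h) * of_nat k)) - 1 + (t * of_real h) * of_real mu
       - of_real kappa * (1 - exp (- (t * of_real h))) powr of_real \<alpha>) \<le> 12 * (norm t + (norm t)\<^sup>2) * (\<epsilon> * h powr \<alpha> + B * h\<^sup>2)"
      using error_term_bound[OF b3 t e] by blast
    have "(\<lambda>N. C * B * (real (Suc N) * (scal N)\<^sup>2)) \<longlonglongrightarrow> C * B * 0" by (intro tendsto_intros scal_sq_lim b3)
    then have "eventually (\<lambda>N. C * B * (real (Suc N) * (scal N)\<^sup>2) < r / 2) sequentially"
      by (rule order_tendstoD) (use r in simp)
    then obtain N0 where N0: "\<And>N. N \<ge> N0 \<Longrightarrow> C * B * (real (Suc N) * (scal N)\<^sup>2) < r / 2" by (auto simp: eventually_sequentially)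
    show "\<exists>no. \<forall>N\<ge>no. norm (n N * (\<phi> N - 1 + s N * of_real mu - of_real kappa * T N) - 0) < r"
    proof (intro exI allI impI)
      fix N assume N: "N \<ge> N0"
      have "norm (\<phi> N - 1 + s N * of_real mu - of_real kappa * T N) \<le> C * (\<epsilon> * scal N powr \<alpha> + B * (scal N)\<^sup>2)"
        using B[of "scal N"] scal_pos[of N] by (simp add: \<phi>_def s_def T_def C_def)
      then have "norm (n N * (\<phi> N - 1 + s N * of_real mu - of_real kappa * T N) - 0) \<le> real (Suc N) * (C * (\<epsilon> * scal N powr \<alpha> + B * (scal N)\<^sup>2))"
        unfolding diff_0_right norm_mult n_def norm_of_nat by (rule mult_left_mono) simp
      also have "\<dots> = C * \<epsilon> * (real (Suc N) * scal N powr \<alpha>) + C * B * (real (Suc N) * (scal N)\<^sup>2)"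
        by (simp add: algebra_simps del: of_nat_Suc)
      also have "\<dots> = C * \<epsilon> + C * B * (real (Suc N) * (scal N)\<^sup>2)" by (simp only: scal_powr)
      also have "\<dots> < r" using Ce N0[OF N] by linarith
      finally show "norm (n N * (\<phi> N - 1 + s N * of_real mu - of_real kappa * T N) - 0) < r" .
    qed
  qed
  have "(\<lambda>N. n N * (\<phi> N - 1 + s N * of_real mu - of_real kappa * T N) + of_real kappa * (n N * T N)) \<longlonglongrightarrow> 0 + of_real kappa * t powr of_real \<alpha>"
    by (intro tendsto_intros Elim Tlim)
  then have A: "(\<lambda>N. n N * (\<phi> N - 1 + s N * of_real mu)) \<longlonglongrightarrow> of_real kappa * t powr of_real \<alpha>"
    by (simp add: algebra_simps)
  have slim: "s \<longlonglongrightarrow> 0"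
  proof -
    have "(\<lambda>N. t * of_real (scal N)) \<longlonglongrightarrow> t * of_real 0" by (intro tendsto_intros scal_lim)
    then show ?thesis by (simp add: s_def[abs_def])
  qed
  define w where "w N = s N * of_real mu" for N
  have wlim: "w \<longlonglongrightarrow> 0" unfolding w_def using tendsto_mult[OF slim tendsto_const, of "of_real mu"] by simp
  have nlim: "(\<lambda>N. 1 / n N) \<longlonglongrightarrow> 0"
  proof -
    have "(\<lambda>N. complex_of_real (1 / real (Suc N))) \<longlonglongrightarrow> of_real 0" by (intro tendsto_of_real) real_asymp
    then show ?thesis by (simp add: n_def del: of_nat_Suc)
  qed
  have phlim: "\<phi> \<longlonglongrightarrow> 1"
  proof -
    have "(\<lambda>N. (n N * (\<phi> N - 1 + w N)) * (1 / n N) + 1 - w N) \<longlonglongrightarrow> (of_real kappa * t powr of_real \<alpha>) * 0 + 1 - 0"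
      by (rule tendsto_diff[OF tendsto_add[OF tendsto_mult[OF A[folded w_def] nlim] tendsto_const] wlim])
    then show ?thesis using nn by simp
  qed
  define \<psi> where "\<psi> N = \<phi> N * exp (w N)" for N
  have w2: "(\<lambda>N. real (Suc N) * (norm (w N))\<^sup>2) \<longlonglongrightarrow> 0"
  proof -
    have "(\<lambda>N. (norm t * \<bar>mu\<bar>)\<^sup>2 * (real (Suc N) * (scal N)\<^sup>2)) \<longlonglongrightarrow> (norm t * \<bar>mu\<bar>)\<^sup>2 * 0"
      by (intro tendsto_intros scal_sq_lim b3)
    moreover have "(norm t * \<bar>mu\<bar>)\<^sup>2 * (real (Suc N) * (scal N)\<^sup>2) = real (Suc N) * (norm (w N))\<^sup>2" for N
      by (simp add: w_def norm_mult snorm power_mult_distrib mult_ac del: of_nat_Suc)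
    ultimately show ?thesis by (simp only: mult_zero_right)
  qed
  have rem: "(\<lambda>N. n N * ((1 - w N) * exp (w N) - 1)) \<longlonglongrightarrow> 0"
    unfolding n_def by (rule exp_linear_remainder[OF wlim w2])
  have "(\<lambda>N. (n N * (\<phi> N - 1 + w N)) * exp (w N) + n N * ((1 - w N) * exp (w N) - 1)) \<longlonglongrightarrow> (of_real kappa * t powr of_real \<alpha>) * exp 0 + 0"
    by (rule tendsto_add[OF tendsto_mult[OF A[folded w_def] tendsto_exp[OF wlim]] rem])
  moreover have "(n N * (\<phi> N - 1 + w N)) * exp (w N) + n N * ((1 - w N) * exp (w N) - 1) = n N * (\<psi> N - 1)" for N
    by (simp add: \<psi>_def algebra_simps)
  ultimately have Blim: "(\<lambda>N. n N * (\<psi> N - 1)) \<longlonglongrightarrow> of_real kappa * t powr of_real \<alpha>" by simp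
  define a where "a N = of_nat N * (\<psi> (N - 1) - 1)" for N
  have "(\<lambda>N. a (Suc N)) \<longlonglongrightarrow> of_real kappa * t powr of_real \<alpha>" using Blim by (simp add: a_def n_def)
  then have "a \<longlonglongrightarrow> of_real kappa * t powr of_real \<alpha>" by (rule LIMSEQ_imp_Suc)
  from LIMSEQ_Suc[OF tendsto_one_plus_over_n_power_exp[OF this]]
  have "(\<lambda>N. (1 + a (Suc N) / of_nat (Suc N)) ^ Suc N) \<longlonglongrightarrow> exp (of_real kappa * t powr of_real \<alpha>)" .
  moreover have "1 + a (Suc N) / of_nat (Suc N) = \<psi> N" for N
    using nn[of N] by (simp add: a_def n_def del: of_nat_Suc)
  ultimately have "(\<lambda>N. \<psi> N ^ Suc N) \<longlonglongrightarrow> exp (of_real kappa * t powr of_real \<alpha>)" by simp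
  from tendsto_divide[OF this phlim]
  have "(\<lambda>N. \<psi> N ^ Suc N / \<phi> N) \<longlonglongrightarrow> exp (of_real kappa * t powr of_real \<alpha>)" by simp
  moreover have "eventually (\<lambda>N. \<psi> N ^ Suc N / \<phi> N = Mean (R N) (\<lambda>xs. exp (- t * complex_of_real (X N xs)))) sequentially"
    using tendsto_imp_eventually_ne[OF phlim, of 0, OF one_neq_zero]
  proof eventually_elim
    case (elim N)
    then show ?case unfolding laplace_X[OF t]
      by (simp add: \<psi>_def \<phi>_def w_def s_def power_mult_distrib)
  qed
  ultimately show ?thesis by (rule Lim_transform_eventually)
qed

lemma laplace_X_tendsto:
  fixes t :: complex
  assumes b3: "\<beta> < 3" and t: "Re t \<ge> 0"
  shows "(\<lambda>N. Mean (R N) (\<lambda>xs. exp (- t * complex_of_real (X N xs)))) \<longlonglongrightarrow> exp (of_real kappa * t powr of_real \<alpha>)"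
proof (cases "t = 0")
  case False
  then show ?thesis using laplace_X_tendsto_nonzero[OF b3 t] by simp
qed simp

lemma nn_integral_sum_list:
  "(\<integral>\<^sup>+xs. ennreal (real (sum_list xs)) \<partial>R N) = of_nat N * (\<integral>\<^sup>+k. ennreal (real k) \<partial>p)"
proof (induction N)
  case (Suc N)
  have "(\<integral>\<^sup>+xs. ennreal (real (sum_list xs)) \<partial>R (Suc N)) = (\<integral>\<^sup>+x. \<integral>\<^sup>+xs. ennreal (real x) + ennreal (real (sum_list xs)) \<partial>R N \<partial>p)"
    by (simp add: ennreal_plus[symmetric] del: ennreal_plus)
  also have "\<dots> = (\<integral>\<^sup>+k. ennreal (real k) \<partial>p) + of_nat N * (\<integral>\<^sup>+k. ennreal (real k) \<partial>p)"
    by (simp add: nn_integral_add Suc.IH measure_pmf.emeasure_space_1)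
  finally show ?case by (simp add: algebra_simps)
qed simp

lemma
  shows integrable_sum_list: "integrable (R N) (\<lambda>xs. real (sum_list xs))"
    and expectation_sum_list: "Mean (R N) (\<lambda>xs. real (sum_list xs)) = real N * mu"
proof -
  have m: "(\<integral>\<^sup>+k. ennreal (real k) \<partial>p) = ennreal mu"
    unfolding mu_def by (rule nn_integral_eq_integral[OF integrable_real]) simp
  have e: "(\<integral>\<^sup>+xs. ennreal (real (sum_list xs)) \<partial>R N) = ennreal (real N * mu)"
    unfolding nn_integral_sum_list m by (simp add: ennreal_mult mu_nonneg ennreal_of_nat_eq_real_of_nat)
  show i: "integrable (R N) (\<lambda>xs. real (sum_list xs))"
    by (rule integrableI_nonneg) (simp_all add: e)
  have "ennreal (Mean (R N) (\<lambda>xs. real (sum_list xs))) = ennreal (real N * mu)"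
    using e by (subst (asm) nn_integral_eq_integral[OF i]) auto
  then show "Mean (R N) (\<lambda>xs. real (sum_list xs)) = real N * mu"
    using mu_nonneg by (simp del: integral_nonneg_eq_0_iff_AE)
qed

lemma integrable_exp_X: "s \<ge> 0 \<Longrightarrow> integrable (R N) (\<lambda>xs. exp (- s * X N xs))"
  using integrable_laplace[of s "scal N" N "scal N * (real (Suc N) * mu)"] scal_pos[of N]
  by (simp add: X_def right_diff_distrib mult.commute del: of_nat_Suc)

lemma integrable_X: "integrable (R N) (X N)"
  unfolding X_def[abs_def] by (intro integrable_mult_right Bochner_Integration.integrable_diff integrable_sum_list) simp

lemma expectation_X: "Mean (R N) (X N) \<le> 0"
proof -
  have "Mean (R N) (X N) = scal N * (real N * mu - real (Suc N) * mu)"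
    unfolding X_def[abs_def] using integrable_sum_list[of N]
    by (simp add: expectation_sum_list del: of_nat_Suc)
  also have "\<dots> = - (scal N * mu)" by (simp add: algebra_simps)
  also have "\<dots> \<le> 0" using scal_pos[of N] mu_nonneg by simp
  finally show ?thesis .
qed

text \<open>Since \<open>E X \<le> 0\<close> and \<open>x + exp (- x) \<ge> 0\<close>, the single bound on \<open>E (exp (- X))\<close> controls both tails.\<close>

lemma X_tail:
  assumes b3: "\<beta> < 3" and e: "\<epsilon> > 0"
  obtains K where "K > 0" "\<And>N. Pr (R N) {xs. \<bar>X N xs\<bar> \<ge> K} < \<epsilon>"
proof -
  have "complex_of_real (Mean (R N) (\<lambda>xs. exp (- 1 * X N xs))) = Mean (R N) (\<lambda>xs. exp (- 1 * complex_of_real (X N xs)))" for N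
  proof -
    have "exp (- 1 * complex_of_real x) = complex_of_real (exp (- 1 * x))" for x by (simp add: exp_of_real[symmetric])
    then show ?thesis by (simp only: integral_complex_of_real)
  qed
  then have "(\<lambda>N. complex_of_real (Mean (R N) (\<lambda>xs. exp (- 1 * X N xs)))) \<longlonglongrightarrow> exp (of_real kappa * 1 powr of_real \<alpha>)"
    using laplace_X_tendsto[OF b3, of 1] by (simp only:) simp
  then have "Bseq (\<lambda>N. complex_of_real (Mean (R N) (\<lambda>xs. exp (- 1 * X N xs))))"
    by (intro convergent_imp_Bseq) (auto simp: convergent_def)
  then obtain C where C0: "C > 0" and "\<And>N. norm (complex_of_real (Mean (R N) (\<lambda>xs. exp (- 1 * X N xs)))) \<le> C"
    by (elim BseqE) auto
  then have C: "Mean (R N) (\<lambda>xs. exp (- X N xs)) \<le> C" for N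
    by (simp only: norm_of_real abs_le_iff) simp
  have ie: "integrable (R N) (\<lambda>xs. exp (- X N xs))" for N using integrable_exp_X[of 1 N] by simp
  define K where "K = 2 * C / \<epsilon> + 1"
  have K: "K > 0" using C0 e by (simp add: K_def add_pos_pos)
  show ?thesis
  proof (rule that[OF K])
    fix N
    have "Pr (R N) {xs. \<bar>X N xs\<bar> \<ge> K} \<le> Pr (R N) ({xs. exp (- X N xs) \<ge> K} \<union> {xs. X N xs + exp (- X N xs) \<ge> K})"
    proof (rule measure_pmf.finite_measure_mono)
      show "{xs. \<bar>X N xs\<bar> \<ge> K} \<subseteq> {xs. exp (- X N xs) \<ge> K} \<union> {xs. X N xs + exp (- X N xs) \<ge> K}"
      proof
        fix xs assume "xs \<in> {xs. \<bar>X N xs\<bar> \<ge> K}"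
        then have "X N xs \<ge> K \<or> - X N xs \<ge> K" by auto
        moreover have "exp (- X N xs) \<ge> 1 + (- X N xs)" by (rule exp_ge_add_one_self)
        moreover have "exp (- X N xs) > 0" by simp
        ultimately have "X N xs + exp (- X N xs) \<ge> K \<or> exp (- X N xs) \<ge> K" by linarith
        then show "xs \<in> {xs. exp (- X N xs) \<ge> K} \<union> {xs. X N xs + exp (- X N xs) \<ge> K}" by auto
      qed
    qed simp
    also have "\<dots> \<le> Pr (R N) {xs. exp (- X N xs) \<ge> K} + Pr (R N) {xs. X N xs + exp (- X N xs) \<ge> K}"
      by (rule measure_Un_le) auto
    also have "Pr (R N) {xs. exp (- X N xs) \<ge> K} \<le> Mean (R N) (\<lambda>xs. exp (- X N xs)) / K"
      using integral_Markov_inequality_measure[of "R N" "\<lambda>xs. exp (- X N xs)" "{}" K] ie K by simp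
    also have "Pr (R N) {xs. X N xs + exp (- X N xs) \<ge> K} \<le> Mean (R N) (\<lambda>xs. X N xs + exp (- X N xs)) / K"
    proof -
      have "0 \<le> X N xs + exp (- X N xs)" for xs using exp_ge_add_one_self[of "- X N xs"] by linarith
      then show ?thesis
        using integral_Markov_inequality_measure[of "R N" "\<lambda>xs. X N xs + exp (- X N xs)" "{}" K] ie[of N] integrable_X[of N] K by simp
    qed
    also have "Mean (R N) (\<lambda>xs. X N xs + exp (- X N xs)) \<le> C"
      using ie[of N] integrable_X[of N] C[of N] expectation_X[of N] by simp
    finally have "Pr (R N) {xs. \<bar>X N xs\<bar> \<ge> K} \<le> Mean (R N) (\<lambda>xs. exp (- X N xs)) / K + C / K"
      using K by (simp add: divide_right_mono)
    then have "Pr (R N) {xs. \<bar>X N xs\<bar> \<ge> K} \<le> C / K + C / K"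
      using divide_right_mono[OF C[of N] less_imp_le[OF K]] by linarith
    also have "\<dots> < \<epsilon>"
    proof -
      have "2 * C < \<epsilon> * K" using C0 e by (simp add: K_def field_simps)
      then show ?thesis using K by (simp add: field_simps)
    qed
    finally show "Pr (R N) {xs. \<bar>X N xs\<bar> \<ge> K} < \<epsilon>" by simp
  qed
qed

lemma real_distribution_X: "real_distribution (distr (R N) borel (X N))"
  by (rule prob_space.real_distribution_distr[OF measure_pmf.prob_space_axioms]) simp

lemma tight_X:
  assumes b3: "\<beta> < 3" shows "tight (\<lambda>N. distr (R N) borel (X N))"
  unfolding tight_def
proof (intro conjI allI impI real_distribution_X)
  fix \<epsilon> :: real assume "\<epsilon> > 0"
  then obtain K where K: "K > 0" "\<And>N. Pr (R N) {xs. \<bar>X N xs\<bar> \<ge> K} < \<epsilon>"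
    using X_tail[OF b3] by blast
  have "measure (distr (R N) borel (X N)) {-K<..K} > 1 - \<epsilon>" for N
  proof -
    have "1 - Pr (R N) {xs. \<bar>X N xs\<bar> \<ge> K} = Pr (R N) (UNIV - {xs. \<bar>X N xs\<bar> \<ge> K})"
      using measure_pmf.prob_compl[of "{xs. \<bar>X N xs\<bar> \<ge> K}" "R N"] by simp
    also have "\<dots> \<le> Pr (R N) (X N -` {-K<..K})"
      by (intro measure_pmf.finite_measure_mono) auto
    also have "\<dots> = measure (distr (R N) borel (X N)) {-K<..K}"
      by (subst measure_distr) auto
    finally show ?thesis using K(2)[of N] by linarith
  qed
  then show "\<exists>a b. a < b \<and> (\<forall>N. measure (distr (R N) borel (X N)) {a<..b} > 1 - \<epsilon>)"
    using K(1) by (intro exI[of _ "-K"] exI[of _ K]) auto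
qed

lemma stable_limit:
  assumes b3: "\<beta> < 3"
  shows "\<exists>M. real_distribution M \<and>
    (\<forall>t. Re t \<ge> 0 \<longrightarrow> integrable M (\<lambda>x. exp (- t * complex_of_real x)) \<and>
       (\<integral>x. exp (- t * complex_of_real x) \<partial>M) = exp (of_real kappa * t powr of_real \<alpha>)) \<and>
    weak_conv_m (\<lambda>N. distr (R N) borel (X N)) M"
proof (rule laplace_limit_law)
  show "real_distribution (distr (R N) borel (X N))" for N by (rule real_distribution_X)
  show "integrable (distr (R N) borel (X N)) (\<lambda>x. exp (- s * x))" if "s \<ge> 0" for N s
    using integrable_exp_X[OF that, of N] by (subst integrable_distr_eq) auto
  show "(\<lambda>N. \<integral>x. exp (- t * complex_of_real x) \<partial>distr (R N) borel (X N)) \<longlonglongrightarrow> exp (of_real kappa * t powr of_real \<alpha>)" if "Re t \<ge> 0" for t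
    using laplace_X_tendsto[OF b3 that] by (subst integral_distr) auto
  show "tight (\<lambda>N. distr (R N) borel (X N))" by (rule tight_X[OF b3])
qed

end

section \<open>Limit laws of the allocation\<close>

lemma tvd_le:
  assumes "\<And>A. \<bar>Pr p A - Pr q A\<bar> \<le> r"
  shows "0 \<le> tvd p q" "tvd p q \<le> r"
proof -
  show "tvd p q \<le> r" unfolding tvd_def by (rule cSUP_least) (use assms in auto)
  have "bdd_above (range (\<lambda>A. \<bar>Pr p A - Pr q A\<bar>))"
    using assms by (intro bdd_aboveI[of _ r]) auto
  then have "\<bar>Pr p {} - Pr q {}\<bar> \<le> tvd p q"
    unfolding tvd_def by (rule cSUP_upper[OF UNIV_I])
  then show "0 \<le> tvd p q" by simp
qed

lemma real_distribution_law: "real_distribution (law q f)"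
  unfolding law_def by (rule prob_space.real_distribution_distr[OF measure_pmf.prob_space_axioms]) simp

lemma cdf_law: "cdf (law q f) x = Pr q {y. f y \<le> x}"
  unfolding law_def cdf_def by (subst measure_distr) (auto simp: vimage_def)

lemma big_Op_imp_small_op:
  assumes O: "big_Op P Y u" and lim: "(\<lambda>i. u i / v i) \<longlonglongrightarrow> 0"
    and u: "eventually (\<lambda>i. u i > 0) sequentially" and v: "eventually (\<lambda>i. v i > 0) sequentially"
  shows "small_op P Y v"
  unfolding small_op_def
proof (intro allI impI tendstoI)
  fix e r :: real assume e: "e > 0" and r: "r > 0"
  obtain K where K: "eventually (\<lambda>i. Pr (P i) {y. \<bar>Y i y\<bar> > K * u i} < r) sequentially"
    using O r unfolding big_Op_def by blast
  have "(\<lambda>i. \<bar>K\<bar> * (u i / v i)) \<longlonglongrightarrow> \<bar>K\<bar> * 0" by (intro tendsto_intros lim)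
  then have "eventually (\<lambda>i. \<bar>K\<bar> * (u i / v i) < e) sequentially"
    by (rule order_tendstoD) (use e in simp)
  with K u v show "eventually (\<lambda>i. dist (Pr (P i) {y. \<bar>Y i y\<bar> > e * v i}) 0 < r) sequentially"
  proof eventually_elim
    case (elim i)
    have "\<bar>K\<bar> * u i < e * v i" using elim by (simp add: field_simps)
    moreover have "K * u i \<le> \<bar>K\<bar> * u i" using elim by (intro mult_right_mono) auto
    ultimately have "K * u i \<le> e * v i" by linarith
    then have "Pr (P i) {y. \<bar>Y i y\<bar> > e * v i} \<le> Pr (P i) {y. \<bar>Y i y\<bar> > K * u i}"
      by (intro measure_pmf.finite_measure_mono) auto
    then show ?case using elim by simp
  qed
qed

locale condensed_allocation = condensation +
  fixes Q :: "nat \<Rightarrow> (nat \<Rightarrow> nat) pmf"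
  assumes close: "\<And>r. r > 0 \<Longrightarrow> eventually (\<lambda>i. \<forall>A. \<bar>Pr (Q i) {y. map int (ordvec (n i) y) \<in> A}
     - Pr (R (n i - 1)) {xs. condensed (m i) xs \<in> A}\<bar> \<le> r) sequentially"
begin

lemma tvd_tendsto:
  "(\<lambda>i. tvd (map_pmf (\<lambda>y. map int (ordvec (n i) y)) (Q i)) (map_pmf (condensed (m i)) (R (n i - 1)))) \<longlonglongrightarrow> 0"
proof (rule tendstoI)
  fix r :: real assume r: "r > 0"
  then have "r / 2 > 0" by simp
  from close[OF this]
  show "eventually (\<lambda>i. dist (tvd (map_pmf (\<lambda>y. map int (ordvec (n i) y)) (Q i)) (map_pmf (condensed (m i)) (R (n i - 1)))) 0 < r) sequentially"
  proof eventually_elim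
    case (elim i)
    have b: "\<bar>Pr (map_pmf (\<lambda>y. map int (ordvec (n i) y)) (Q i)) A - Pr (map_pmf (condensed (m i)) (R (n i - 1))) A\<bar> \<le> r / 2" for A
      using spec[OF elim, of A] by (simp add: vimage_def)
    show ?case using tvd_le[OF b] r by simp
  qed
qed

lemma prob_transfer:
  assumes lim: "(\<lambda>i. Pr (R (n i - 1)) {xs. condensed (m i) xs \<in> A i}) \<longlonglongrightarrow> l"
  shows "(\<lambda>i. Pr (Q i) {y. map int (ordvec (n i) y) \<in> A i}) \<longlonglongrightarrow> l"
proof -
  have "(\<lambda>i. Pr (Q i) {y. map int (ordvec (n i) y) \<in> A i} - Pr (R (n i - 1)) {xs. condensed (m i) xs \<in> A i}) \<longlonglongrightarrow> 0"
  proof (rule tendstoI)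
    fix r :: real assume r: "r > 0"
    then have "r / 2 > 0" by simp
    from close[OF this]
    show "eventually (\<lambda>i. dist (Pr (Q i) {y. map int (ordvec (n i) y) \<in> A i} - Pr (R (n i - 1)) {xs. condensed (m i) xs \<in> A i}) 0 < r) sequentially"
    proof eventually_elim
      case (elim i)
      from spec[OF elim, of "A i"] show ?case using r by simp
    qed
  qed
  from tendsto_add[OF this lim] show ?thesis by simp
qed

lemma first_transfer:
  assumes lim: "(\<lambda>i. Pr (R (n i - 1)) {xs. real (m i) - real (sum_list xs) \<in> B i}) \<longlonglongrightarrow> l"
  shows "(\<lambda>i. Pr (Q i) {y. real (ordstat (n i) y 1) \<in> B i}) \<longlonglongrightarrow> l"
proof -
  have eq: "{xs. condensed (m i) xs \<in> {L. real_of_int (L ! 0) \<in> B i}} = {xs. real (m i) - real (sum_list xs) \<in> B i}" for i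
    by (simp add: condensed_def)
  have "(\<lambda>i. Pr (R (n i - 1)) {xs. condensed (m i) xs \<in> {L. real_of_int (L ! 0) \<in> B i}}) \<longlonglongrightarrow> l"
    unfolding eq by (rule lim)
  from prob_transfer[OF this]
  show ?thesis
  proof (rule Lim_transform_eventually)
    show "eventually (\<lambda>i. Pr (Q i) {y. map int (ordvec (n i) y) \<in> {L. real_of_int (L ! 0) \<in> B i}} = Pr (Q i) {y. real (ordstat (n i) y 1) \<in> B i}) sequentially"
      using n_pos[of 0] by eventually_elim (simp add: ordstat_def ordvec_def)
  qed
qed

lemma later_transfer:
  assumes lim: "(\<lambda>i. Pr (R (n i - 1)) {xs. real (rev (sort xs) ! k) \<in> B i}) \<longlonglongrightarrow> l"
  shows "(\<lambda>i. Pr (Q i) {y. real (ordstat (n i) y (k + 2)) \<in> B i}) \<longlonglongrightarrow> l"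
proof -
  have "(\<lambda>i. Pr (R (n i - 1)) {xs. condensed (m i) xs \<in> {L. real_of_int (L ! Suc k) \<in> B i}}) \<longlonglongrightarrow> l"
  proof (rule Lim_transform_eventually[OF lim])
    show "eventually (\<lambda>i. Pr (R (n i - 1)) {xs. real (rev (sort xs) ! k) \<in> B i} = Pr (R (n i - 1)) {xs. condensed (m i) xs \<in> {L. real_of_int (L ! Suc k) \<in> B i}}) sequentially"
      using n_pos[of "k + 1"]
    proof eventually_elim
      case (elim i)
      show ?case
        using AE_replicate_pmf_length[of "n i - 1" p]
        by (intro measure_pmf.finite_measure_eq_AE) (use elim in \<open>auto simp: condensed_def sorted_desc_def elim!: eventually_mono\<close>)
    qed
  qed
  from prob_transfer[OF this]
  show ?thesis
  proof (rule Lim_transform_eventually)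
    show "eventually (\<lambda>i. Pr (Q i) {y. map int (ordvec (n i) y) \<in> {L. real_of_int (L ! Suc k) \<in> B i}} = Pr (Q i) {y. real (ordstat (n i) y (k + 2)) \<in> B i}) sequentially"
      using n_pos[of "k + 1"] by eventually_elim (simp add: ordstat_def ordvec_def)
  qed
qed

lemma first_small_op:
  "small_op Q (\<lambda>i y. real (ordstat (n i) y 1) - D * real (n i)) (\<lambda>i. real (n i))"
  unfolding small_op_def
proof (intro allI impI)
  fix e :: real assume e: "e > 0"
  have "(\<lambda>i. Pr (R (n i - 1)) {xs. real (m i) - real (sum_list xs) \<in> {v. \<bar>v - D * real (n i)\<bar> > e * real (n i)}}) \<longlonglongrightarrow> 0"
    using weak_law_shifted[of "e / 4"] e by simp
  from first_transfer[OF this]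
  show "(\<lambda>i. Pr (Q i) {y. \<bar>real (ordstat (n i) y 1) - D * real (n i)\<bar> > e * real (n i)}) \<longlonglongrightarrow> 0" by simp
qed

lemma Suc_n1: "eventually (\<lambda>i. Suc (n i - 1) = n i) sequentially"
  using n_pos[of 0] by eventually_elim simp

lemma later_limit:
  assumes x: "x > 0"
  shows "(\<lambda>i. Pr (Q i) {y. real (ordstat (n i) y (k + 2)) \<le> x * real (n i) powr (1 / \<alpha>)}) \<longlonglongrightarrow> cdf (frechet k) x"
proof -
  have "(\<lambda>i. Pr (R (n i - 1)) {xs. real (rev (sort xs) ! k) \<le> x * real (Suc (n i - 1)) powr (1 / \<alpha>)}) \<longlonglongrightarrow> cdf (frechet k) x"
    using filterlim_compose[OF order_stat_limit[OF x, of k] n1_lim] by (simp only: cdf_frechet[OF x])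
  then have "(\<lambda>i. Pr (R (n i - 1)) {xs. real (rev (sort xs) ! k) \<in> {v. v \<le> x * real (n i) powr (1 / \<alpha>)}}) \<longlonglongrightarrow> cdf (frechet k) x"
    by (rule Lim_transform_eventually) (use Suc_n1 in \<open>eventually_elim, simp\<close>)
  from later_transfer[OF this] show ?thesis by simp
qed

lemma later_big_Op:
  "big_Op Q (\<lambda>i y. real (ordstat (n i) y (k + 2))) (\<lambda>i. real (n i) powr (1 / \<alpha>))"
  unfolding big_Op_def
proof (intro allI impI)
  fix e :: real assume e: "e > 0"
  interpret F: real_distribution "frechet k" by (rule real_distribution_frechet)
  have "eventually (\<lambda>x. cdf (frechet k) x > 1 - e) at_top"
    using F.cdf_lim_at_top_prob by (rule order_tendstoD) (use e in simp)
  then have "eventually (\<lambda>x. cdf (frechet k) x > 1 - e \<and> x > 0) at_top"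
    using eventually_gt_at_top[of 0] by (rule eventually_conj)
  then obtain K where K: "K > 0" "cdf (frechet k) K > 1 - e"
    using eventually_happens[of _ "at_top :: real filter"] by auto
  have "eventually (\<lambda>i. Pr (Q i) {y. \<bar>real (ordstat (n i) y (k + 2))\<bar> > K * real (n i) powr (1 / \<alpha>)} < e) sequentially"
    using order_tendstoD(1)[OF later_limit[OF K(1)] K(2)]
  proof eventually_elim
    case (elim i)
    let ?S = "{y. real (ordstat (n i) y (k + 2)) \<le> K * real (n i) powr (1 / \<alpha>)}"
    have "{y. \<bar>real (ordstat (n i) y (k + 2))\<bar> > K * real (n i) powr (1 / \<alpha>)} = UNIV - ?S" by auto
    then show ?case using elim measure_pmf.prob_compl[of ?S "Q i"] by simp
  qed
  then show "\<exists>K. eventually (\<lambda>i. Pr (Q i) {y. \<bar>real (ordstat (n i) y (k + 2))\<bar> > K * real (n i) powr (1 / \<alpha>)} < e) sequentially" by blast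
qed

lemma scaled_le_iff:
  assumes "N > 0" shows "real N powr (- 1 / \<alpha>) * v \<le> x \<longleftrightarrow> v \<le> x * real N powr (1 / \<alpha>)"
proof -
  have e: "real N powr (- 1 / \<alpha>) = 1 / real N powr (1 / \<alpha>)" by (simp add: powr_minus_divide)
  have "real N powr (1 / \<alpha>) > 0" using assms by simp
  then show ?thesis unfolding e by (simp add: pos_divide_le_eq)
qed

lemma later_weak_conv:
  "weak_conv_m (\<lambda>i. law (Q i) (\<lambda>y. real (n i) powr (- 1 / \<alpha>) * real (ordstat (n i) y (k + 2)))) (frechet k)"
proof (rule weak_conv_m_from_pos[OF real_distribution_law real_distribution_frechet cdf_frechet_0])
  fix x :: real assume x: "x > 0"
  show "(\<lambda>i. cdf (law (Q i) (\<lambda>y. real (n i) powr (- 1 / \<alpha>) * real (ordstat (n i) y (k + 2)))) x) \<longlonglongrightarrow> cdf (frechet k) x"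
    by (rule Lim_transform_eventually[OF later_limit[OF x]])
       (use n_pos[of 0] in \<open>eventually_elim, simp only: cdf_law scaled_le_iff\<close>)
qed

lemma second_small_op: "small_op Q (\<lambda>i y. real (ordstat (n i) y 2)) (\<lambda>i. real (n i))"
proof (rule big_Op_imp_small_op)
  show "big_Op Q (\<lambda>i y. real (ordstat (n i) y 2)) (\<lambda>i. real (n i) powr (1 / \<alpha>))"
    using later_big_Op[of 0] by (simp only: add_0)
  have "((\<lambda>x::real. x powr (1 / \<alpha>) / x) \<longlongrightarrow> 0) at_top"
  proof -
    have "1 / \<alpha> - 1 < 0" using beta by (simp add: field_simps)
    then have "((\<lambda>x::real. x powr (1 / \<alpha> - 1)) \<longlongrightarrow> 0) at_top" by (rule tendsto_neg_powr[OF _ filterlim_ident])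
    then show ?thesis
      by (rule Lim_transform_eventually) (use eventually_gt_at_top[of 0] in \<open>eventually_elim, simp add: powr_diff\<close>)
  qed
  from filterlim_compose[OF this n_real_lim]
  show "(\<lambda>i. real (n i) powr (1 / \<alpha>) / real (n i)) \<longlonglongrightarrow> 0" .
  show "eventually (\<lambda>i. real (n i) powr (1 / \<alpha>) > 0) sequentially" "eventually (\<lambda>i. real (n i) > 0) sequentially"
    using n_pos[of 0] by (eventually_elim, simp)+
qed

lemma first_big_Op:
  assumes b3: "\<beta> < 3"
  shows "big_Op Q (\<lambda>i y. real (ordstat (n i) y 1) - (real (m i) - mu * real (n i))) (\<lambda>i. real (n i) powr (1 / \<alpha>))"
  unfolding big_Op_def
proof (intro allI impI)
  fix e :: real assume e: "e > 0"
  then obtain K where K: "K > 0" "\<And>N. Pr (R N) {xs. \<bar>X N xs\<bar> \<ge> K} < e / 2"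
    using X_tail[OF b3, of "e / 2"] by auto
  let ?B = "\<lambda>i. {v. \<bar>v - (real (m i) - mu * real (n i))\<bar> > K * real (n i) powr (1 / \<alpha>)}"
  let ?A = "\<lambda>i. {L. real_of_int (L ! 0) \<in> ?B i}"
  have "e / 2 > 0" using e by simp
  from close[OF this] n_pos[of 0] Suc_n1
  have "eventually (\<lambda>i. Pr (Q i) {y. real (ordstat (n i) y 1) \<in> ?B i} < e) sequentially"
  proof eventually_elim
    case (elim i)
    have "Pr (R (n i - 1)) {xs. condensed (m i) xs \<in> ?A i} \<le> Pr (R (n i - 1)) {xs. \<bar>X (n i - 1) xs\<bar> \<ge> K}"
    proof (rule measure_pmf.finite_measure_mono)
      show "{xs. condensed (m i) xs \<in> ?A i} \<subseteq> {xs. \<bar>X (n i - 1) xs\<bar> \<ge> K}"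
      proof
        fix xs assume "xs \<in> {xs. condensed (m i) xs \<in> ?A i}"
        then have a: "\<bar>mu * real (n i) - real (sum_list xs)\<bar> > K * real (n i) powr (1 / \<alpha>)" by (simp add: condensed_def)
        have "\<bar>X (n i - 1) xs\<bar> = real (n i) powr (- 1 / \<alpha>) * \<bar>mu * real (n i) - real (sum_list xs)\<bar>"
          unfolding X_def scal_def using elim by (simp add: abs_mult abs_minus_commute mult.commute)
        moreover have "\<not> real (n i) powr (- 1 / \<alpha>) * \<bar>mu * real (n i) - real (sum_list xs)\<bar> \<le> K"
          using a scaled_le_iff[of "n i" "\<bar>mu * real (n i) - real (sum_list xs)\<bar>" K] elim by simp
        ultimately show "xs \<in> {xs. \<bar>X (n i - 1) xs\<bar> \<ge> K}" by simp
      qed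
    qed simp
    then have a: "Pr (R (n i - 1)) {xs. condensed (m i) xs \<in> ?A i} < e / 2" using K(2)[of "n i - 1"] by linarith
    have eq: "{y. map int (ordvec (n i) y) \<in> ?A i} = {y. real (ordstat (n i) y 1) \<in> ?B i}"
      using elim by (simp add: ordstat_def ordvec_def)
    show ?case using a spec[OF elim(1), of "?A i"] unfolding eq by linarith
  qed
  then show "\<exists>K. eventually (\<lambda>i. Pr (Q i) {y. \<bar>real (ordstat (n i) y 1) - (real (m i) - mu * real (n i))\<bar> > K * real (n i) powr (1 / \<alpha>)} < e) sequentially"
    by (intro exI[of _ K]) simp
qed

lemma first_weak_conv:
  assumes wc: "weak_conv_m (\<lambda>N. distr (R N) borel (X N)) M"
  shows "weak_conv_m (\<lambda>i. law (Q i) (\<lambda>y. real (n i) powr (- 1 / \<alpha>) * (real (m i) - mu * real (n i) - real (ordstat (n i) y 1)))) M"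
  unfolding weak_conv_m_def weak_conv_def
proof (intro allI impI)
  fix x assume "isCont (cdf M) x"
  then have "(\<lambda>N. cdf (law (R N) (X N)) x) \<longlonglongrightarrow> cdf M x"
    using wc unfolding weak_conv_m_def weak_conv_def law_def by blast
  then have "(\<lambda>N. Pr (R N) {xs. X N xs \<le> x}) \<longlonglongrightarrow> cdf M x" by (simp only: cdf_law)
  from filterlim_compose[OF this n1_lim]
  have "(\<lambda>i. Pr (R (n i - 1)) {xs. real (m i) - real (sum_list xs) \<in> {v. real (n i) powr (- 1 / \<alpha>) * (real (m i) - mu * real (n i) - v) \<le> x}}) \<longlonglongrightarrow> cdf M x"
  proof (rule Lim_transform_eventually)
    show "eventually (\<lambda>i. Pr (R (n i - 1)) {xs. X (n i - 1) xs \<le> x} =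
       Pr (R (n i - 1)) {xs. real (m i) - real (sum_list xs) \<in> {v. real (n i) powr (- 1 / \<alpha>) * (real (m i) - mu * real (n i) - v) \<le> x}}) sequentially"
      using Suc_n1
    proof eventually_elim
      case (elim i)
      have "X (n i - 1) xs = real (n i) powr (- 1 / \<alpha>) * (real (m i) - mu * real (n i) - (real (m i) - real (sum_list xs)))" for xs
        unfolding X_def scal_def elim by (simp add: mult.commute)
      then show ?case by simp
    qed
  qed
  from first_transfer[OF this]
  show "(\<lambda>i. cdf (law (Q i) (\<lambda>y. real (n i) powr (- 1 / \<alpha>) * (real (m i) - mu * real (n i) - real (ordstat (n i) y 1)))) x) \<longlonglongrightarrow> cdf M x"
    by (simp add: cdf_law)
qed

end

lemma weights_limit:
  fixes w :: "nat \<Rightarrow> real"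
  assumes c: "c > 0" and w: "w \<sim>[sequentially] (\<lambda>k. c * real k powr (- \<beta>))"
  shows "(\<lambda>k. w k * real k powr \<beta>) \<longlonglongrightarrow> c"
proof -
  let ?g = "\<lambda>k::nat. c * real k powr (- \<beta>)"
  have "(\<lambda>k. if w k = 0 \<and> ?g k = 0 then 1 else w k / ?g k) \<longlonglongrightarrow> 1"
    using w unfolding asymp_equiv_def .
  from tendsto_mult[OF tendsto_const[of c] this]
  have "(\<lambda>k. c * (if w k = 0 \<and> ?g k = 0 then 1 else w k / ?g k)) \<longlonglongrightarrow> c" by simp
  then show ?thesis
    by (rule Lim_transform_eventually)
       (use eventually_gt_at_top[of 0] in \<open>eventually_elim, use c in \<open>simp add: powr_minus divide_inverse\<close>\<close>)
qed

lemma Phi_1_pos: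
  fixes w :: "nat \<Rightarrow> real"
  assumes c: "c > 0" and w: "\<And>k. w k \<ge> 0" and lim: "(\<lambda>k. w k * real k powr \<beta>) \<longlonglongrightarrow> c" and S: "summable w"
  shows "Phi w 1 > 0"
proof -
  have "eventually (\<lambda>k. w k * real k powr \<beta> > 0) sequentially" using lim c by (rule order_tendstoD)
  then obtain k where k: "w k * real k powr \<beta> > 0" using eventually_happens by (auto simp: eventually_sequentially)
  then have "w k > 0" using w[of k] by (cases "w k = 0") auto
  then show ?thesis using suminf_pos2[OF S w] by (simp add: Phi_def)
qed

lemma pmf_xi_pmf:
  fixes w :: "nat \<Rightarrow> real"
  assumes w: "\<And>k. w k \<ge> 0" and S: "summable w" and pos: "Phi w 1 > 0"
  shows "pmf (xi_pmf w) k = w k / Phi w 1"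
  unfolding xi_pmf_def
proof (rule pmf_embed_pmf)
  show "0 \<le> w k / Phi w 1" for k using w pos by simp
  have "(\<integral>\<^sup>+k. ennreal (w k / Phi w 1) \<partial>count_space UNIV) = (\<Sum>k. ennreal (w k / Phi w 1))"
    by (rule nn_integral_count_space_nat)
  also have "\<dots> = ennreal (\<Sum>k. w k / Phi w 1)"
    using w pos S by (intro suminf_ennreal2 summable_divide) auto
  also have "(\<Sum>k. w k / Phi w 1) = 1"
    using pos S by (simp add: suminf_divide Phi_def)
  finally show "(\<integral>\<^sup>+k. ennreal (w k / Phi w 1) \<partial>count_space UNIV) = 1" by simp
qed

theorem theorem18p33:
  fixes w :: "nat \<Rightarrow> real" and c \<beta> lam :: real and m n :: "nat \<Rightarrow> nat"
  assumes w_nonneg: "\<And>k. w k \<ge> 0"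
    and c_pos: "c > 0" and beta: "\<beta> > 2"
    and w_asymp: "w \<sim>[sequentially] (\<lambda>k. c * real k powr (- \<beta>))"
  shows "(Psi w \<longlongrightarrow> nu w) (at_left 1) \<and>
    (filterlim n at_top sequentially \<longrightarrow>
     (\<lambda>i. real (m i) / real (n i)) \<longlonglongrightarrow> lam \<longrightarrow>
     lam > nu w \<longrightarrow>
     (\<forall>i. Zmn w (m i) (n i) > 0) \<longrightarrow>
     (let \<alpha> = \<beta> - 1; c' = c / Phi w 1; P = (\<lambda>i. Bmn w (m i) (n i)) in
      \<comment> \<open>(i)\<close>
      small_op P (\<lambda>i y. real (ordstat (n i) y 1) - (lam - nu w) * real (n i)) (\<lambda>i. real (n i)) \<and>
      small_op P (\<lambda>i y. real (ordstat (n i) y 2)) (\<lambda>i. real (n i)) \<and>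
      \<comment> \<open>(ii)\<close>
      (\<lambda>i. Zmn w (m i) (n i)) \<sim>[sequentially]
        (\<lambda>i. c * (lam - nu w) powr (- \<beta>) * Phi w 1 ^ (n i - 1) * real (n i) powr (1 - \<beta>)) \<and>
      \<comment> \<open>(iii)\<close>
      (\<lambda>i. tvd (map_pmf (\<lambda>y. map int (ordvec (n i) y)) (P i))
                (map_pmf (\<lambda>xs. (int (m i) - int (sum_list xs)) # map int (rev (sort xs)))
                         (replicate_pmf (n i - 1) (xi_pmf w)))) \<longlonglongrightarrow> 0 \<and>
      \<comment> \<open>(iv), for 1 < alpha < 2 (see NOTES.md)\<close>
      (\<alpha> < 2 \<longrightarrow>
        big_Op P (\<lambda>i y. real (ordstat (n i) y 1) - (real (m i) - nu w * real (n i)))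
               (\<lambda>i. real (n i) powr (1 / \<alpha>)) \<and>
        (\<exists>M. real_distribution M \<and>
           (\<forall>t::complex. Re t \<ge> 0 \<longrightarrow>
              integrable M (\<lambda>x. exp (- t * complex_of_real x)) \<and>
              (\<integral>x. exp (- t * complex_of_real x) \<partial>M)
                = exp (complex_of_real (c' * Gamma (- \<alpha>)) * t powr complex_of_real \<alpha>)) \<and>
           weak_conv_m (\<lambda>i. law (P i) (\<lambda>y. real (n i) powr (- 1 / \<alpha>) *
                  (real (m i) - nu w * real (n i) - real (ordstat (n i) y 1)))) M)) \<and>
      \<comment> \<open>(v)\<close>
      big_Op P (\<lambda>i y. real (ordstat (n i) y 2)) (\<lambda>i. real (n i) powr (1 / \<alpha>)) \<and>
      (\<exists>M. real_distribution M \<and>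
         (\<forall>x>0. cdf M x = exp (- (c' / \<alpha>) * x powr (- \<alpha>))) \<and>
         weak_conv_m (\<lambda>i. law (P i) (\<lambda>y. real (n i) powr (- 1 / \<alpha>) * real (ordstat (n i) y 2))) M) \<and>
      \<comment> \<open>(vi)\<close>
      (\<forall>j\<ge>2.
        big_Op P (\<lambda>i y. real (ordstat (n i) y j)) (\<lambda>i. real (n i) powr (1 / \<alpha>)) \<and>
        (let M = density lborel (\<lambda>x. ennreal (if x > 0 then
                   c' * x powr (- \<alpha> - 1) * (c' / \<alpha> * x powr (- \<alpha>)) ^ (j - 2) / fact (j - 2)
                   * exp (- (c' / \<alpha>) * x powr (- \<alpha>)) else 0)) in
          real_distribution M \<and>
          weak_conv_m (\<lambda>i. law (P i) (\<lambda>y. real (n i) powr (- 1 / \<alpha>) * real (ordstat (n i) y j))) M \<and>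
          distr M borel (\<lambda>x. c' / \<alpha> * x powr (- \<alpha>))
            = density lborel (\<lambda>x. ennreal (erlang_density (j - 2) 1 x))))))"
proof -
  let ?\<Phi> = "Phi w 1" let ?p = "xi_pmf w" let ?c = "c / Phi w 1"
  have lim: "(\<lambda>k. w k * real k powr \<beta>) \<longlonglongrightarrow> c" by (rule weights_limit[OF c_pos w_asymp])
  note S = summable_weights[OF beta lim w_nonneg]
  have pos: "?\<Phi> > 0" by (rule Phi_1_pos[OF c_pos w_nonneg lim S(2)])
  note p = pmf_xi_pmf[OF w_nonneg S(2) pos]
  interpret heavy_tail ?p ?c \<beta>
  proof
    show "?c > 0" using c_pos pos by simp
    show "(\<lambda>k. pmf ?p k * real k powr \<beta>) \<longlonglongrightarrow> ?c"
      using tendsto_divide[OF lim tendsto_const[of ?\<Phi>]] pos by (simp add: p)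
  qed (rule beta)
  have "(\<lambda>k. pmf ?p k *\<^sub>R real k) sums mu" unfolding mu_def by (rule integral_pmf_nat_sums[OF integrable_real])
  then have "mu = (\<Sum>k. real k * w k / ?\<Phi>)" by (simp add: p sums_iff mult.commute)
  also have "\<dots> = (\<Sum>k. real k * w k) / ?\<Phi>" by (rule suminf_divide[OF S(1)])
  finally have "(Psi w \<longlongrightarrow> mu) (at_left 1)" using Psi_tendsto[OF w_nonneg S pos] by simp
  moreover from this have nu: "nu w = mu" unfolding nu_def by (intro tendsto_Lim) auto
  ultimately have Psi: "(Psi w \<longlongrightarrow> nu w) (at_left 1)" by simp
  show ?thesis
  proof (rule conjI[OF Psi], intro impI, goal_cases)
    case 1
    interpret condensation ?p ?c \<beta> m n lam
      by unfold_locales (use 1 nu in auto)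
    define Q where "Q = (\<lambda>i. Bmn w (m i) (n i))"
    have ordvec: "{y. map int (ordvec N y) \<in> A} = {y. map y [0..<N] \<in> {ys. sorted_desc ys \<in> A}}" for N A
      by (simp add: ordvec_def sorted_desc_def)
    interpret condensed_allocation ?p ?c \<beta> m n lam Q
    proof
      fix r :: real assume "r > 0"
      from conditional_close[OF this]
      show "eventually (\<lambda>i. \<forall>A. \<bar>Pr (Q i) {y. map int (ordvec (n i) y) \<in> A}
         - Pr (R (n i - 1)) {xs. condensed (m i) xs \<in> A}\<bar> \<le> r) sequentially"
        unfolding ordvec Q_def prob_Bmn[OF w_nonneg 1(4)[rule_format] p pos] by simp
    qed
    have DD: "lam - nu w = D" by (simp add: D_def nu)
    have condensed: "condensed (m i) = (\<lambda>xs. (int (m i) - int (sum_list xs)) # map int (rev (sort xs)))" for i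
      by (simp add: fun_eq_iff condensed_def sorted_desc_def)
    have frechet: "frechet k = density lborel (\<lambda>x. ennreal (if x > 0 then
         ?c * x powr (- \<alpha> - 1) * (?c / \<alpha> * x powr (- \<alpha>)) ^ k / fact k * exp (- (?c / \<alpha>) * x powr (- \<alpha>)) else 0))" for k
      unfolding frechet_def frechet_density_def ..
    have theta: "theta = (\<lambda>x. ?c / \<alpha> * x powr (- \<alpha>))"
      by (simp add: fun_eq_iff theta_def)
    have Zasymp: "(\<lambda>i. Zmn w (m i) (n i)) \<sim>[sequentially]
        (\<lambda>i. c * (lam - nu w) powr (- \<beta>) * ?\<Phi> ^ (n i - 1) * real (n i) powr (1 - \<beta>))"
    proof (rule asymp_equivI', rule Lim_transform_eventually[OF prob_sum_asymp])
      show "eventually (\<lambda>i. Pr (R (n i)) {ys. sum_list ys = m i} / (real (n i) * b i) =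
        Zmn w (m i) (n i) / (c * (lam - nu w) powr (- \<beta>) * ?\<Phi> ^ (n i - 1) * real (n i) powr (1 - \<beta>))) sequentially"
        using n_pos[of 0]
      proof eventually_elim
        case (elim i)
        have "c * (lam - nu w) powr (- \<beta>) * ?\<Phi> ^ (n i - 1) * real (n i) powr (1 - \<beta>) = ?\<Phi> ^ n i * (real (n i) * b i)"
        proof -
          have "real (n i) powr (1 - \<beta>) = real (n i) * real (n i) powr (- \<beta>)"
            using elim powr_add[of "real (n i)" 1 "- \<beta>"] by simp
          moreover have "?\<Phi> ^ n i = ?\<Phi> * ?\<Phi> ^ (n i - 1)" using elim by (cases "n i") auto
          moreover have "(D * real (n i)) powr (- \<beta>) = D powr (- \<beta>) * real (n i) powr (- \<beta>)"
            by (rule powr_mult)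
          ultimately show ?thesis using pos by (simp add: DD b_def)
        qed
        then show ?case using pos by (simp add: Zmn_eq_prob[OF p pos])
      qed
    qed
    have second: "big_Op Q (\<lambda>i y. real (ordstat (n i) y 2)) (\<lambda>i. real (n i) powr (1 / \<alpha>))"
      using later_big_Op[of 0] by (simp only: add_0)
    have part4: "\<alpha> < 2 \<longrightarrow>
        big_Op Q (\<lambda>i y. real (ordstat (n i) y 1) - (real (m i) - nu w * real (n i))) (\<lambda>i. real (n i) powr (1 / \<alpha>)) \<and>
        (\<exists>M. real_distribution M \<and>
           (\<forall>t::complex. Re t \<ge> 0 \<longrightarrow>
              integrable M (\<lambda>x. exp (- t * complex_of_real x)) \<and>
              (\<integral>x. exp (- t * complex_of_real x) \<partial>M)
                = exp (complex_of_real (?c * Gamma (- \<alpha>)) * t powr complex_of_real \<alpha>)) \<and>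
           weak_conv_m (\<lambda>i. law (Q i) (\<lambda>y. real (n i) powr (- 1 / \<alpha>) *
                  (real (m i) - nu w * real (n i) - real (ordstat (n i) y 1)))) M)"
      using first_big_Op stable_limit first_weak_conv unfolding nu kappa_def by force
    have part5: "\<exists>M. real_distribution M \<and> (\<forall>x>0. cdf M x = exp (- (?c / \<alpha>) * x powr (- \<alpha>))) \<and>
         weak_conv_m (\<lambda>i. law (Q i) (\<lambda>y. real (n i) powr (- 1 / \<alpha>) * real (ordstat (n i) y 2))) M"
    proof (intro exI conjI allI impI)
      show "real_distribution (frechet 0)" by (rule real_distribution_frechet)
      show "cdf (frechet 0) x = exp (- (?c / \<alpha>) * x powr (- \<alpha>))" if "x > 0" for x
        using theta_pos[OF that] by (simp add: cdf_frechet[OF that] erlang_CDF_def theta_def)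
      show "weak_conv_m (\<lambda>i. law (Q i) (\<lambda>y. real (n i) powr (- 1 / \<alpha>) * real (ordstat (n i) y 2))) (frechet 0)"
        using later_weak_conv[of 0] by (simp only: add_0)
    qed
    have part6: "\<forall>j\<ge>2. big_Op Q (\<lambda>i y. real (ordstat (n i) y j)) (\<lambda>i. real (n i) powr (1 / \<alpha>)) \<and>
        real_distribution (frechet (j - 2)) \<and>
        weak_conv_m (\<lambda>i. law (Q i) (\<lambda>y. real (n i) powr (- 1 / \<alpha>) * real (ordstat (n i) y j))) (frechet (j - 2)) \<and>
        distr (frechet (j - 2)) borel theta = density lborel (\<lambda>x. ennreal (erlang_density (j - 2) 1 x))"
    proof (intro allI impI, goal_cases)
      case (1 j)
      then have j: "j - 2 + 2 = j" by simp
      show ?case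
        using later_big_Op[of "j - 2"] real_distribution_frechet later_weak_conv[of "j - 2"] distr_frechet
        unfolding j by blast
    qed
    show ?case
      unfolding Let_def Q_def[symmetric] frechet[symmetric] theta[symmetric]
      using first_small_op[folded DD] second_small_op Zasymp tvd_tendsto[unfolded condensed] part4 second part5 part6
      by (intro conjI)
  qed
qed

end
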